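(* Let the smoothing kernel satisfy $\varphi\in H^{\lambda,\infty}(\mathbb{R}^2)$ with $\lambda>1$. Consider functions $f=u\chi_\Omega$ such that $\Omega\subset B=\{|\mathbf{x}|<1\}\subset\mathbb{R}^2$ is a compact domain with smooth boundary, $u\in C^\infty(\mathbb{R}^2)$ with $u>0$, and the set $\Upsilon$ of $(s,\theta)$ such that $L(s,\theta)$ is tangent to $\partial\Omega$ on a disconnected set or at a single point with zero curvature is finite. Then $\mathcal{R}f$ determines $\partial\Omega$; that is, if $f_1=u_1\chi_{\Omega_1}$ and $f_2=u_2\chi_{\Omega_2}$ both satisfy these conditions and $\mathcal{R}f_1=\mathcal{R}f_2$, then $\partial\Omega_1=\partial\Omega_2$.
   Context: Fourier transform: $\hat f(\xi)=\int e^{-i\mathbf{x}\cdot\xi}f(\mathbf{x})\,d\mathbf{x}$. $H^{\lambda,\infty}(\mathbb{R}^2)$ is the space of tempered distributions $f$ whose Fourier transform is a measurable function with $\|(1+|\xi|^2)^{\lambda/2}\hat f\|_{L^\infty(\mathbb{R}^2)}<\infty$. Fix $a,b>0$ and $2\psi\in(0,\pi)$. The V-line transform is $$\mathcal{V}_{a,b}f(\mathbf{x},\phi)=a\int_0^\infty f(\mathbf{x}+t\Phi)\,dt+b\int_0^\infty f(\mathbf{x}+t\Phi')\,dt,$$ with $\Phi=(\cos(\phi+2\psi-\pi/2),\sin(\phi+2\psi-\pi/2))$, $\Phi'=(\cos(\phi-\pi/2),\sin(\phi-\pi/2))$. Its smoothed version is $\widetilde{\mathcal{V}_{a,b}}f(\cdot,\phi)=\varphi*\mathcal{V}_{a,b}f(\cdot,\phi)$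 (convolution in $\mathbf{x}$), where $\varphi\ge0$ is a smoothing kernel with bounded support and $\int_{\mathbb{R}^2}\varphi=1$. For $s\in\mathbb{R}$, $\theta\in[-\pi,\pi]$ let $\Theta=(\cos\theta,\sin\theta)$ and $L(s,\theta)=\{\mathbf{x}\in\mathbb{R}^2:\mathbf{x}\cdot\Theta=s\}$. The non-linear transform is $$\mathcal{R}f(s,\theta)=c_0\int_{L(s,\theta)}w(\mathbf{x})f(\mathbf{x})e^{-\widetilde{\mathcal{V}_{a,b}}f(\mathbf{x},\theta)}\,dl(\mathbf{x}),\qquad s\in\mathbb{R},\ \theta\in[-\pi,\pi],$$ where $c_0>0$ is a constant, $w$ is a fixed smooth weight with $w>0$ on $B$, and $dl$ is arc length. The data $a,b,\psi,\varphi,c_0,w$ are fixed (the same for all $f$). *)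

theory Defs
  imports "HOL-Probability.Probability"
begin

primrec higher_differentiable_on ::
  "'a::real_normed_vector set \<Rightarrow> ('a \<Rightarrow> 'b::real_normed_vector) \<Rightarrow> nat \<Rightarrow> bool" where
  "higher_differentiable_on S f 0 \<longleftrightarrow> continuous_on S f"
| "higher_differentiable_on S f (Suc n) \<longleftrightarrow>
     (\<forall>x\<in>S. f differentiable (at x)) \<and>
     (\<forall>v. higher_differentiable_on S (\<lambda>x. frechet_derivative f (at x) v) n)"

text \<open>Meant for open \<open>S\<close>, where it is $C^\infty(S)$.\<close>
definition smooth_on ::
  "'a::real_normed_vector set \<Rightarrow> ('a \<Rightarrow> 'b::real_normed_vector) \<Rightarrow> bool" where
  "smooth_on S f \<longleftrightarrow> (\<forall>n. higher_differentiable_on S f n)"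

definition fourier :: "(real^2 \<Rightarrow> complex) \<Rightarrow> real^2 \<Rightarrow> complex" where
  "fourier f \<xi> = (LINT x|lborel. cis (- (x \<bullet> \<xi>)) * f x)"

text \<open>
  The integrable members of $H^{\lambda,\infty}(\mathbb{R}^2)$.  An $L^1$ function is a tempered
  distribution whose Fourier transform is the function given by the integral above, so no
  distribution theory is needed.  Only kernels with integral 1 are tested for membership, and
  these are integrable.  The library's \<open>esssup\<close> of a non-measurable function is \<open>\<infinity>\<close>.
\<close>
definition sobolev_inf :: "real \<Rightarrow> (real^2 \<Rightarrow> complex) set" where
  "sobolev_inf l = {f. integrable lborel f \<and>
     esssup lborel (\<lambda>\<xi>. ereal ((1 + (norm \<xi>)\<^sup>2) powr (l / 2) * cmod (fourier f \<xi>))) < \<infinity>}"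

definition smoothing_kernel :: "(real^2 \<Rightarrow> real) \<Rightarrow> bool" where
  "smoothing_kernel \<phi> \<longleftrightarrow>
     (\<forall>x. \<phi> x \<ge> 0) \<and> bounded {x. \<phi> x \<noteq> 0} \<and>
     integrable lborel \<phi> \<and> (LINT x|lborel. \<phi> x) = 1"

definition dir :: "real \<Rightarrow> real^2" where
  "dir \<theta> = vector [cos \<theta>, sin \<theta>]"

definition V_line ::
  "real \<Rightarrow> real \<Rightarrow> real \<Rightarrow> (real^2 \<Rightarrow> real) \<Rightarrow> real^2 \<Rightarrow> real \<Rightarrow> real" where
  "V_line a b \<psi> f x \<alpha> =
     a * (LINT t:{0..}|lborel. f (x + t *\<^sub>R dir (\<alpha> + 2 * \<psi> - pi / 2))) +
     b * (LINT t:{0..}|lborel. f (x + t *\<^sub>R dir (\<alpha> - pi / 2)))"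

definition convolution :: "(real^2 \<Rightarrow> real) \<Rightarrow> (real^2 \<Rightarrow> real) \<Rightarrow> real^2 \<Rightarrow> real" where
  "convolution g h x = (LINT y|lborel. g (x - y) * h y)"

definition V_smooth ::
  "real \<Rightarrow> real \<Rightarrow> real \<Rightarrow> (real^2 \<Rightarrow> real) \<Rightarrow> (real^2 \<Rightarrow> real) \<Rightarrow> real^2 \<Rightarrow> real \<Rightarrow> real" where
  "V_smooth a b \<psi> \<phi> f x \<alpha> = convolution \<phi> (\<lambda>y. V_line a b \<psi> f y \<alpha>) x"

definition line :: "real \<Rightarrow> real \<Rightarrow> (real^2) set" where
  "line s \<theta> = {x. x \<bullet> dir \<theta> = s}"

text \<open>Integral over \<open>line s \<theta>\<close> by arc length, in the unit speed parametrisation of that line.\<close>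
definition line_integral :: "real \<Rightarrow> real \<Rightarrow> (real^2 \<Rightarrow> real) \<Rightarrow> real" where
  "line_integral s \<theta> g = (LINT t|lborel. g (s *\<^sub>R dir \<theta> + t *\<^sub>R dir (\<theta> + pi / 2)))"

definition R_transform ::
  "real \<Rightarrow> real \<Rightarrow> real \<Rightarrow> (real^2 \<Rightarrow> real) \<Rightarrow> real \<Rightarrow> (real^2 \<Rightarrow> real) \<Rightarrow>
   (real^2 \<Rightarrow> real) \<Rightarrow> real \<Rightarrow> real \<Rightarrow> real" where
  "R_transform a b \<psi> \<phi> c0 w f s \<theta> =
     c0 * line_integral s \<theta> (\<lambda>x. w x * f x * exp (- V_smooth a b \<psi> \<phi> f x \<theta>))"

definition smooth_boundary :: "(real^2) set \<Rightarrow> bool" where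
  "smooth_boundary \<Omega> \<longleftrightarrow>
     (\<forall>p\<in>frontier \<Omega>. \<exists>U (\<rho> :: real^2 \<Rightarrow> real).
        open U \<and> p \<in> U \<and> smooth_on U \<rho> \<and>
        (\<forall>x\<in>U. \<exists>v. frechet_derivative \<rho> (at x) v \<noteq> 0) \<and>
        \<Omega> \<inter> U = {x\<in>U. \<rho> x \<le> 0})"

text \<open>A compact domain is the compact closure of a nonempty connected open set.
  The boundary may have several components.\<close>
definition compact_smooth_domain :: "(real^2) set \<Rightarrow> bool" where
  "compact_smooth_domain \<Omega> \<longleftrightarrow>
     compact \<Omega> \<and> interior \<Omega> \<noteq> {} \<and> connected (interior \<Omega>) \<and>
     closure (interior \<Omega>) = \<Omega> \<and> smooth_boundary \<Omega>"

definition velocity :: "(real \<Rightarrow> real^2) \<Rightarrow> real \<Rightarrow> real^2" where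
  "velocity \<gamma> t = vector_derivative \<gamma> (at t)"

definition curvature :: "(real \<Rightarrow> real^2) \<Rightarrow> real \<Rightarrow> real" where
  "curvature \<gamma> t =
     (let v = velocity \<gamma> t; a = velocity (velocity \<gamma>) t
      in (v $ 1 * a $ 2 - v $ 2 * a $ 1) / norm v ^ 3)"

text \<open>If \<open>S\<close> is the boundary of a smooth domain, any two such curves through \<open>p\<close> are
  reparametrisations of each other near \<open>p\<close>.  The tangent direction at \<open>p\<close>, and the curvature
  at \<open>p\<close> up to sign, are therefore independent of the curve, and the two existential
  definitions below are statements about \<open>S\<close> alone.\<close>
definition regular_curve_through :: "(real^2) set \<Rightarrow> real^2 \<Rightarrow> (real \<Rightarrow> real^2) \<Rightarrow> bool" where
  "regular_curve_through S p \<gamma> \<longleftrightarrow>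
     (\<exists>r>0. smooth_on {-r<..<r} \<gamma> \<and> (\<forall>t\<in>{-r<..<r}. velocity \<gamma> t \<noteq> 0) \<and>
        \<gamma> ` {-r<..<r} \<subseteq> S \<and> \<gamma> 0 = p)"

definition tangent_points :: "(real^2) set \<Rightarrow> real \<Rightarrow> real \<Rightarrow> (real^2) set" where
  "tangent_points S s \<theta> =
     {p \<in> S \<inter> line s \<theta>. \<exists>\<gamma>. regular_curve_through S p \<gamma> \<and> velocity \<gamma> 0 \<bullet> dir \<theta> = 0}"

definition zero_curvature_at :: "(real^2) set \<Rightarrow> real^2 \<Rightarrow> bool" where
  "zero_curvature_at S p \<longleftrightarrow> (\<exists>\<gamma>. regular_curve_through S p \<gamma> \<and> curvature \<gamma> 0 = 0)"

definition Upsilon :: "(real^2) set \<Rightarrow> (real \<times> real) set" where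
  "Upsilon \<Omega> = {(s, \<theta>). \<theta> \<in> {-pi..pi} \<and>
     (\<not> connected (tangent_points (frontier \<Omega>) s \<theta>) \<or>
      (\<exists>p. tangent_points (frontier \<Omega>) s \<theta> = {p} \<and> zero_curvature_at (frontier \<Omega>) p))}"

definition cutoff :: "(real^2 \<Rightarrow> real) \<Rightarrow> (real^2) set \<Rightarrow> real^2 \<Rightarrow> real" where
  "cutoff u \<Omega> x = u x * indicator \<Omega> x"

definition admissible :: "(real^2) set \<Rightarrow> (real^2 \<Rightarrow> real) \<Rightarrow> bool" where
  "admissible \<Omega> u \<longleftrightarrow>
     compact_smooth_domain \<Omega> \<and> \<Omega> \<subseteq> ball 0 1 \<and>
     smooth_on UNIV u \<and> (\<forall>x. u x > 0) \<and> finite (Upsilon \<Omega>)"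

end

theory Submission
  imports Defs
begin

text \<open>
  For a fixed direction \<open>\<theta>\<close> the data are integrals over chords, as functions of the offset \<open>s\<close>. The
  decay of the Fourier transform puts the kernel in $L^2$, and \<open>cutoff u \<Omega>\<close> changes by
  \<open>O(sqrt d)\<close> in $L^2$ under a translation by \<open>d\<close>; splitting off the bounded part of the kernel shows
  that the exponential factor varies by \<open>o(sqrt d)\<close>. At a line that is nowhere tangent to
  the boundary the data therefore vary by \<open>o(sqrt d)\<close>, while a single tangency at a point of nonzero
  curvature changes the length of the chord by at least a multiple of \<open>sqrt d\<close>. Hence, with finitely
  many exceptional directions, the lines tangent to one boundary at a point of nonzero curvature are
  also tangent to the other one. By Sard's theorem the points of tangency with the second boundary may
  be taken nondegenerate, and differentiating the family of tangent lines shows that the points of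
  tangency agree. So the points of nonzero curvature of each boundary lie on the other one. In a
  common frame the two boundaries are then graphs whose difference has vanishing second derivative, so
  the boundaries agree near every accumulation point of their intersection. Those points form a closed
  and relatively open subset of each boundary, whose complement is empty because its farthest point
  from the origin would have nonzero curvature.
\<close>

subsection \<open>Smooth functions\<close>

text \<open>The attenuation factor depends on the unknown function and differs between the two
  sides, so it cannot be cancelled; it can only be shown negligible against the square root of the
  displacement. A kernel in L2 and Cauchy-Schwarz give a bound of exactly that order, one step
  short, which is why the kernel has to be split. The condition \<lambda> > 1 is what makes (1 +
  |\<xi>|^2)^(-\<lambda>) integrable over the plane.

  Equality of the data says little about a tangent line of one boundary: it touches the other one
  somewhere, with no control of the point, of the curvature there, or of the dependence on the line.
  Compactness supplies limits of such points, regular slopes make the limits nondegenerate, and the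
  envelope of a family of lines, which the lines alone determine, identifies them. Flat parts of a
  boundary are never detected in this way; they are recovered only through the comparison of two
  graphs.\<close>

lemma higher_differentiable_on_cong:
  assumes "open S" "\<And>x. x \<in> S \<Longrightarrow> f x = g x"
  shows "higher_differentiable_on S f n \<longleftrightarrow> higher_differentiable_on S g n"
  using assms(2)
proof (induction n arbitrary: f g)
  case 0
  then show ?case by (simp cong: continuous_on_cong)
next
  case (Suc n)
  have hd: "(f has_derivative D) (at x) \<longleftrightarrow> (g has_derivative D) (at x)" if "x \<in> S" for x D
    using has_derivative_transform_within_open[of f D x UNIV S g]
      has_derivative_transform_within_open[of g D x UNIV S f] that assms(1) Suc.prems by auto
  have 1: "f differentiable (at x) \<longleftrightarrow> g differentiable (at x)" if "x \<in> S" for x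
    using hd[OF that] by (simp add: differentiable_def)
  have 2: "frechet_derivative f (at x) v = frechet_derivative g (at x) v" if "x \<in> S" for x v
    using hd[OF that] by (simp add: frechet_derivative_def)
  have "higher_differentiable_on S (\<lambda>x. frechet_derivative f (at x) v) n \<longleftrightarrow>
    higher_differentiable_on S (\<lambda>x. frechet_derivative g (at x) v) n" for v
    by (rule Suc.IH) (rule 2)
  then show ?case using 1 by simp
qed

lemma higher_differentiable_on_Suc_D:
  "higher_differentiable_on S f (Suc n) \<Longrightarrow> higher_differentiable_on S f n"
proof (induction n arbitrary: f)
  case 0
  then have "\<forall>x\<in>S. f differentiable (at x)" by simp
  then have "\<forall>x\<in>S. isCont f x" using differentiable_imp_continuous_within by blast
  then show ?case by (simp add: continuous_at_imp_continuous_on)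
next
  case (Suc n)
  have "higher_differentiable_on S (\<lambda>x. frechet_derivative f (at x) v) n" for v
    using Suc.prems by (intro Suc.IH) (auto simp only: higher_differentiable_on.simps)
  then show ?case using Suc.prems by simp
qed

lemma higher_differentiable_on_subset:
  assumes "higher_differentiable_on S f n" "T \<subseteq> S"
  shows "higher_differentiable_on T f n"
  using assms(1)
proof (induction n arbitrary: f)
  case 0
  then show ?case using continuous_on_subset[OF _ assms(2)] by simp
next
  case (Suc n)
  then show ?case using assms(2) by (simp add: subset_iff)
qed

lemma smooth_on_subset: "smooth_on S f \<Longrightarrow> T \<subseteq> S \<Longrightarrow> smooth_on T f"
  unfolding smooth_on_def by (blast intro: higher_differentiable_on_subset)

lemma higher_differentiable_on_const: "higher_differentiable_on S (\<lambda>x. c) n"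
  by (induction n arbitrary: c) simp_all

text \<open>\<open>frechet_derivative\<close> is a choice operator; this rule lets a derivative
  found by the usual calculus take its place, so that the closure properties below become inductions
  on the order with an explicit formula for the derivative.\<close>

lemma higher_differentiable_on_SucI:
  assumes "open S" "\<And>x. x \<in> S \<Longrightarrow> (f has_derivative f' x) (at x)"
    "\<And>v. higher_differentiable_on S (\<lambda>x. f' x v) n"
  shows "higher_differentiable_on S f (Suc n)"
proof -
  have 1: "frechet_derivative f (at x) = f' x" if "x \<in> S" for x
    using assms(2)[OF that] frechet_derivative_at by metis
  have "higher_differentiable_on S (\<lambda>x. frechet_derivative f (at x) v) n" for v
    using higher_differentiable_on_cong[OF assms(1), of "\<lambda>x. frechet_derivative f (at x) v" "\<lambda>x. f' x v"]
      assms(3) 1 by metis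
  then show ?thesis using assms(2) by (auto simp: differentiable_def)
qed

lemma higher_differentiable_on_SucE:
  assumes "higher_differentiable_on S f (Suc n)" "x \<in> S"
  shows "(f has_derivative frechet_derivative f (at x)) (at x)"
  using assms frechet_derivative_works by auto

lemma higher_differentiable_on_linear:
  assumes "open S" "bounded_linear A" "higher_differentiable_on S f n"
  shows "higher_differentiable_on S (\<lambda>x. A (f x)) n"
  using assms(3)
proof (induction n arbitrary: f)
  case 0
  then show ?case by (simp add: bounded_linear.continuous_on[OF assms(2)])
next
  case (Suc n)
  show ?case
  proof (rule higher_differentiable_on_SucI[OF assms(1)])
    fix x assume "x \<in> S"
    then show "((\<lambda>x. A (f x)) has_derivative (\<lambda>v. A (frechet_derivative f (at x) v))) (at x)"
      by (intro bounded_linear.has_derivative[OF assms(2)] higher_differentiable_on_SucE[OF Suc.prems])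
  next
    fix v show "higher_differentiable_on S (\<lambda>x. A (frechet_derivative f (at x) v)) n"
      using Suc by auto
  qed
qed

lemma higher_differentiable_on_add:
  assumes "open S" "higher_differentiable_on S f n" "higher_differentiable_on S g n"
  shows "higher_differentiable_on S (\<lambda>x. f x + g x) n"
  using assms(2,3)
proof (induction n arbitrary: f g)
  case 0
  then show ?case by (auto intro: continuous_intros)
next
  case (Suc n)
  show ?case
  proof (rule higher_differentiable_on_SucI[OF assms(1)])
    fix x assume "x \<in> S"
    then show "((\<lambda>x. f x + g x) has_derivative
      (\<lambda>v. frechet_derivative f (at x) v + frechet_derivative g (at x) v)) (at x)"
      by (intro has_derivative_add higher_differentiable_on_SucE[OF Suc.prems(1)]
          higher_differentiable_on_SucE[OF Suc.prems(2)])
  qed (use Suc in auto)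
qed

lemma higher_differentiable_on_bilinear:
  assumes "open S" "bounded_bilinear B" "higher_differentiable_on S f n" "higher_differentiable_on S g n"
  shows "higher_differentiable_on S (\<lambda>x. B (f x) (g x)) n"
  using assms(3,4)
proof (induction n arbitrary: f g)
  case 0
  then show ?case by (simp add: bounded_bilinear.continuous_on[OF assms(2)])
next
  case (Suc n)
  show ?case
  proof (rule higher_differentiable_on_SucI[OF assms(1)])
    fix x assume "x \<in> S"
    then show "((\<lambda>x. B (f x) (g x)) has_derivative
      (\<lambda>v. B (f x) (frechet_derivative g (at x) v) + B (frechet_derivative f (at x) v) (g x))) (at x)"
      by (intro bounded_bilinear.FDERIV[OF assms(2)] higher_differentiable_on_SucE[OF Suc.prems(1)]
          higher_differentiable_on_SucE[OF Suc.prems(2)])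
  next
    fix v
    note Suc.prems[THEN higher_differentiable_on_Suc_D]
    moreover have "higher_differentiable_on S (\<lambda>x. frechet_derivative f (at x) v) n"
      "higher_differentiable_on S (\<lambda>x. frechet_derivative g (at x) v) n"
      using Suc.prems by auto
    ultimately show "higher_differentiable_on S (\<lambda>x. B (f x) (frechet_derivative g (at x) v) +
        B (frechet_derivative f (at x) v) (g x)) n"
      by (intro higher_differentiable_on_add[OF assms(1)] Suc.IH)
  qed
qed

text \<open>The derivative of the inverse contains the inverse again, but only smoothness of order
  \<open>n\<close> is asked of it, so the induction hypothesis and the product rule close the
  step.\<close>

lemma higher_differentiable_on_inverse:
  fixes f :: "'a::real_normed_vector \<Rightarrow> real"
  assumes "open S" "\<And>x. x \<in> S \<Longrightarrow> f x \<noteq> 0" "higher_differentiable_on S f n"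
  shows "higher_differentiable_on S (\<lambda>x. inverse (f x)) n"
  using assms(3)
proof (induction n)
  case 0
  then show ?case using assms(2) by (auto intro: continuous_intros)
next
  case (Suc n)
  have i: "higher_differentiable_on S (\<lambda>x. inverse (f x)) n"
    using Suc higher_differentiable_on_Suc_D by blast
  note mult = higher_differentiable_on_bilinear[OF assms(1) bounded_bilinear_mult]
  show ?case
  proof (rule higher_differentiable_on_SucI[OF assms(1)])
    fix x assume "x \<in> S"
    then show "((\<lambda>x. inverse (f x)) has_derivative
      (\<lambda>v. - (inverse (f x) * frechet_derivative f (at x) v * inverse (f x)))) (at x)"
      by (intro Deriv.has_derivative_inverse assms(2) higher_differentiable_on_SucE[OF Suc.prems])
  next
    fix v
    have "higher_differentiable_on S (\<lambda>x. frechet_derivative f (at x) v) n"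
      using Suc.prems by auto
    then have "higher_differentiable_on S (\<lambda>x. inverse (f x) * frechet_derivative f (at x) v * inverse (f x)) n"
      using i by (intro mult)
    then show "higher_differentiable_on S (\<lambda>x. - (inverse (f x) * frechet_derivative f (at x) v * inverse (f x))) n"
      by (rule higher_differentiable_on_linear[OF assms(1) bounded_linear_minus[OF bounded_linear_ident]])
  qed
qed

lemma smooth_on_id: "open S \<Longrightarrow> smooth_on S (\<lambda>x. x)"
  unfolding smooth_on_def
proof
  fix n assume "open S"
  then show "higher_differentiable_on S (\<lambda>x. x) n"
    by (cases n) (auto simp only: higher_differentiable_on.simps(1)
      intro!: continuous_on_id higher_differentiable_on_SucI[of _ _ "\<lambda>x v. v"]
        higher_differentiable_on_const has_derivative_ident)
qed

lemma smooth_on_linear: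
  "open S \<Longrightarrow> bounded_linear A \<Longrightarrow> smooth_on S f \<Longrightarrow> smooth_on S (\<lambda>x. A (f x))"
  by (simp add: smooth_on_def higher_differentiable_on_linear)

lemma smooth_on_add:
  "open S \<Longrightarrow> smooth_on S f \<Longrightarrow> smooth_on S g \<Longrightarrow> smooth_on S (\<lambda>x. f x + g x)"
  by (simp add: smooth_on_def higher_differentiable_on_add)

lemma smooth_on_bilinear:
  "open S \<Longrightarrow> bounded_bilinear B \<Longrightarrow> smooth_on S f \<Longrightarrow> smooth_on S g \<Longrightarrow> smooth_on S (\<lambda>x. B (f x) (g x))"
  by (simp add: smooth_on_def higher_differentiable_on_bilinear)

lemma smooth_on_inverse:
  fixes f :: "'a::real_normed_vector \<Rightarrow> real"
  shows "open S \<Longrightarrow> smooth_on S f \<Longrightarrow> (\<And>x. x \<in> S \<Longrightarrow> f x \<noteq> 0) \<Longrightarrow> smooth_on S (\<lambda>x. inverse (f x))"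
  by (simp add: smooth_on_def higher_differentiable_on_inverse)

lemma smooth_on_has_derivative:
  assumes "smooth_on S f" "x \<in> S"
  shows "(f has_derivative frechet_derivative f (at x)) (at x)"
proof -
  have "higher_differentiable_on S f (Suc 0)" using assms(1) unfolding smooth_on_def ..
  then show ?thesis using assms(2) by (rule higher_differentiable_on_SucE)
qed

lemma smooth_on_continuous_on:
  assumes "smooth_on S f" shows "continuous_on S f"
proof -
  have "higher_differentiable_on S f 0" using assms unfolding smooth_on_def ..
  then show ?thesis by simp
qed

lemma smooth_on_frechet:
  assumes "smooth_on S f" shows "smooth_on S (\<lambda>x. frechet_derivative f (at x) v)"
  unfolding smooth_on_def
proof
  fix n
  have "higher_differentiable_on S f (Suc n)" using assms unfolding smooth_on_def ..
  then show "higher_differentiable_on S (\<lambda>x. frechet_derivative f (at x) v) n" by simp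
qed

text \<open>Smoothness along a curve without a chain rule of higher order. The velocity of
  \<open>c\<close> is a smooth function of the position, so the derivative of \<open>h (c t)\<close>
  is again of the form \<open>H (c t)\<close> with \<open>H\<close> smooth on \<open>U\<close>.
  Implicitly defined graphs satisfy such an equation, and their smoothness comes from here.\<close>

lemma smooth_on_integral_curve:
  fixes c :: "real \<Rightarrow> 'a::real_normed_vector" and h :: "'a \<Rightarrow> 'b::real_normed_vector"
  assumes "open I" "open U" "\<And>t. t \<in> I \<Longrightarrow> c t \<in> U"
    and "smooth_on U q"
    and c: "\<And>t. t \<in> I \<Longrightarrow> (c has_vector_derivative (e + q (c t) *\<^sub>R d)) (at t)"
    and "smooth_on U h"
  shows "smooth_on I (\<lambda>t. h (c t))"
  unfolding smooth_on_def
proof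
  fix n
  show "higher_differentiable_on I (\<lambda>t. h (c t)) n"
    using \<open>smooth_on U h\<close>
  proof (induction n arbitrary: h)
    case 0
    have "continuous_on I c"
      using has_vector_derivative_continuous[OF c] by (simp add: continuous_at_imp_continuous_on)
    then show ?case
      unfolding higher_differentiable_on.simps
      by (rule continuous_on_compose2[OF smooth_on_continuous_on[OF 0]]) (use assms(3) in auto)
  next
    case (Suc n)
    \<comment> \<open>\<open>H\<close> is the derivative of \<open>h\<close> along the field
      \<open>e + q x *\<^sub>R d\<close>. The induction is generalised over \<open>h\<close> because
      the next step is about \<open>H\<close>.\<close>
    define H where "H x = frechet_derivative h (at x) e + q x *\<^sub>R frechet_derivative h (at x) d" for x
    have sH: "smooth_on U H"
      unfolding H_def
      by (rule smooth_on_add[OF \<open>open U\<close> smooth_on_frechet[OF Suc.prems]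
          smooth_on_bilinear[OF \<open>open U\<close> bounded_bilinear_scaleR \<open>smooth_on U q\<close> smooth_on_frechet[OF Suc.prems]]])
    show ?case
    proof (rule higher_differentiable_on_SucI[OF \<open>open I\<close>])
      fix t assume t: "t \<in> I"
      have d: "(h has_derivative frechet_derivative h (at (c t))) (at (c t))"
        using smooth_on_has_derivative[OF Suc.prems] assms(3) t by blast
      then interpret bounded_linear "frechet_derivative h (at (c t))"
        by (rule has_derivative_bounded_linear)
      have "((\<lambda>t. h (c t)) has_derivative
        (\<lambda>v. frechet_derivative h (at (c t)) (v *\<^sub>R (e + q (c t) *\<^sub>R d)))) (at t)"
        using has_derivative_compose[OF c[OF t, unfolded has_vector_derivative_def] d] .
      then show "((\<lambda>t. h (c t)) has_derivative (\<lambda>v. v *\<^sub>R H (c t))) (at t)"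
        by (simp add: H_def add scale)
    next
      fix v :: real
      show "higher_differentiable_on I (\<lambda>t. v *\<^sub>R H (c t)) n"
        using Suc.IH[OF sH] by (rule higher_differentiable_on_linear[OF \<open>open I\<close> bounded_linear_scaleR_right])
    qed
  qed
qed

subsection \<open>Smooth boundaries as graphs\<close>

text \<open>Cartesian coordinates in the frame turned by \<theta>. With \<open>s\<close> fixed this
  is the parametrisation of \<open>line s \<theta>\<close> in \<open>line_integral\<close>; for a
  boundary written as s = g t, the tangent vector of slope \<open>m\<close> is
  \<open>pt \<theta> m 1\<close>.\<close>

definition pt :: "real \<Rightarrow> real \<Rightarrow> real \<Rightarrow> real^2" where
  "pt \<theta> s t = s *\<^sub>R dir \<theta> + t *\<^sub>R dir (\<theta> + pi / 2)"

lemma inner_real2: "(x::real^2) \<bullet> y = x $ 1 * y $ 1 + x $ 2 * y $ 2"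
  by (simp add: inner_vec_def sum_2)

lemma dir_nth [simp]: "dir \<theta> $ 1 = cos \<theta>" "dir \<theta> $ 2 = sin \<theta>"
  by (simp_all add: dir_def)

lemma dir_inner_self [simp]: "dir \<theta> \<bullet> dir \<theta> = 1"
  by (simp add: inner_real2 flip: power2_eq_square)

lemma norm_dir [simp]: "norm (dir \<theta>) = 1"
  by (simp add: norm_eq_1)

lemma dir_inner_normal [simp]: "dir \<theta> \<bullet> dir (\<theta> + pi / 2) = 0" "dir (\<theta> + pi / 2) \<bullet> dir \<theta> = 0"
  by (simp_all add: inner_real2 sin_add cos_add)

lemma pt_inner [simp]: "pt \<theta> s t \<bullet> dir \<theta> = s" "pt \<theta> s t \<bullet> dir (\<theta> + pi / 2) = t"
  by (simp_all add: pt_def inner_add_left)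

lemma pt_inner_eq: "pt \<theta> (x \<bullet> dir \<theta>) (x \<bullet> dir (\<theta> + pi / 2)) = x"
proof -
  have s: "sin \<theta> * sin \<theta> = 1 - cos \<theta> * cos \<theta>"
    using sin_cos_squared_add[of \<theta>] by (simp add: power2_eq_square algebra_simps)
  show ?thesis
    by (simp add: vec_eq_iff forall_2 pt_def inner_real2 sin_add cos_add ring_distribs)
       (simp add: s mult.assoc mult.left_commute[of "sin \<theta>"] mult.left_commute[of "cos \<theta>"], simp add: algebra_simps)
qed

lemma pt_cases: obtains s t where "x = pt \<theta> s t"
  using pt_inner_eq by metis

lemma pt_eq_iff [simp]: "pt \<theta> s t = pt \<theta> s' t' \<longleftrightarrow> s = s' \<and> t = t'"
  by (metis pt_inner)

lemma pt_diff: "pt \<theta> s t - pt \<theta> s' t' = pt \<theta> (s - s') (t - t')"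
  by (simp add: pt_def algebra_simps)

lemma norm_pt_le: "norm (pt \<theta> s t) \<le> \<bar>s\<bar> + \<bar>t\<bar>"
  unfolding pt_def by (rule order_trans[OF norm_triangle_ineq]) simp

lemma dist_pt_le: "dist (pt \<theta> s t) (pt \<theta> s' t') \<le> \<bar>s - s'\<bar> + \<bar>t - t'\<bar>"
  by (simp add: dist_norm pt_diff norm_pt_le)

lemma norm_pt: "(norm (pt \<theta> s t))\<^sup>2 = s\<^sup>2 + t\<^sup>2"
proof -
  have "(norm (pt \<theta> s t))\<^sup>2 = pt \<theta> s t \<bullet> (s *\<^sub>R dir \<theta> + t *\<^sub>R dir (\<theta> + pi / 2))"
    by (simp add: power2_norm_eq_inner pt_def)
  then show ?thesis by (simp add: inner_add_right power2_eq_square)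
qed

lemma abs_le_norm_pt: "\<bar>s\<bar> \<le> norm (pt \<theta> s t)" "\<bar>t\<bar> \<le> norm (pt \<theta> s t)"
  using norm_pt[of \<theta> s t] by (simp_all add: abs_le_square_iff[of _ "norm (pt \<theta> s t)", simplified])

lemma continuous_on_pt [continuous_intros]:
  "continuous_on S f \<Longrightarrow> continuous_on S g \<Longrightarrow> continuous_on S (\<lambda>x. pt \<theta> (f x) (g x))"
  unfolding pt_def by (intro continuous_intros)

lemma tendsto_pt [tendsto_intros]:
  "(f \<longlongrightarrow> a) F \<Longrightarrow> (g \<longlongrightarrow> b) F \<Longrightarrow> ((\<lambda>x. pt \<theta> (f x) (g x)) \<longlongrightarrow> pt \<theta> a b) F"
  unfolding pt_def by (intro tendsto_intros)

section \<open>Defining functions and graph charts of a boundary\<close>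

definition local_defining :: "(real^2) set \<Rightarrow> (real^2) set \<Rightarrow> (real^2 \<Rightarrow> real) \<Rightarrow> bool" where
  "local_defining \<Omega> U \<rho> \<longleftrightarrow> open U \<and> smooth_on U \<rho> \<and>
     (\<forall>x\<in>U. \<exists>v. frechet_derivative \<rho> (at x) v \<noteq> 0) \<and> \<Omega> \<inter> U = {x\<in>U. \<rho> x \<le> 0}"

text \<open>The point is the last argument, so \<open>slope \<rho> v\<close> is a function of the
  point and iterated slopes are second directional derivatives.\<close>

abbreviation slope :: "(real^2 \<Rightarrow> real) \<Rightarrow> real^2 \<Rightarrow> real^2 \<Rightarrow> real" where
  "slope \<rho> v x \<equiv> frechet_derivative \<rho> (at x) v"

lemma frontier_local_defining:
  assumes "local_defining \<Omega> U \<rho>" "closed \<Omega>" "x \<in> U"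
  shows "x \<in> frontier \<Omega> \<longleftrightarrow> \<rho> x = 0"
proof -
  have U: "open U" "smooth_on U \<rho>" and eq: "\<And>y. y \<in> U \<Longrightarrow> y \<in> \<Omega> \<longleftrightarrow> \<rho> y \<le> 0"
    and grad: "\<exists>v. slope \<rho> v x \<noteq> 0"
    using assms unfolding local_defining_def by auto
  note cont = smooth_on_continuous_on[OF U(2)]
  show ?thesis
  proof
    assume fr: "x \<in> frontier \<Omega>"
    then have "x \<in> \<Omega>" using assms(2) by (auto simp: frontier_def)
    then have "\<rho> x \<le> 0" using eq assms(3) by auto
    moreover have "\<not> \<rho> x < 0"
    proof
      assume neg: "\<rho> x < 0"
      define W where "W = {y\<in>U. \<rho> y < 0}"
      have "open W" unfolding W_def
        using continuous_open_preimage[OF cont U(1), of "{..<0}"] by (simp add: vimage_def Int_def)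
      moreover have "W \<subseteq> \<Omega>" "x \<in> W" using eq neg assms(3) by (auto simp: W_def)
      ultimately have "x \<in> interior \<Omega>" by (metis interiorI)
      then show False using fr by (simp add: frontier_def)
    qed
    ultimately show "\<rho> x = 0" by simp
  next
    assume zero: "\<rho> x = 0"
    then have "x \<in> \<Omega>" using eq assms(3) by auto
    moreover have "x \<notin> interior \<Omega>"
    proof
      assume int: "x \<in> interior \<Omega>"
      obtain v where v: "slope \<rho> v x \<noteq> 0" using grad by blast
      have d: "(\<rho> has_derivative frechet_derivative \<rho> (at x)) (at x)"
        using smooth_on_has_derivative[OF U(2) assms(3)] .
      have "open (U \<inter> interior \<Omega>)" using U(1) by auto
      then obtain r where r: "r > 0" "ball x r \<subseteq> U \<inter> interior \<Omega>"
        using int assms(3) by (meson IntI openE)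
      \<comment> \<open>A zero of \<rho> in the interior of \<Omega> is a local maximum, so the
        differential would vanish there.\<close>
      have "frechet_derivative \<rho> (at x) = (\<lambda>v. 0)"
      proof (rule differential_zero_maxmin[of x "ball x r" \<rho>, OF _ _ d])
        show "(\<forall>y\<in>ball x r. \<rho> y \<le> \<rho> x) \<or> (\<forall>y\<in>ball x r. \<rho> x \<le> \<rho> y)"
        proof (intro disjI1 ballI)
          fix y assume "y \<in> ball x r"
          then have "y \<in> U" "y \<in> \<Omega>" using r(2) interior_subset[of \<Omega>] by auto
          then show "\<rho> y \<le> \<rho> x" using eq zero by simp
        qed
      qed (use r in auto)
      then show False using v by auto
    qed
    ultimately show "x \<in> frontier \<Omega>" using closure_subset by (auto simp: frontier_def)
  qed
qed

text \<open>Two derivatives are recorded because \<open>g''\<close> carries the curvature of the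
  boundary: it vanishes exactly where the curvature does. The equivalence over the whole box
  excludes further branches of \<open>S\<close>, so that two boundaries with charts over a common
  box are compared by comparing functions.\<close>

definition graph_chart :: "(real^2) set \<Rightarrow> real \<Rightarrow> real \<Rightarrow> real \<Rightarrow> real \<Rightarrow> real \<Rightarrow>
    (real \<Rightarrow> real) \<Rightarrow> (real \<Rightarrow> real) \<Rightarrow> (real \<Rightarrow> real) \<Rightarrow> bool" where
  "graph_chart S \<theta> s0 t0 \<epsilon> \<delta> g g' g'' \<longleftrightarrow> \<epsilon> > 0 \<and> \<delta> > 0 \<and>
     (\<forall>t. \<bar>t - t0\<bar> < \<delta> \<longrightarrow> \<bar>g t - s0\<bar> < \<epsilon> \<and> (g has_real_derivative g' t) (at t) \<and>
        (g' has_real_derivative g'' t) (at t) \<and> isCont g'' t) \<and>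
     (\<forall>s t. \<bar>s - s0\<bar> < \<epsilon> \<longrightarrow> \<bar>t - t0\<bar> < \<delta> \<longrightarrow> (pt \<theta> s t \<in> S \<longleftrightarrow> s = g t))"

text \<open>Stated with absolute values because it is applied to increments of either sign,
  including zero.\<close>

lemma mean_value_abs:
  fixes f f' :: "real \<Rightarrow> real"
  assumes "\<And>z. \<bar>z - a\<bar> \<le> \<bar>b - a\<bar> \<Longrightarrow> (f has_real_derivative f' z) (at z)"
  shows "\<exists>z. \<bar>z - a\<bar> \<le> \<bar>b - a\<bar> \<and> f b - f a = (b - a) * f' z"
proof -
  consider "a < b" | "a = b" | "b < a" by linarith
  then show ?thesis
  proof cases
    case 1
    have "(f has_real_derivative f' x) (at x)" if "a \<le> x" "x \<le> b" for x
      using that by (intro assms) auto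
    then obtain z where "a < z" "z < b" "f b - f a = (b - a) * f' z"
      using MVT2[OF 1, of f f'] by blast
    then show ?thesis using 1 by (intro exI[of _ z]) auto
  next
    case 3
    have "(f has_real_derivative f' x) (at x)" if "b \<le> x" "x \<le> a" for x
      using that by (intro assms) auto
    then obtain z where "b < z" "z < a" "f a - f b = (a - b) * f' z"
      using MVT2[OF 3, of f f'] by blast
    then show ?thesis using 3 by (intro exI[of _ z]) (auto simp: algebra_simps)
  qed auto
qed

lemma smooth_on_real:
  fixes f :: "real \<Rightarrow> real"
  assumes "open I" "smooth_on I f" "t \<in> I"
  shows "(f has_real_derivative frechet_derivative f (at t) 1) (at t)"
    and "isCont (\<lambda>t. frechet_derivative f (at t) 1) t"
proof -
  have d: "(f has_derivative frechet_derivative f (at t)) (at t)"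
    using smooth_on_has_derivative[OF assms(2,3)] .
  then interpret bounded_linear "frechet_derivative f (at t)"
    by (rule has_derivative_bounded_linear)
  have "frechet_derivative f (at t) h = frechet_derivative f (at t) 1 * h" for h
    using scaleR[of h 1] by simp
  then have "frechet_derivative f (at t) = (*) (frechet_derivative f (at t) 1)"
    by (rule ext)
  then show "(f has_real_derivative frechet_derivative f (at t) 1) (at t)"
    using d by (simp add: has_field_derivative_def)
  show "isCont (\<lambda>t. frechet_derivative f (at t) 1) t"
    using smooth_on_continuous_on[OF smooth_on_frechet[OF assms(2)]] assms(1,3)
    by (simp add: continuous_on_eq_continuous_at)
qed

lemma has_derivative_pt_line:
  assumes "(\<rho> has_derivative D) (at (pt \<theta> s t))"
  shows "((\<lambda>s. \<rho> (pt \<theta> s t)) has_real_derivative D (dir \<theta>)) (at s)"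
    and "((\<lambda>t. \<rho> (pt \<theta> s t)) has_real_derivative D (dir (\<theta> + pi / 2))) (at t)"
proof -
  interpret bounded_linear D using assms by (rule has_derivative_bounded_linear)
  have "((\<lambda>s. pt \<theta> s t) has_derivative (\<lambda>h. h *\<^sub>R dir \<theta>)) (at s)"
    unfolding pt_def by (auto intro!: derivative_eq_intros)
  from has_derivative_compose[OF this assms]
  show "((\<lambda>s. \<rho> (pt \<theta> s t)) has_real_derivative D (dir \<theta>)) (at s)"
    by (simp add: scaleR has_field_derivative_def mult_commute_abs)
  have "((\<lambda>t. pt \<theta> s t) has_derivative (\<lambda>h. h *\<^sub>R dir (\<theta> + pi / 2))) (at t)"
    unfolding pt_def by (auto intro!: derivative_eq_intros)
  from has_derivative_compose[OF this assms]
  show "((\<lambda>t. \<rho> (pt \<theta> s t)) has_real_derivative D (dir (\<theta> + pi / 2))) (at t)"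
    by (simp add: scaleR has_field_derivative_def mult_commute_abs)
qed


text \<open>The implicit function theorem by hand. \<rho> is strictly monotone in the first
  coordinate, so the intermediate value theorem gives \<open>g\<close>; its derivative is the
  quotient -T/R of the partial derivatives on the graph. Hence the graph is an integral curve of a
  smooth field and is smooth itself. The relation between the second slope and \<open>g''\<close>
  comes from differentiating \<rho> = 0 twice along the graph; it identifies the nondegenerate
  tangencies with the zeros avoided by \<open>g''\<close>.\<close>

lemma exists_graph_chart:
  assumes ld: "local_defining \<Omega> U \<rho>" and cl: "closed \<Omega>"
    and p: "pt \<theta> s0 t0 \<in> U" "pt \<theta> s0 t0 \<in> frontier \<Omega>"
    and nz: "slope \<rho> (dir \<theta>) (pt \<theta> s0 t0) \<noteq> 0"
  obtains \<epsilon> \<delta> g g' g'' where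
    "graph_chart (frontier \<Omega>) \<theta> s0 t0 \<epsilon> \<delta> g g' g''"
    "\<And>t. \<bar>t - t0\<bar> < \<delta> \<Longrightarrow> pt \<theta> (g t) t \<in> U"
    "\<And>t. \<bar>t - t0\<bar> < \<delta> \<Longrightarrow> slope \<rho> (dir \<theta>) (pt \<theta> (g t) t) \<noteq> 0"
    "\<And>t. \<bar>t - t0\<bar> < \<delta> \<Longrightarrow> slope \<rho> (pt \<theta> (g' t) 1) (pt \<theta> (g t) t) = 0"
    "\<And>t. \<bar>t - t0\<bar> < \<delta> \<Longrightarrow> slope (slope \<rho> (pt \<theta> (g' t) 1)) (pt \<theta> (g' t) 1) (pt \<theta> (g t) t) =
       - slope \<rho> (dir \<theta>) (pt \<theta> (g t) t) * g'' t"
    "smooth_on {-\<delta><..<\<delta>} (\<lambda>t. pt \<theta> (g (t0 + t)) (t0 + t))"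
    "\<And>t. \<bar>t\<bar> < \<delta> \<Longrightarrow>
       ((\<lambda>t. pt \<theta> (g (t0 + t)) (t0 + t)) has_vector_derivative pt \<theta> (g' (t0 + t)) 1) (at t)"
proof -
  define d e where "d = dir \<theta>" and "e = dir (\<theta> + pi / 2)"
  define R T where "R = slope \<rho> d" and "T = slope \<rho> e"
  let ?p = "pt \<theta> s0 t0"
  have U: "open U" "smooth_on U \<rho>" using ld unfolding local_defining_def by auto
  have sR: "smooth_on U R" "smooth_on U T"
    unfolding R_def T_def by (rule smooth_on_frechet[OF U(2)])+
  have der: "(\<rho> has_derivative frechet_derivative \<rho> (at x)) (at x)" if "x \<in> U" for x
    using smooth_on_has_derivative[OF U(2) that] .
  have "R ?p \<noteq> 0" using nz by (simp add: R_def d_def)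
  \<comment> \<open>The sign makes \<open>F\<close> below increasing in \<open>s\<close>, whichever
    side \<Omega> lies on.\<close>
  define \<sigma> where "\<sigma> = sgn (R ?p)"
  have \<sigma>: "\<sigma> \<noteq> 0" "\<sigma> * R ?p > 0"
    using \<open>R ?p \<noteq> 0\<close> by (auto simp: \<sigma>_def sgn_if)
  define W where "W = U \<inter> {x. \<sigma> * R x > 0}"
  have "open W" "?p \<in> W"
  proof -
    have "continuous_on U (\<lambda>x. \<sigma> * R x)"
      using smooth_on_continuous_on[OF sR(1)] by (intro continuous_intros)
    from continuous_open_preimage[OF this U(1), of "{0<..}"]
    show "open W" by (simp add: W_def vimage_def Int_def)
    show "?p \<in> W" using p \<sigma> by (simp add: W_def)
  qed
  then obtain r where r: "r > 0" "ball ?p r \<subseteq> W" by (meson openE)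
  define \<eta> where "\<eta> = r / 2"
  have "\<eta> > 0" using r by (simp add: \<eta>_def)
  have inW: "pt \<theta> s t \<in> W" if "\<bar>s - s0\<bar> < \<eta>" "\<bar>t - t0\<bar> < \<eta>" for s t
  proof -
    have "dist ?p (pt \<theta> s t) < r"
      using dist_pt_le[of \<theta> s0 t0 s t] that by (simp add: \<eta>_def abs_minus_commute)
    then show ?thesis using r by auto
  qed
  define F where "F s t = \<sigma> * \<rho> (pt \<theta> s t)" for s t
  have Fs: "((\<lambda>s. F s t) has_real_derivative \<sigma> * R (pt \<theta> s t)) (at s)"
    and Ft: "((\<lambda>t. F s t) has_real_derivative \<sigma> * T (pt \<theta> s t)) (at t)"
    if "\<bar>s - s0\<bar> < \<eta>" "\<bar>t - t0\<bar> < \<eta>" for s t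
    unfolding F_def R_def T_def d_def e_def
    using has_derivative_pt_line[OF der[of "pt \<theta> s t"]] inW[OF that] W_def
    by (auto intro!: DERIV_cmult)
  have mono: "F a t < F b t" if "a < b" "\<bar>a - s0\<bar> < \<eta>" "\<bar>b - s0\<bar> < \<eta>" "\<bar>t - t0\<bar> < \<eta>" for a b t
  proof (rule DERIV_pos_imp_increasing[OF \<open>a < b\<close>])
    fix x assume "a \<le> x" "x \<le> b"
    then have x: "\<bar>x - s0\<bar> < \<eta>" using that by auto
    from Fs[OF x that(4)] inW[OF x that(4)]
    show "\<exists>y. ((\<lambda>a. F a t) has_real_derivative y) (at x) \<and> y > 0" by (auto simp: W_def)
  qed
  have F0: "F s0 t0 = 0"
    using frontier_local_defining[OF ld cl p(1)] p(2) by (simp add: F_def)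
  \<comment> \<open>A third of the box: a mean value point is no farther from \<open>g t1\<close>
    than \<open>g t\<close> is, and with both values within \<epsilon> of \<open>s0\<close> it stays
    within \<eta>. The second coordinate gets the same margin in \<delta>.\<close>
  define \<epsilon> where "\<epsilon> = \<eta> / 3"
  have \<epsilon>: "\<epsilon> > 0" "\<epsilon> < \<eta>" using \<open>\<eta> > 0\<close> by (auto simp: \<epsilon>_def)
  have Fc: "isCont (\<lambda>t. F s t) t" if "\<bar>s - s0\<bar> < \<eta>" "\<bar>t - t0\<bar> < \<eta>" for s t
    using Ft[OF that] DERIV_isCont by blast
  have nbhd: "\<exists>\<delta>>0. \<forall>t. \<bar>t - t1\<bar> < \<delta> \<longrightarrow> F a t < 0 \<and> 0 < F b t"
    if "\<bar>a - s0\<bar> < \<eta>" "\<bar>b - s0\<bar> < \<eta>" "\<bar>t1 - t0\<bar> < \<eta>" "F a t1 < 0" "0 < F b t1" for a b t1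
  proof -
    have "\<forall>\<^sub>F t in nhds t1. F a t < 0" "\<forall>\<^sub>F t in nhds t1. 0 < F b t"
      using order_tendstoD(2)[OF Fc[OF that(1,3), unfolded continuous_at tendsto_at_iff_tendsto_nhds] that(4)]
        order_tendstoD(1)[OF Fc[OF that(2,3), unfolded continuous_at tendsto_at_iff_tendsto_nhds] that(5)] .
    then have "\<forall>\<^sub>F t in nhds t1. F a t < 0 \<and> 0 < F b t" by (rule eventually_conj)
    then show ?thesis by (auto simp: eventually_nhds_metric dist_real_def)
  qed
  have "F (s0 - \<epsilon>) t0 < 0" "0 < F (s0 + \<epsilon>) t0"
    using mono[of "s0 - \<epsilon>" s0 t0] mono[of s0 "s0 + \<epsilon>" t0] \<epsilon> \<open>\<eta> > 0\<close> F0 by auto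
  with nbhd[of "s0 - \<epsilon>" "s0 + \<epsilon>" t0] \<epsilon> \<open>\<eta> > 0\<close>
  obtain \<delta>' where \<delta>': "\<delta>' > 0" "\<And>t. \<bar>t - t0\<bar> < \<delta>' \<Longrightarrow> F (s0 - \<epsilon>) t < 0 \<and> 0 < F (s0 + \<epsilon>) t"
    by auto
  define \<delta> where "\<delta> = min \<delta>' (\<eta> / 3)"
  have \<delta>: "\<delta> > 0" "\<delta> \<le> \<eta>" "\<delta> \<le> \<delta>'" "3 * \<delta> \<le> \<eta>" using \<delta>'(1) \<open>\<eta> > 0\<close> by (auto simp: \<delta>_def)
  have ex: "\<exists>s. \<bar>s - s0\<bar> < \<epsilon> \<and> F s t = 0" if t: "\<bar>t - t0\<bar> < \<delta>" for t
  proof -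
    have neg: "F (s0 - \<epsilon>) t < 0" and pos: "0 < F (s0 + \<epsilon>) t" using \<delta>'(2)[of t] t \<delta> by auto
    have "\<exists>s\<ge>s0 - \<epsilon>. s \<le> s0 + \<epsilon> \<and> F s t = 0"
    proof (rule IVT)
      show "\<forall>s. s0 - \<epsilon> \<le> s \<and> s \<le> s0 + \<epsilon> \<longrightarrow> isCont (\<lambda>s. F s t) s"
        using Fs t \<delta> \<epsilon> by (intro allI impI DERIV_isCont[OF Fs]) auto
    qed (use neg pos \<epsilon> in auto)
    then obtain s where s: "s0 - \<epsilon> \<le> s" "s \<le> s0 + \<epsilon>" "F s t = 0" by blast
    then have "s \<noteq> s0 - \<epsilon>" "s \<noteq> s0 + \<epsilon>" using neg pos by auto
    then show ?thesis using s by (intro exI[of _ s]) auto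
  qed
  define g where "g t = (SOME s. \<bar>s - s0\<bar> < \<epsilon> \<and> F s t = 0)" for t
  have g: "\<bar>g t - s0\<bar> < \<epsilon>" "F (g t) t = 0" if "\<bar>t - t0\<bar> < \<delta>" for t
    using someI_ex[OF ex[OF that]] unfolding g_def by auto
  have Fless: "F s t < 0 \<longleftrightarrow> s < g t" "F s t > 0 \<longleftrightarrow> s > g t"
    if "\<bar>s - s0\<bar> < \<eta>" "\<bar>t - t0\<bar> < \<delta>" for s t
    using mono[of s "g t" t] mono[of "g t" s t] g[OF that(2)] that \<delta> \<epsilon>
    by (cases s "g t" rule: linorder_cases; force)+
  have F0iff: "F s t = 0 \<longleftrightarrow> s = g t" if "\<bar>s - s0\<bar> < \<eta>" "\<bar>t - t0\<bar> < \<delta>" for s t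
    using Fless[OF that] by (metis linorder_neq_iff)
  have gcont: "(g \<longlongrightarrow> g t1) (at t1)" if t1: "\<bar>t1 - t0\<bar> < \<delta>" for t1
  proof (rule LIM_I)
    fix \<kappa> :: real assume "\<kappa> > 0"
    define \<kappa>' where "\<kappa>' = min (\<kappa> / 2) (\<eta> - \<epsilon>)"
    have \<kappa>': "\<kappa>' > 0" "\<kappa>' < \<kappa>" "\<kappa>' \<le> \<eta> - \<epsilon>" using \<open>\<kappa> > 0\<close> \<epsilon> by (auto simp: \<kappa>'_def)
    have b: "\<bar>g t1 - \<kappa>' - s0\<bar> < \<eta>" "\<bar>g t1 + \<kappa>' - s0\<bar> < \<eta>"
      using g(1)[OF t1] \<kappa>' by auto
    have "F (g t1 - \<kappa>') t1 < 0" "0 < F (g t1 + \<kappa>') t1"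
      using Fless[OF b(1) t1] Fless[OF b(2) t1] \<kappa>' by auto
    with nbhd[OF b, of t1] t1 \<delta> obtain \<delta>1 where
      \<delta>1: "\<delta>1 > 0" "\<And>t. \<bar>t - t1\<bar> < \<delta>1 \<Longrightarrow> F (g t1 - \<kappa>') t < 0 \<and> 0 < F (g t1 + \<kappa>') t" by auto
    show "\<exists>s>0. \<forall>x. x \<noteq> t1 \<and> norm (x - t1) < s \<longrightarrow> norm (g x - g t1) < \<kappa>"
    proof (intro exI[of _ "min \<delta>1 (\<delta> - \<bar>t1 - t0\<bar>)"] conjI allI impI)
      show "0 < min \<delta>1 (\<delta> - \<bar>t1 - t0\<bar>)" using \<delta>1 t1 by auto
      fix x assume "x \<noteq> t1 \<and> norm (x - t1) < min \<delta>1 (\<delta> - \<bar>t1 - t0\<bar>)"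
      then have x: "\<bar>x - t1\<bar> < \<delta>1" "\<bar>x - t0\<bar> < \<delta>" by auto
      show "norm (g x - g t1) < \<kappa>"
        using \<delta>1(2)[OF x(1)] Fless[OF b(1) x(2)] Fless[OF b(2) x(2)] \<kappa>' by auto
    qed
  qed
  define q where "q x = - T x * inverse (R x)" for x
  define P where "P t = pt \<theta> (g t) t" for t
  have PW: "P t \<in> W" if "\<bar>t - t0\<bar> < \<delta>" for t
    unfolding P_def using g(1)[OF that] \<epsilon> that \<delta> by (intro inW) auto
  have WU: "W \<subseteq> U" and RW: "\<And>x. x \<in> W \<Longrightarrow> R x \<noteq> 0" by (auto simp: W_def)
  define g' where "g' t = q (P t)" for t
  have gder: "(g has_real_derivative g' t1) (at t1)" if t1: "\<bar>t1 - t0\<bar> < \<delta>" for t1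
  proof -
    have ev: "\<forall>\<^sub>F t in at t1. \<bar>t - t0\<bar> < \<delta>"
      using t1 by (intro eventually_at[THEN iffD2] exI[of _ "\<delta> - \<bar>t1 - t0\<bar>"]) (auto simp: dist_real_def)
    \<comment> \<open>The increment of \<open>F\<close> along the graph is zero. Splitting it at the
      corner \<open>pt \<theta> (g t1) t\<close> into one step in each coordinate gives two mean
      values, which tend to the partial derivatives at \<open>P t1\<close>.\<close>
    have "\<exists>\<xi> \<zeta>. \<bar>\<xi> - g t1\<bar> \<le> \<bar>g t - g t1\<bar> \<and> \<bar>\<zeta> - t1\<bar> \<le> \<bar>t - t1\<bar> \<and>
        (g t - g t1) * R (pt \<theta> \<xi> t) + (t - t1) * T (pt \<theta> (g t1) \<zeta>) = 0 \<and> R (pt \<theta> \<xi> t) \<noteq> 0"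
      if t: "\<bar>t - t0\<bar> < \<delta>" for t
    proof -
      have "\<exists>\<xi>. \<bar>\<xi> - g t1\<bar> \<le> \<bar>g t - g t1\<bar> \<and> F (g t) t - F (g t1) t = (g t - g t1) * (\<sigma> * R (pt \<theta> \<xi> t))"
      proof (rule mean_value_abs, rule Fs)
        fix z assume "\<bar>z - g t1\<bar> \<le> \<bar>g t - g t1\<bar>"
        then show "\<bar>z - s0\<bar> < \<eta>"
          using g(1)[OF t] g(1)[OF t1] unfolding \<epsilon>_def by linarith
      qed (use t \<delta> in auto)
      then obtain \<xi> where \<xi>: "\<bar>\<xi> - g t1\<bar> \<le> \<bar>g t - g t1\<bar>"
        "F (g t) t - F (g t1) t = (g t - g t1) * (\<sigma> * R (pt \<theta> \<xi> t))" by blast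
      have "\<exists>\<zeta>. \<bar>\<zeta> - t1\<bar> \<le> \<bar>t - t1\<bar> \<and> F (g t1) t - F (g t1) t1 = (t - t1) * (\<sigma> * T (pt \<theta> (g t1) \<zeta>))"
      proof (rule mean_value_abs, rule Ft)
        fix z assume "\<bar>z - t1\<bar> \<le> \<bar>t - t1\<bar>"
        then show "\<bar>z - t0\<bar> < \<eta>" using t t1 \<delta>(4) by linarith
      qed (use g(1)[OF t1] \<epsilon> in auto)
      then obtain \<zeta> where \<zeta>: "\<bar>\<zeta> - t1\<bar> \<le> \<bar>t - t1\<bar>"
        "F (g t1) t - F (g t1) t1 = (t - t1) * (\<sigma> * T (pt \<theta> (g t1) \<zeta>))" by blast
      have "\<sigma> * ((g t - g t1) * R (pt \<theta> \<xi> t) + (t - t1) * T (pt \<theta> (g t1) \<zeta>)) = 0"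
        using \<xi>(2) \<zeta>(2) g(2)[OF t] g(2)[OF t1] by (simp add: algebra_simps)
      moreover have "pt \<theta> \<xi> t \<in> W"
      proof (rule inW)
        show "\<bar>\<xi> - s0\<bar> < \<eta>"
          using \<xi>(1) g(1)[OF t] g(1)[OF t1] unfolding \<epsilon>_def by linarith
      qed (use t \<delta> in auto)
      ultimately show ?thesis using \<xi>(1) \<zeta>(1) \<sigma>(1) RW by auto
    qed
    then obtain \<xi> \<zeta> where
      \<xi>\<zeta>: "\<And>t. \<bar>t - t0\<bar> < \<delta> \<Longrightarrow> \<bar>\<xi> t - g t1\<bar> \<le> \<bar>g t - g t1\<bar> \<and> \<bar>\<zeta> t - t1\<bar> \<le> \<bar>t - t1\<bar> \<and>
        (g t - g t1) * R (pt \<theta> (\<xi> t) t) + (t - t1) * T (pt \<theta> (g t1) (\<zeta> t)) = 0 \<and> R (pt \<theta> (\<xi> t) t) \<noteq> 0"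
      by metis
    have "(\<xi> \<longlongrightarrow> g t1) (at t1)"
    proof (rule LIM_zero_cancel, rule Lim_null_comparison)
      show "\<forall>\<^sub>F t in at t1. norm (\<xi> t - g t1) \<le> \<bar>g t - g t1\<bar>"
        using ev by eventually_elim (use \<xi>\<zeta> in auto)
      show "((\<lambda>t. \<bar>g t - g t1\<bar>) \<longlongrightarrow> 0) (at t1)"
        using gcont[OF t1] by (auto intro!: tendsto_eq_intros)
    qed
    then have 1: "((\<lambda>t. pt \<theta> (\<xi> t) t) \<longlongrightarrow> P t1) (at t1)" unfolding P_def by (intro tendsto_intros)
    have "(\<zeta> \<longlongrightarrow> t1) (at t1)"
    proof (rule LIM_zero_cancel, rule Lim_null_comparison)
      show "\<forall>\<^sub>F t in at t1. norm (\<zeta> t - t1) \<le> \<bar>t - t1\<bar>"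
        using ev by eventually_elim (use \<xi>\<zeta> in auto)
      show "((\<lambda>t. \<bar>t - t1\<bar>) \<longlongrightarrow> 0) (at t1)" by (auto intro!: tendsto_eq_intros)
    qed
    then have 2: "((\<lambda>t. pt \<theta> (g t1) (\<zeta> t)) \<longlongrightarrow> P t1) (at t1)" unfolding P_def by (intro tendsto_intros)
    have Pc: "isCont R (P t1)" "isCont T (P t1)"
      using smooth_on_continuous_on[OF sR(1)] smooth_on_continuous_on[OF sR(2)] PW[OF t1] WU U(1)
      by (auto simp: continuous_on_eq_continuous_at)
    have "((\<lambda>t. - T (pt \<theta> (g t1) (\<zeta> t)) * inverse (R (pt \<theta> (\<xi> t) t))) \<longlongrightarrow> - T (P t1) * inverse (R (P t1))) (at t1)"
      using RW[OF PW[OF t1]]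
      by (intro tendsto_intros isCont_tendsto_compose[OF Pc(1) 1] isCont_tendsto_compose[OF Pc(2) 2])
    then have "((\<lambda>t. (g t - g t1) / (t - t1)) \<longlongrightarrow> g' t1) (at t1)"
      unfolding g'_def q_def
    proof (rule Lim_transform_eventually)
      have "\<forall>\<^sub>F t in at t1. t \<noteq> t1" by (simp add: eventually_at_filter)
      with ev show "\<forall>\<^sub>F t in at t1. - T (pt \<theta> (g t1) (\<zeta> t)) * inverse (R (pt \<theta> (\<xi> t) t)) = (g t - g t1) / (t - t1)"
      proof eventually_elim
        case (elim t)
        then show ?case using \<xi>\<zeta>[OF elim(1)] by (auto simp: field_simps)
      qed
    qed
    then show ?thesis by (simp add: has_field_derivative_iff)
  qed
  have Pder: "(P has_vector_derivative (e + q (P t) *\<^sub>R d)) (at t)" if "\<bar>t - t0\<bar> < \<delta>" for t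
  proof -
    show ?thesis
      using gder[OF that]
      unfolding P_def pt_def d_def[symmetric] e_def[symmetric] g'_def
      by (auto intro!: derivative_eq_intros)
  qed
  have Pder': "((\<lambda>t. P (t0 + t)) has_vector_derivative (e + q (P (t0 + t)) *\<^sub>R d)) (at t)" if "\<bar>t\<bar> < \<delta>" for t
  proof -
    have "((\<lambda>t. P (t0 + t)) has_derivative (\<lambda>h. h *\<^sub>R (e + q (P (t0 + t)) *\<^sub>R d))) (at t)"
    proof (rule has_derivative_compose[of "\<lambda>t. t0 + t"])
      show "((+) t0 has_derivative (\<lambda>h. h)) (at t)" by (auto intro!: derivative_eq_intros)
      show "(P has_derivative (\<lambda>h. h *\<^sub>R (e + q (P (t0 + t)) *\<^sub>R d))) (at (t0 + t))"
        using Pder[of "t0 + t"] that by (simp add: has_vector_derivative_def)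
    qed
    then show ?thesis by (simp add: has_vector_derivative_def)
  qed
  have sq: "smooth_on W q"
    unfolding q_def
    using sR[THEN smooth_on_subset[OF _ WU]]
    by (intro smooth_on_bilinear[OF \<open>open W\<close> bounded_bilinear_mult] smooth_on_inverse[OF \<open>open W\<close>]
        smooth_on_linear[OF \<open>open W\<close> bounded_linear_minus[OF bounded_linear_ident]] RW)
  define I where "I = {t0 - \<delta><..<t0 + \<delta>}"
  have I: "open I" "t \<in> I \<longleftrightarrow> \<bar>t - t0\<bar> < \<delta>" for t unfolding I_def by auto
  have sg': "smooth_on I g'"
    unfolding g'_def by (rule smooth_on_integral_curve[OF I(1) \<open>open W\<close> _ sq Pder sq]) (auto simp: I PW)
  have sP: "smooth_on {-\<delta><..<\<delta>} (\<lambda>t. P (t0 + t))"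
    by (rule smooth_on_integral_curve[OF _ \<open>open W\<close> _ sq Pder' smooth_on_id[OF \<open>open W\<close>]])
       (auto simp: PW)
  define g'' where "g'' t = frechet_derivative g' (at t) 1" for t
  have g'': "(g' has_real_derivative g'' t) (at t)" "isCont g'' t" if "\<bar>t - t0\<bar> < \<delta>" for t
    using smooth_on_real[OF I(1) sg', of t] that I(2) unfolding g''_def by auto
  have lin: "slope \<rho> (pt \<theta> m 1) x = m * R x + T x" if "x \<in> U" for m x
  proof -
    interpret bounded_linear "frechet_derivative \<rho> (at x)"
      using der[OF that] by (rule has_derivative_bounded_linear)
    show ?thesis by (simp add: pt_def R_def T_def d_def e_def add scaleR)
  qed
  have zero: "g' t * R (P t) + T (P t) = 0" if "\<bar>t - t0\<bar> < \<delta>" for t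
    using RW[OF PW[OF that]] by (simp add: g'_def q_def)
  show thesis
  proof
    show "graph_chart (frontier \<Omega>) \<theta> s0 t0 \<epsilon> \<delta> g g' g''"
      unfolding graph_chart_def
    proof (intro conjI allI impI)
      fix s t assume st: "\<bar>s - s0\<bar> < \<epsilon>" "\<bar>t - t0\<bar> < \<delta>"
      have "pt \<theta> s t \<in> U" using inW[of s t] st \<epsilon> \<delta> WU by auto
      from frontier_local_defining[OF ld cl this]
      show "pt \<theta> s t \<in> frontier \<Omega> \<longleftrightarrow> s = g t"
        using F0iff[of s t] st \<epsilon> \<sigma>(1) by (auto simp: F_def)
    qed (use \<epsilon> \<delta> g gder g'' in auto)
    fix t assume t: "\<bar>t - t0\<bar> < \<delta>"
    have PU: "P t \<in> U" using PW[OF t] WU by auto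
    then show "pt \<theta> (g t) t \<in> U" by (simp add: P_def)
    show "slope \<rho> (dir \<theta>) (pt \<theta> (g t) t) \<noteq> 0"
      using RW[OF PW[OF t]] by (simp add: R_def d_def P_def)
    show "slope \<rho> (pt \<theta> (g' t) 1) (pt \<theta> (g t) t) = 0"
      using lin[OF PU] zero[OF t] by (simp add: P_def)
    define v where "v = pt \<theta> (g' t) 1"
    have v: "v = e + q (P t) *\<^sub>R d" by (simp add: v_def pt_def d_def e_def g'_def)
    have dR: "(R has_derivative frechet_derivative R (at (P t))) (at (P t))"
      and dT: "(T has_derivative frechet_derivative T (at (P t))) (at (P t))"
      using smooth_on_has_derivative[OF sR(1) PU] smooth_on_has_derivative[OF sR(2) PU] .
    have "((\<lambda>x. g' t * R x + T x) has_derivative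
        (\<lambda>h. g' t * frechet_derivative R (at (P t)) h + frechet_derivative T (at (P t)) h)) (at (P t))"
      by (intro has_derivative_add has_derivative_mult_right dR dT)
    then have sv: "(slope \<rho> v has_derivative
        (\<lambda>h. g' t * frechet_derivative R (at (P t)) h + frechet_derivative T (at (P t)) h)) (at (P t))"
      by (rule has_derivative_transform_within_open[OF _ U(1) PU]) (simp add: lin v_def)
    then have 1: "slope (slope \<rho> v) v (P t) =
        g' t * frechet_derivative R (at (P t)) v + frechet_derivative T (at (P t)) v"
      by (simp flip: frechet_derivative_at[OF sv])
    have comp: "((\<lambda>t. f (P t)) has_real_derivative f' v) (at t)"
      if "(f has_derivative f') (at (P t))" for f f'
    proof -
      interpret bounded_linear f' using that by (rule has_derivative_bounded_linear)
      show ?thesis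
        using has_derivative_compose[OF Pder[OF t, unfolded has_vector_derivative_def] that]
        by (simp add: scaleR has_field_derivative_def mult_commute_abs v)
    qed
    have "((\<lambda>t. g' t * R (P t) + T (P t)) has_real_derivative
        (g'' t * R (P t) + frechet_derivative R (at (P t)) v * g' t + frechet_derivative T (at (P t)) v)) (at t)"
      by (intro DERIV_add DERIV_mult comp[OF dR] comp[OF dT] g''(1)[OF t])
    moreover have "((\<lambda>t. g' t * R (P t) + T (P t)) has_real_derivative 0) (at t)"
    proof (rule has_field_derivative_transform_within_open[of "\<lambda>_. 0" _ _ I])
      show "t \<in> I" using t I by auto
      show "\<And>x. x \<in> I \<Longrightarrow> 0 = g' x * R (P x) + T (P x)" using zero I by auto
    qed (use I in auto)
    ultimately have "g'' t * R (P t) + frechet_derivative R (at (P t)) v * g' t + frechet_derivative T (at (P t)) v = 0"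
      by (rule DERIV_unique)
    with 1 have "slope (slope \<rho> v) v (P t) = - R (P t) * g'' t"
      by (simp add: algebra_simps)
    then show "slope (slope \<rho> (pt \<theta> (g' t) 1)) (pt \<theta> (g' t) 1) (pt \<theta> (g t) t) =
       - slope \<rho> (dir \<theta>) (pt \<theta> (g t) t) * g'' t"
      unfolding v_def R_def d_def P_def .
  next
    show "smooth_on {-\<delta><..<\<delta>} (\<lambda>t. pt \<theta> (g (t0 + t)) (t0 + t))"
      using sP by (simp add: P_def)
    fix t assume "\<bar>t\<bar> < \<delta>"
    from Pder'[OF this]
    show "((\<lambda>t. pt \<theta> (g (t0 + t)) (t0 + t)) has_vector_derivative pt \<theta> (g' (t0 + t)) 1) (at t)"
      by (simp add: P_def g'_def pt_def d_def e_def add.commute)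
  qed
qed

subsection \<open>Square integrability from the Fourier transform\<close>

lemma cis_measurable [measurable]: "cis \<in> borel_measurable borel"
  by (intro borel_measurable_continuous_onI continuous_intros)

section \<open>Lebesgue measure of the plane as a product measure\<close>

definition vec2 :: "real \<times> real \<Rightarrow> real^2" where
  "vec2 p = fst p *\<^sub>R axis 1 1 + snd p *\<^sub>R axis 2 1"

lemma vec2_nth [simp]: "vec2 p $ 1 = fst p" "vec2 p $ 2 = snd p"
  by (simp_all add: vec2_def axis_def)

lemma vec2_inner [simp]: "vec2 p \<bullet> z = fst p * z $ 1 + snd p * z $ 2"
  by (simp add: inner_vec_def sum_2)

lemma vec2_measurable [measurable]: "vec2 \<in> borel_measurable (lborel \<Otimes>\<^sub>M lborel)"
proof -
  have "continuous_on UNIV vec2" unfolding vec2_def[abs_def] by (intro continuous_intros)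
  then show ?thesis by (simp add: lborel_prod borel_measurable_continuous_onI)
qed

lemma vec_nth_measurable [measurable]: "(\<lambda>x. x $ i) \<in> borel_measurable (borel :: (real^2) measure)"
  by (intro borel_measurable_continuous_onI continuous_intros)

text \<open>Elements of \<open>real^2\<close> are functions on a two element type, not pairs;
  transporting the product measure makes Fubini available coordinate by coordinate. The masses of
  boxes determine Lebesgue measure.\<close>

lemma lborel_real2: "(lborel :: (real^2) measure) = distr (lborel \<Otimes>\<^sub>M lborel) borel vec2"
proof (rule lborel_eqI)
  fix l u :: "real^2"
  assume le: "\<And>b. b \<in> Basis \<Longrightarrow> l \<bullet> b \<le> u \<bullet> b"
  have B: "(Basis :: (real^2) set) = {axis 1 1, axis 2 1}"
    by (auto simp: Basis_vec_def exhaust_2) (metis exhaust_2)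
  have ne: "axis 1 1 \<noteq> (axis 2 1 :: real^2)" by (simp add: axis_eq_axis)
  have le': "l $ 1 \<le> u $ 1" "l $ 2 \<le> u $ 2"
    using le[of "axis 1 1"] le[of "axis 2 1"] by (simp_all add: B inner_axis)
  have vi: "vec2 -` box l u = box (l $ 1, l $ 2) (u $ 1, u $ 2)"
    by (auto simp: mem_box_cart forall_2 mem_box B Basis_prod_def)
  have "emeasure (distr (lborel \<Otimes>\<^sub>M lborel) borel vec2) (box l u) =
      emeasure lborel (box (l $ 1, l $ 2) (u $ 1, u $ 2))"
    using vec2_measurable by (subst emeasure_distr) (simp_all add: vi lborel_prod)
  also have "\<dots> = ennreal (\<Prod>b\<in>Basis. ((u $ 1, u $ 2) - (l $ 1, l $ 2)) \<bullet> b)"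
    by (rule emeasure_lborel_box) (use le' in \<open>auto simp: Basis_prod_def\<close>)
  also have "(\<Prod>b\<in>Basis. ((u $ 1, u $ 2) - (l $ 1, l $ 2)) \<bullet> b) = (u $ 1 - l $ 1) * (u $ 2 - l $ 2)"
    by (simp add: Basis_prod_def)
  also have "\<dots> = (\<Prod>b\<in>Basis. (u - l) \<bullet> b)"
    using ne by (simp add: B inner_axis)
  finally show "emeasure (distr (lborel \<Otimes>\<^sub>M lborel) borel vec2) (box l u) = ennreal (\<Prod>b\<in>Basis. (u - l) \<bullet> b)" .
qed simp

lemma product_integral_real2:
  fixes f g :: "real \<Rightarrow> 'b::{real_normed_field, banach, second_countable_topology}"
  assumes f: "integrable lborel f" and g: "integrable lborel g"
  shows "integrable lborel (\<lambda>x::real^2. f (x $ 1) * g (x $ 2))"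
    and "(LINT x|lborel. f ((x::real^2) $ 1) * g (x $ 2)) = (LINT x|lborel. f x) * (LINT x|lborel. g x)"
proof -
  have [measurable]: "f \<in> borel_measurable borel" "g \<in> borel_measurable borel"
    using f g by auto
  have int: "integrable (lborel \<Otimes>\<^sub>M lborel) (\<lambda>p. f (fst p) * g (snd p))"
  proof (rule lborel_pair.Fubini_integrable)
    show "integrable lborel (\<lambda>x. LINT y|lborel. norm (f (fst (x, y)) * g (snd (x, y))))"
      using f by (simp add: norm_mult)
    show "AE x in lborel. integrable lborel (\<lambda>y. f (fst (x, y)) * g (snd (x, y)))"
      using g by simp
  qed measurable
  have m: "(\<lambda>x::real^2. f (x $ 1) * g (x $ 2)) \<in> borel_measurable borel" by measurable
  show "integrable lborel (\<lambda>x::real^2. f (x $ 1) * g (x $ 2))"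
    unfolding lborel_real2 using int m by (subst integrable_distr_eq) auto
  have "(LINT x|lborel. f ((x::real^2) $ 1) * g (x $ 2)) = (LINT p|(lborel \<Otimes>\<^sub>M lborel). f (fst p) * g (snd p))"
    unfolding lborel_real2 using m by (subst integral_distr) auto
  also have "\<dots> = (LINT x|lborel. LINT y|lborel. f x * g y)"
    using lborel_pair.integral_fst'[OF int] by simp
  finally show "(LINT x|lborel. f ((x::real^2) $ 1) * g (x $ 2)) = (LINT x|lborel. f x) * (LINT x|lborel. g x)"
    by simp
qed

section \<open>The Gaussian and the quadratic form of Gaussian smoothing\<close>

definition gauss2 :: "real^2 \<Rightarrow> real" where
  "gauss2 x = std_normal_density (x $ 1) * std_normal_density (x $ 2)"

lemma gauss2_measurable [measurable]: "gauss2 \<in> borel_measurable borel"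
  unfolding gauss2_def by measurable

lemma norm_real2: "(norm (x::real^2))\<^sup>2 = (x $ 1)\<^sup>2 + (x $ 2)\<^sup>2"
  unfolding power2_norm_eq_inner by (simp add: inner_vec_def sum_2 power2_eq_square)

lemma gauss2_eq: "gauss2 x = exp (- (norm x)\<^sup>2 / 2) / (2 * pi)"
  by (simp add: gauss2_def std_normal_density_def norm_real2 exp_add[symmetric] exp_diff exp_minus field_simps)

lemma gauss2_bounds: "0 \<le> gauss2 x" "gauss2 x \<le> 1 / (2 * pi)"
  by (auto simp: gauss2_eq divide_right_mono)

lemma integrable_gauss2: "integrable lborel gauss2" and integral_gauss2: "(LINT x|lborel. gauss2 x) = 1"
  using product_integral_real2[of "std_normal_density" "std_normal_density"]
  by (simp_all add: gauss2_def[abs_def])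

lemma std_normal_fourier:
  "(LINT x|lborel. cis (x * t) * of_real (std_normal_density x)) = of_real (exp (- t\<^sup>2 / 2))"
proof -
  have "char std_normal_distribution t = (LINT x|lborel. std_normal_density x *\<^sub>R cis (t * x))"
    unfolding char_def by (subst integral_density) (auto simp: cis_conv_exp mult.commute)
  then show ?thesis
    by (simp add: char_std_normal_distribution scaleR_conv_of_real mult.commute)
qed

text \<open>The coordinates separate, and each factor is the characteristic function of the normal
  distribution; the 2 pi undoes the normalisation of the density on the right.\<close>

lemma gauss2_fourier:
  "(LINT x|lborel. cis (x \<bullet> z) * of_real (gauss2 x)) = of_real (2 * pi * gauss2 z)"
proof -
  have i: "integrable lborel (\<lambda>x. cis (x * t) * complex_of_real (std_normal_density x))" for t
    by (rule Bochner_Integration.integrable_bound[OF integrable_normal_density[of 1 0]])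
       (auto simp: norm_mult)
  have eq: "cis ((x::real^2) \<bullet> z) * complex_of_real (gauss2 x) =
    (cis (x $ 1 * z $ 1) * of_real (std_normal_density (x $ 1))) * (cis (x $ 2 * z $ 2) * of_real (std_normal_density (x $ 2)))" for x
    by (simp add: gauss2_def inner_vec_def sum_2 cis_mult[symmetric] mult_ac)
  show ?thesis
    unfolding eq product_integral_real2(2)[OF i i] std_normal_fourier
    by (simp add: gauss2_eq norm_real2 mult_exp_exp add_divide_distrib diff_divide_distrib flip: of_real_mult)
qed

lemma lborel_affine_integral:
  fixes f :: "'a::euclidean_space \<Rightarrow> 'b::{banach, second_countable_topology}"
  assumes [measurable]: "f \<in> borel_measurable borel" and c: "c \<noteq> 0"
  shows "integrable lborel f \<longleftrightarrow> integrable lborel (\<lambda>x. f (t + c *\<^sub>R x))"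
    and "(LINT x|lborel. f x) = \<bar>c\<bar> ^ DIM('a) *\<^sub>R (LINT x|lborel. f (t + c *\<^sub>R x))"
proof -
  have 1: "lborel = density (distr lborel borel (\<lambda>x::'a. t + c *\<^sub>R x)) (\<lambda>_. ennreal (\<bar>c\<bar> ^ DIM('a)))"
    using lborel_affine[OF c, of t] by simp
  have "integrable lborel f \<longleftrightarrow> integrable lborel (\<lambda>x. \<bar>c\<bar> ^ DIM('a) *\<^sub>R f (t + c *\<^sub>R x))"
    using c by (subst 1, subst integrable_density) (auto simp: integrable_distr_eq)
  also have "\<dots> \<longleftrightarrow> integrable lborel (\<lambda>x. f (t + c *\<^sub>R x))"
    using c integrable_scaleR_right[of "inverse (\<bar>c\<bar> ^ DIM('a))" lborel "\<lambda>x. \<bar>c\<bar> ^ DIM('a) *\<^sub>R f (t + c *\<^sub>R x)"]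
    by auto
  finally show "integrable lborel f \<longleftrightarrow> integrable lborel (\<lambda>x. f (t + c *\<^sub>R x))" .
  show "(LINT x|lborel. f x) = \<bar>c\<bar> ^ DIM('a) *\<^sub>R (LINT x|lborel. f (t + c *\<^sub>R x))"
    using c by (subst 1, subst integral_density) (auto simp: integral_distr)
qed


text \<open>The pairing of \<open>h\<close> with \<open>k\<close> smoothed by a Gaussian of width
  \<sigma>. The kernel is not normalised: its mass is \<sigma>^2, so the pairing of \<open>h\<close>
  and \<open>k\<close> is the limit of
  \<open>gauss_form \<sigma> h k / \<sigma>\<^sup>2\<close>.\<close>

definition gauss_form :: "real \<Rightarrow> (real^2 \<Rightarrow> real) \<Rightarrow> (real^2 \<Rightarrow> real) \<Rightarrow> real" where
  "gauss_form \<sigma> h k = (LINT p|(lborel \<Otimes>\<^sub>M lborel). h (fst p) * k (snd p) * gauss2 ((fst p - snd p) /\<^sub>R \<sigma>))"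

lemma integrable_pair_product:
  fixes h k :: "real^2 \<Rightarrow> 'b::{real_normed_field, banach, second_countable_topology}"
  assumes h: "integrable lborel h" and k: "integrable lborel k"
  shows "integrable (lborel \<Otimes>\<^sub>M lborel) (\<lambda>p. h (fst p) * k (snd p))"
proof -
  have [measurable]: "h \<in> borel_measurable borel" "k \<in> borel_measurable borel"
    using h k by auto
  show ?thesis
  proof (rule lborel_pair.Fubini_integrable)
    show "integrable lborel (\<lambda>x. LINT y|lborel. norm (h (fst (x, y)) * k (snd (x, y))))"
      using h by (simp add: norm_mult)
    show "AE x in lborel. integrable lborel (\<lambda>y. h (fst (x, y)) * k (snd (x, y)))"
      using k by simp
  qed measurable
qed

lemma gauss2_pair_measurable [measurable]:
  "(\<lambda>p::(real^2) \<times> (real^2). gauss2 ((fst p - snd p) /\<^sub>R \<sigma>)) \<in> borel_measurable (lborel \<Otimes>\<^sub>M lborel)"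
proof -
  have "(\<lambda>p::(real^2) \<times> (real^2). (fst p - snd p) /\<^sub>R \<sigma>) \<in> borel_measurable (lborel \<Otimes>\<^sub>M lborel)"
    by (simp add: lborel_prod) (intro borel_measurable_continuous_onI continuous_intros)
  then show ?thesis by (rule measurable_compose[OF _ gauss2_measurable])
qed

lemma integrable_gauss_form:
  assumes h: "integrable lborel h" and k: "integrable lborel k"
  shows "integrable (lborel \<Otimes>\<^sub>M lborel) (\<lambda>p. h (fst p) * k (snd p) * gauss2 ((fst p - snd p) /\<^sub>R \<sigma>))"
proof (rule Bochner_Integration.integrable_bound[OF integrable_pair_product[OF h k]])
  have [measurable]: "h \<in> borel_measurable borel" "k \<in> borel_measurable borel"
    using h k by auto
  show "(\<lambda>p. h (fst p) * k (snd p) * gauss2 ((fst p - snd p) /\<^sub>R \<sigma>)) \<in> borel_measurable (lborel \<Otimes>\<^sub>M lborel)"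
    by measurable
  have "gauss2 z \<le> 1" for z
    using gauss2_bounds(2)[of z] pi_gt3 by (smt (verit) divide_le_eq_1)
  then show "AE p in (lborel \<Otimes>\<^sub>M lborel). norm (h (fst p) * k (snd p) * gauss2 ((fst p - snd p) /\<^sub>R \<sigma>))
      \<le> norm (h (fst p) * k (snd p))"
    by (auto simp: abs_mult gauss2_bounds intro!: AE_I2 mult_left_le)
qed

lemma fourier_measurable:
  assumes "integrable lborel f"
  shows "fourier f \<in> borel_measurable borel"
proof -
  have [measurable]: "f \<in> borel_measurable borel" using assms by auto
  have 1: "(\<lambda>p::(real^2) \<times> (real^2). - (snd p \<bullet> fst p)) \<in> borel_measurable (lborel \<Otimes>\<^sub>M lborel)"
    by (simp add: lborel_prod) (intro borel_measurable_continuous_onI continuous_intros)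
  have "(\<lambda>p. cis (- (snd p \<bullet> fst p)) * f (snd p)) \<in> borel_measurable (lborel \<Otimes>\<^sub>M lborel)"
    using measurable_compose[OF 1 cis_measurable] by measurable
  then have "(\<lambda>\<xi>. LINT x|lborel. cis (- (x \<bullet> \<xi>)) * f x) \<in> borel_measurable lborel"
    by (intro lborel.borel_measurable_lebesgue_integral) (simp add: case_prod_beta)
  then show ?thesis by (simp add: fourier_def[abs_def])
qed

lemma cnj_integral_lborel: "cnj (LINT x|lborel. f x) = (LINT x|lborel. cnj (f x))"
  by simp

text \<open>A regularised Plancherel identity. The Gaussian is written as a Fourier integral; the
  Gaussian weight makes the resulting integral absolutely convergent for merely integrable
  \<open>h\<close>, and Fubini does the rest. As the right hand side is nonnegative, the form is
  positive, which \<open>gauss_form_mixed\<close> exploits.\<close>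

lemma gauss_form_fourier:
  fixes h :: "real^2 \<Rightarrow> real"
  assumes h: "integrable lborel h" and "\<sigma> \<noteq> 0"
  shows "2 * pi * gauss_form \<sigma> h h = (LINT \<xi>|lborel. (cmod (fourier (\<lambda>x. of_real (h x)) (\<xi> /\<^sub>R \<sigma>)))\<^sup>2 * gauss2 \<xi>)"
proof -
  let ?P = "lborel \<Otimes>\<^sub>M lborel :: ((real^2) \<times> (real^2)) measure"
  have hm [measurable]: "h \<in> borel_measurable borel" using h by auto
  let ?H = "\<lambda>x. complex_of_real (h x)"
  have H: "integrable lborel ?H" using h by simp
  interpret PP: pair_sigma_finite lborel ?P
    unfolding lborel_prod by standard
  define f where "f \<xi> p = cis (- ((fst p - snd p) \<bullet> (\<xi> /\<^sub>R \<sigma>))) * (?H (fst p) * ?H (snd p)) * of_real (gauss2 \<xi>)"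
    for \<xi> :: "real^2" and p
  have pm: "(\<lambda>z :: (real^2) \<times> ((real^2) \<times> (real^2)). - ((fst (snd z) - snd (snd z)) \<bullet> (fst z /\<^sub>R \<sigma>))) \<in> borel_measurable (lborel \<Otimes>\<^sub>M ?P)"
    by (simp add: lborel_prod) (intro borel_measurable_continuous_onI continuous_intros)
  have fm: "(\<lambda>z. f (fst z) (snd z)) \<in> borel_measurable (lborel \<Otimes>\<^sub>M ?P)"
    unfolding f_def using measurable_compose[OF pm cis_measurable] by measurable
  have HH: "integrable ?P (\<lambda>p. ?H (fst p) * ?H (snd p))" by (rule integrable_pair_product[OF H H])
  have shiftm: "(\<lambda>p::(real^2)\<times>(real^2). - ((fst p - snd p) \<bullet> (\<xi> /\<^sub>R \<sigma>))) \<in> borel_measurable ?P" for \<xi>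
    by (simp add: lborel_prod) (intro borel_measurable_continuous_onI continuous_intros)
  have fi: "integrable ?P (f \<xi>)" for \<xi>
    unfolding f_def
  proof (rule integrable_mult_left, rule Bochner_Integration.integrable_bound[OF HH])
    show "(\<lambda>p. cis (- ((fst p - snd p) \<bullet> (\<xi> /\<^sub>R \<sigma>))) * (?H (fst p) * ?H (snd p))) \<in> borel_measurable ?P"
      using measurable_compose[OF shiftm cis_measurable] by measurable
  qed (auto simp: norm_mult)
  have int: "integrable (lborel \<Otimes>\<^sub>M ?P) (\<lambda>z. f (fst z) (snd z))"
  proof (rule PP.Fubini_integrable[OF fm])
    have "(LINT y|?P. norm (f (fst (x, y)) (snd (x, y)))) = (LINT y|?P. norm (?H (fst y) * ?H (snd y))) * gauss2 x" for x
      by (simp add: f_def norm_mult gauss2_bounds)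
    then show "integrable lborel (\<lambda>x. LINT y|?P. norm (f (fst (x, y)) (snd (x, y))))"
      using integrable_gauss2 by simp
  qed (use fi in auto)
  have A: "(LINT \<xi>|lborel. LINT p|?P. f \<xi> p) = (LINT p|?P. LINT \<xi>|lborel. f \<xi> p)"
    by (rule PP.Fubini_integral[symmetric]) (use int in \<open>simp add: case_prod_beta'\<close>)
  have c: "cnj (fourier ?H \<xi>) = (LINT x|lborel. cis (x \<bullet> \<xi>) * ?H x)" for \<xi>
    unfolding fourier_def cnj_integral_lborel by (simp add: cis_cnj)
  have 1: "(LINT p|?P. f \<xi> p) = of_real ((cmod (fourier ?H (\<xi> /\<^sub>R \<sigma>)))\<^sup>2 * gauss2 \<xi>)" for \<xi>
  proof -
    let ?z = "\<xi> /\<^sub>R \<sigma>"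
    have "(LINT p|?P. f \<xi> p) = (LINT x|lborel. LINT y|lborel. f \<xi> (x, y))"
      using lborel_pair.integral_fst'[OF fi] by simp
    also have "\<dots> = (LINT x|lborel. LINT y|lborel. (cis (- (x \<bullet> ?z)) * ?H x * of_real (gauss2 \<xi>)) * (cis (y \<bullet> ?z) * ?H y))"
    proof -
      have "cis (- ((x - y) \<bullet> ?z)) = cis (- (x \<bullet> ?z)) * cis (y \<bullet> ?z)" for x y
        unfolding cis_mult by (simp only: inner_diff_left) (simp add: algebra_simps)
      then show ?thesis by (simp only: f_def fst_conv snd_conv mult_ac)
    qed
    also have "\<dots> = (LINT x|lborel. (cis (- (x \<bullet> ?z)) * ?H x) * (of_real (gauss2 \<xi>) * cnj (fourier ?H ?z)))"
      by (simp only: integral_mult_right_zero c mult.assoc)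
    also have "\<dots> = fourier ?H ?z * cnj (fourier ?H ?z) * of_real (gauss2 \<xi>)"
      by (simp only: integral_mult_left_zero) (simp only: fourier_def mult_ac)
    also have "\<dots> = of_real ((cmod (fourier ?H ?z))\<^sup>2 * gauss2 \<xi>)"
      by (simp only: of_real_mult complex_norm_square)
    finally show ?thesis .
  qed
  have 2: "(LINT \<xi>|lborel. f \<xi> p) = of_real (2 * pi * (h (fst p) * h (snd p) * gauss2 ((fst p - snd p) /\<^sub>R \<sigma>)))" for p
  proof -
    have "(LINT \<xi>|lborel. f \<xi> p) = (LINT \<xi>|lborel. (?H (fst p) * ?H (snd p)) * (cis (\<xi> \<bullet> (- ((fst p - snd p) /\<^sub>R \<sigma>))) * of_real (gauss2 \<xi>)))"
      by (simp add: f_def mult_ac inner_commute)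
    also have "\<dots> = (?H (fst p) * ?H (snd p)) * of_real (2 * pi * gauss2 (- ((fst p - snd p) /\<^sub>R \<sigma>)))"
      by (simp only: integral_mult_right_zero gauss2_fourier)
    finally show ?thesis by (simp add: gauss2_eq norm_minus_commute)
  qed
  have "complex_of_real (LINT \<xi>|lborel. (cmod (fourier ?H (\<xi> /\<^sub>R \<sigma>)))\<^sup>2 * gauss2 \<xi>) =
      of_real (LINT p|?P. 2 * pi * (h (fst p) * h (snd p) * gauss2 ((fst p - snd p) /\<^sub>R \<sigma>)))"
    using A unfolding 1 2 integral_complex_of_real .
  then have "(LINT \<xi>|lborel. (cmod (fourier ?H (\<xi> /\<^sub>R \<sigma>)))\<^sup>2 * gauss2 \<xi>) =
      (LINT p|?P. 2 * pi * (h (fst p) * h (snd p) * gauss2 ((fst p - snd p) /\<^sub>R \<sigma>)))"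
    unfolding of_real_eq_iff .
  then show ?thesis by (simp add: gauss_form_def)
qed


text \<open>The kernel is symmetric and has mass \<sigma>^2 in each variable, so the inequality g(x)
  g(y) <= (g(x)^2 + g(y)^2) / 2 under the integral is enough.\<close>

lemma gauss_form_le_L2:
  assumes g: "integrable lborel g" "integrable lborel (\<lambda>x. (g x)\<^sup>2)" and \<sigma>: "\<sigma> > 0"
  shows "gauss_form \<sigma> g g \<le> \<sigma>\<^sup>2 * (LINT x|lborel. (g x)\<^sup>2)"
proof -
  let ?k = "\<lambda>p::(real^2)\<times>(real^2). gauss2 ((fst p - snd p) /\<^sub>R \<sigma>)"
  have [measurable]: "g \<in> borel_measurable borel" using g by auto
  have shift: "(\<lambda>y. gauss2 ((x - y) /\<^sub>R \<sigma>)) \<in> borel_measurable borel" for x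
    by (rule measurable_compose[OF _ gauss2_measurable])
       (intro borel_measurable_continuous_onI continuous_intros)
  have kint: "integrable lborel (\<lambda>y. gauss2 ((x - y) /\<^sub>R \<sigma>))" "(LINT y|lborel. gauss2 ((x - y) /\<^sub>R \<sigma>)) = \<sigma>\<^sup>2" for x
    using lborel_affine_integral[OF shift[of x], where c = "- \<sigma>" and t = x] integrable_gauss2 integral_gauss2 \<sigma>
    by (simp_all add: power2_eq_square)
  have int: "integrable (lborel \<Otimes>\<^sub>M lborel) (\<lambda>p. (g (fst p))\<^sup>2 * ?k p)"
  proof (rule lborel_pair.Fubini_integrable)
    show "integrable lborel (\<lambda>x. LINT y|lborel. norm ((g (fst (x, y)))\<^sup>2 * ?k (x, y)))"
      using g(2) kint by (simp add: abs_mult gauss2_bounds)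
    show "AE x in lborel. integrable lborel (\<lambda>y. (g (fst (x, y)))\<^sup>2 * ?k (x, y))"
      using kint by simp
  qed measurable
  have I: "(LINT p|(lborel \<Otimes>\<^sub>M lborel). (g (fst p))\<^sup>2 * ?k p) = \<sigma>\<^sup>2 * (LINT x|lborel. (g x)\<^sup>2)"
    using lborel_pair.integral_fst'[OF int] by (simp add: kint mult.commute)
  have sym: "?k (y, x) = ?k (x, y)" for x y
    by (simp add: gauss2_eq norm_minus_commute)
  have int': "integrable (lborel \<Otimes>\<^sub>M lborel) (\<lambda>p. (g (snd p))\<^sup>2 * ?k p)"
    using lborel_pair.integrable_product_swap[OF int] sym by (simp add: case_prod_beta')
  have I': "(LINT p|(lborel \<Otimes>\<^sub>M lborel). (g (snd p))\<^sup>2 * ?k p) = \<sigma>\<^sup>2 * (LINT x|lborel. (g x)\<^sup>2)"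
    using lborel_pair.integral_product_swap[of "\<lambda>p. (g (fst p))\<^sup>2 * ?k p"] int sym I
    by (simp add: case_prod_beta')
  have "gauss_form \<sigma> g g \<le> (LINT p|(lborel \<Otimes>\<^sub>M lborel). ((g (fst p))\<^sup>2 * ?k p + (g (snd p))\<^sup>2 * ?k p) / 2)"
    unfolding gauss_form_def
  proof (rule integral_mono)
    fix p :: "(real^2) \<times> (real^2)"
    have "g (fst p) * g (snd p) \<le> ((g (fst p))\<^sup>2 + (g (snd p))\<^sup>2) / 2"
      using sum_squares_bound[of "g (fst p)" "g (snd p)"] by simp
    then have "g (fst p) * g (snd p) * ?k p \<le> ((g (fst p))\<^sup>2 + (g (snd p))\<^sup>2) / 2 * ?k p"
      by (rule mult_right_mono) (rule gauss2_bounds)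
    then show "g (fst p) * g (snd p) * ?k p \<le> ((g (fst p))\<^sup>2 * ?k p + (g (snd p))\<^sup>2 * ?k p) / 2"
      by (simp add: algebra_simps add_divide_distrib)
  qed (use integrable_gauss_form[OF g(1) g(1)] int int' in auto)
  also have "\<dots> = \<sigma>\<^sup>2 * (LINT x|lborel. (g x)\<^sup>2)"
    using int int' I I' by simp
  finally show ?thesis .
qed

text \<open>The Gaussian weight is at most 1, and the substitution of \<xi>/\<sigma> for \<xi> costs
  \<sigma>^2. Only an upper bound is wanted, so the factor 2 pi is dropped by positivity of the
  form.\<close>

lemma gauss_form_le_fourier:
  fixes h :: "real^2 \<Rightarrow> real"
  assumes h: "integrable lborel h" and \<sigma>: "\<sigma> > 0"
    and L2: "integrable lborel (\<lambda>\<xi>. (cmod (fourier (\<lambda>x. of_real (h x)) \<xi>))\<^sup>2)"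
  shows "gauss_form \<sigma> h h \<le> \<sigma>\<^sup>2 * (LINT \<xi>|lborel. (cmod (fourier (\<lambda>x. of_real (h x)) \<xi>))\<^sup>2)"
proof -
  define F where "F \<xi> = (cmod (fourier (\<lambda>x. of_real (h x)) \<xi>))\<^sup>2" for \<xi>
  have H: "integrable lborel (\<lambda>x. complex_of_real (h x))" using h by simp
  have [measurable]: "F \<in> borel_measurable borel"
    unfolding F_def using fourier_measurable[OF H] by measurable
  have F0: "0 \<le> F \<xi>" for \<xi> by (simp add: F_def)
  note aff = lborel_affine_integral[OF \<open>F \<in> borel_measurable borel\<close>, of "inverse \<sigma>" 0]
  have "integrable lborel F" using L2 unfolding F_def[abs_def] .
  then have i: "integrable lborel (\<lambda>\<xi>. F (\<xi> /\<^sub>R \<sigma>))" using aff(1) \<sigma> by simp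
  have e: "(LINT \<xi>|lborel. F (\<xi> /\<^sub>R \<sigma>)) = \<sigma>\<^sup>2 * (LINT \<xi>|lborel. F \<xi>)"
    using aff(2) \<sigma> by (simp add: field_simps power2_eq_square)
  have g1: "gauss2 z \<le> 1" for z
    using gauss2_bounds(2)[of z] pi_gt3 by (smt (verit) divide_le_eq_1)
  have m: "(\<lambda>\<xi>. F (\<xi> /\<^sub>R \<sigma>)) \<in> borel_measurable borel" using i by auto
  have "(LINT \<xi>|lborel. F (\<xi> /\<^sub>R \<sigma>) * gauss2 \<xi>) \<le> (LINT \<xi>|lborel. F (\<xi> /\<^sub>R \<sigma>))"
  proof (rule integral_mono)
    show "integrable lborel (\<lambda>\<xi>. F (\<xi> /\<^sub>R \<sigma>) * gauss2 \<xi>)"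
      by (rule Bochner_Integration.integrable_bound[OF i])
         (use m F0 gauss2_bounds g1 in \<open>auto simp: abs_mult intro!: AE_I2 mult_left_le\<close>)
  qed (use i F0 g1 in \<open>auto intro!: mult_left_le\<close>)
  then have "2 * pi * gauss_form \<sigma> h h \<le> \<sigma>\<^sup>2 * (LINT \<xi>|lborel. F \<xi>)"
    using gauss_form_fourier[OF h, of \<sigma>] \<sigma> e by (simp add: F_def)
  moreover have "0 \<le> 2 * pi * gauss_form \<sigma> h h"
    using gauss_form_fourier[OF h, of \<sigma>] \<sigma> gauss2_bounds by simp
  then have "gauss_form \<sigma> h h \<le> 2 * pi * gauss_form \<sigma> h h"
    using pi_gt3 by (smt (verit) mult_le_cancel_right1 zero_le_mult_iff)
  ultimately show ?thesis by (simp add: F_def)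
qed

text \<open>The form is symmetric and nonnegative at \<open>h - k\<close>.\<close>

lemma gauss_form_mixed:
  assumes h: "integrable lborel h" and k: "integrable lborel k" and \<sigma>: "\<sigma> > 0"
  shows "2 * gauss_form \<sigma> h k \<le> gauss_form \<sigma> h h + gauss_form \<sigma> k k"
proof -
  have "0 \<le> 2 * pi * gauss_form \<sigma> (\<lambda>x. h x - k x) (\<lambda>x. h x - k x)"
    using \<sigma> gauss2_bounds by (subst gauss_form_fourier) (use h k in auto)
  then have 0: "0 \<le> gauss_form \<sigma> (\<lambda>x. h x - k x) (\<lambda>x. h x - k x)"
    using mult_pos_neg[of "2 * pi"] by (meson linorder_not_less mult_pos_pos pi_gt_zero zero_less_numeral)
  note i = integrable_gauss_form[of _ _ \<sigma>]
  have "gauss_form \<sigma> (\<lambda>x. h x - k x) (\<lambda>x. h x - k x) =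
    gauss_form \<sigma> h h - gauss_form \<sigma> h k - (gauss_form \<sigma> k h - gauss_form \<sigma> k k)"
    unfolding gauss_form_def
    by (subst Bochner_Integration.integral_diff[symmetric], (intro Bochner_Integration.integrable_diff i h k)+)+
       (rule Bochner_Integration.integral_cong, auto simp: algebra_simps)
  moreover have "gauss_form \<sigma> k h = gauss_form \<sigma> h k"
  proof -
    have "gauss2 ((y - x) /\<^sub>R \<sigma>) = gauss2 ((x - y) /\<^sub>R \<sigma>)" for x y
      by (simp add: gauss2_eq norm_minus_commute)
    then show ?thesis
      using lborel_pair.integral_product_swap[of "\<lambda>p. h (fst p) * k (snd p) * gauss2 ((fst p - snd p) /\<^sub>R \<sigma>)"]
        i[OF h k]
      by (simp add: gauss_form_def case_prod_beta' mult.commute[of "h _"])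
  qed
  ultimately show ?thesis using 0 by simp
qed

text \<open>After the substitution y = x - \<sigma> z the inner integral is \<sigma>^2 times an
  average of \<open>k\<close>, bounded by \<open>K\<close> and converging to \<open>k x\<close> by
  continuity; dominated convergence is used for the inner and for the outer integral.\<close>

lemma gauss_form_tendsto:
  assumes h: "integrable lborel h" and k: "continuous_on UNIV k" "integrable lborel k" "\<And>x. \<bar>k x\<bar> \<le> K"
    and \<sigma>: "\<sigma> \<longlonglongrightarrow> 0" "\<And>n. \<sigma> n > 0"
  shows "(\<lambda>n. gauss_form (\<sigma> n) h k / (\<sigma> n)\<^sup>2) \<longlonglongrightarrow> (LINT x|lborel. h x * k x)"
proof -
  have [measurable]: "h \<in> borel_measurable borel" "k \<in> borel_measurable borel"
    using h k by auto
  define S where "S n x = (LINT z|lborel. k (x - \<sigma> n *\<^sub>R z) * gauss2 z)" for n x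
  have km: "(\<lambda>y. k (f y)) \<in> borel_measurable borel" if "continuous_on UNIV f" for f
    using k(1) that by (intro borel_measurable_continuous_onI continuous_on_compose2[OF k(1)]) auto
  have gm: "(\<lambda>y. k y * gauss2 ((x - y) /\<^sub>R s)) \<in> borel_measurable borel" for x s
  proof -
    have "(\<lambda>y. gauss2 ((x - y) /\<^sub>R s)) \<in> borel_measurable borel"
      by (rule measurable_compose[OF _ gauss2_measurable])
         (intro borel_measurable_continuous_onI continuous_intros)
    then show ?thesis by measurable
  qed
  have "(LINT y|lborel. k y * gauss2 ((x - y) /\<^sub>R \<sigma> n)) = (\<sigma> n)\<^sup>2 * S n x" for n x
    using lborel_affine_integral(2)[OF gm[of "\<sigma> n" x], where c = "- \<sigma> n" and t = x] \<sigma>(2)[of n]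
    by (simp add: S_def power2_eq_square)
  then have e1: "(LINT y|lborel. h x * (k y * gauss2 ((x - y) /\<^sub>R \<sigma> n))) = (\<sigma> n)\<^sup>2 * (h x * S n x)" for n x
    by simp
  have e2: "gauss_form (\<sigma> n) h k = (LINT x|lborel. LINT y|lborel. h x * (k y * gauss2 ((x - y) /\<^sub>R \<sigma> n)))" for n
    unfolding gauss_form_def
    using lborel_pair.integral_fst'[OF integrable_gauss_form[OF h k(2), of "\<sigma> n"]]
    by (simp add: mult.assoc)
  have eq: "gauss_form (\<sigma> n) h k / (\<sigma> n)\<^sup>2 = (LINT x|lborel. h x * S n x)" for n
    unfolding e2 e1 using \<sigma>(2)[of n] by simp
  have Sb: "\<bar>S n x\<bar> \<le> K" for n x
  proof -
    have "norm (S n x) \<le> (LINT z|lborel. K * gauss2 z)"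
      unfolding S_def
    proof (rule Bochner_Integration.integral_norm_bound_integral)
      have "norm (k (x - \<sigma> n *\<^sub>R z) * gauss2 z) \<le> K * gauss2 z" for z
        using k(3) gauss2_bounds by (auto simp: abs_mult intro!: mult_right_mono)
      then have "norm (k (x - \<sigma> n *\<^sub>R z) * gauss2 z) \<le> norm (K * gauss2 z)" for z
        by (rule order_trans) simp
      moreover have "(\<lambda>z. k (x - \<sigma> n *\<^sub>R z)) \<in> borel_measurable borel"
        by (intro km continuous_intros)
      ultimately show "integrable lborel (\<lambda>z. k (x - \<sigma> n *\<^sub>R z) * gauss2 z)"
        by (intro Bochner_Integration.integrable_bound[OF integrable_mult_right[OF integrable_gauss2], of _ K] AE_I2) auto
    qed (use integrable_gauss2 gauss2_bounds k(3) in \<open>auto simp: abs_mult intro!: mult_right_mono\<close>)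
    then show ?thesis using integral_gauss2 by simp
  qed
  have Sm: "S n \<in> borel_measurable borel" for n
  proof -
    have "(\<lambda>p::(real^2)\<times>(real^2). k (fst p - \<sigma> n *\<^sub>R snd p)) \<in> borel_measurable (lborel \<Otimes>\<^sub>M lborel)"
      by (simp add: lborel_prod)
         (intro borel_measurable_continuous_onI continuous_on_compose2[OF k(1)] continuous_intros, auto)
    then have "(\<lambda>p. k (fst p - \<sigma> n *\<^sub>R snd p) * gauss2 (snd p)) \<in> borel_measurable (lborel \<Otimes>\<^sub>M lborel)"
      by measurable
    then have "(\<lambda>x. LINT z|lborel. k (x - \<sigma> n *\<^sub>R z) * gauss2 z) \<in> borel_measurable lborel"
      by (intro lborel.borel_measurable_lebesgue_integral) (simp add: case_prod_beta')
    then show ?thesis by (simp add: S_def[abs_def])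
  qed
  have Slim: "(\<lambda>n. S n x) \<longlonglongrightarrow> k x" for x
  proof -
    have "(\<lambda>n. S n x) \<longlonglongrightarrow> (LINT z|lborel. k x * gauss2 z)"
      unfolding S_def
    proof (rule integral_dominated_convergence[where w = "\<lambda>z. K * gauss2 z"])
      show "(\<lambda>z. k (x - \<sigma> n *\<^sub>R z) * gauss2 z) \<in> borel_measurable lborel" for n
      proof -
        have "(\<lambda>z. k (x - \<sigma> n *\<^sub>R z)) \<in> borel_measurable borel" by (intro km continuous_intros)
        then show ?thesis by measurable
      qed
      have "(\<lambda>n. k (x - \<sigma> n *\<^sub>R z)) \<longlonglongrightarrow> k x" for z
      proof -
        have "(\<lambda>n. x - \<sigma> n *\<^sub>R z) \<longlonglongrightarrow> x" using \<sigma>(1) by (auto intro!: tendsto_eq_intros)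
        moreover have "isCont k x" using k(1) by (simp add: continuous_on_eq_continuous_at)
        ultimately show ?thesis by (rule isCont_tendsto_compose[rotated])
      qed
      then show "AE z in lborel. (\<lambda>n. k (x - \<sigma> n *\<^sub>R z) * gauss2 z) \<longlonglongrightarrow> k x * gauss2 z"
        by (auto intro!: AE_I2 tendsto_intros)
      show "AE z in lborel. norm (k (x - \<sigma> n *\<^sub>R z) * gauss2 z) \<le> K * gauss2 z" for n
        using k(3) gauss2_bounds by (auto simp: abs_mult intro!: AE_I2 mult_right_mono)
    qed (use integrable_gauss2 in auto)
    then show ?thesis using integral_gauss2 by simp
  qed
  show ?thesis
    unfolding eq
  proof (rule integral_dominated_convergence[where w = "\<lambda>x. K * \<bar>h x\<bar>"])
    show "AE x in lborel. norm (h x * S n x) \<le> K * \<bar>h x\<bar>" for n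
      using Sb by (auto simp: abs_mult mult.commute[of K] intro!: AE_I2 mult_left_mono)
    show "AE x in lborel. (\<lambda>n. h x * S n x) \<longlonglongrightarrow> h x * k x"
      using Slim by (auto intro!: AE_I2 tendsto_intros)
  qed (use h Sm in auto)
qed


text \<open>One half of Plancherel in dual form: testing \<open>h\<close> costs no more than the
  squared norms of its Fourier transform and of the test function. The factors \<sigma>^2 of the
  estimates cancel before the limit is taken.\<close>

lemma square_test_bound:
  assumes h: "integrable lborel h"
    and L2: "integrable lborel (\<lambda>\<xi>. (cmod (fourier (\<lambda>x. of_real (h x)) \<xi>))\<^sup>2)"
    and k: "continuous_on UNIV k" "integrable lborel k" "\<And>x. \<bar>k x\<bar> \<le> K" "integrable lborel (\<lambda>x. (k x)\<^sup>2)"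
  shows "2 * (LINT x|lborel. h x * k x) \<le>
    (LINT \<xi>|lborel. (cmod (fourier (\<lambda>x. of_real (h x)) \<xi>))\<^sup>2) + (LINT x|lborel. (k x)\<^sup>2)"
proof -
  define \<sigma> :: "nat \<Rightarrow> real" where "\<sigma> n = inverse (real (Suc n))" for n
  have \<sigma>: "\<sigma> \<longlonglongrightarrow> 0" "\<sigma> n > 0" for n
    unfolding \<sigma>_def by (rule LIMSEQ_inverse_real_of_nat) simp
  have "(\<lambda>n. 2 * (gauss_form (\<sigma> n) h k / (\<sigma> n)\<^sup>2)) \<longlonglongrightarrow> 2 * (LINT x|lborel. h x * k x)"
    by (intro tendsto_intros gauss_form_tendsto[OF h k(1-3) \<sigma>])
  then show ?thesis
  proof (rule LIMSEQ_le_const2, intro exI allI impI)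
    fix n
    show "2 * (gauss_form (\<sigma> n) h k / (\<sigma> n)\<^sup>2) \<le> (LINT \<xi>|lborel. (cmod (fourier (\<lambda>x. of_real (h x)) \<xi>))\<^sup>2) + (LINT x|lborel. (k x)\<^sup>2)"
      using gauss_form_mixed[OF h k(2) \<sigma>(2)[of n]] gauss_form_le_fourier[OF h \<sigma>(2)[of n] L2]
        gauss_form_le_L2[OF k(2,4) \<sigma>(2)[of n]] \<sigma>(2)[of n]
      by (simp add: field_simps)
  qed
qed

section \<open>Square integrability by duality\<close>

lemma bounded_truncation_approx:
  fixes h :: "real^2 \<Rightarrow> real"
  assumes h: "h \<in> borel_measurable borel" "\<And>x. 0 \<le> h x" "\<And>x. h x \<le> N" and supp: "\<And>x. h x \<noteq> 0 \<Longrightarrow> norm x \<le> r"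
  shows "\<exists>k :: nat \<Rightarrow> real^2 \<Rightarrow> real. (\<forall>n. continuous_on UNIV (k n)) \<and>
    (\<forall>n x. 0 \<le> k n x \<and> k n x \<le> N \<and> (k n x \<noteq> 0 \<longrightarrow> norm x \<le> r + 1)) \<and>
    (AE x in lborel. (\<lambda>n. k n x) \<longlonglongrightarrow> h x)"
proof -
  have "h measurable_on UNIV"
    using h(1) by (simp add: measurable_on_iff_borel_measurable lebesgue_on_UNIV_eq measurable_completion)
  then obtain Z g where Z: "negligible Z" and g: "\<And>n. continuous_on UNIV (g n)"
    "\<And>x. x \<notin> Z \<Longrightarrow> (\<lambda>n. g n x) \<longlonglongrightarrow> h x"
    unfolding measurable_on_def by auto
  have "AE x in lebesgue. x \<notin> Z"
    using Z by (simp add: negligible_iff_null_sets AE_not_in)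
  then have ae: "AE x in lborel. x \<notin> Z" by (simp add: AE_completion_iff)
  have N: "0 \<le> N" using h(2,3)[of 0] by simp
  \<comment> \<open>A continuous plateau: 1 on the ball of radius \<open>r\<close>, outside of which
    \<open>h\<close> vanishes, and 0 beyond radius \<open>r + 1\<close>. It keeps the approximants
    in L1 and L2 without changing the limit.\<close>
  define b where "b x = max 0 (min 1 (r + 1 - norm x))" for x :: "real^2"
  have b: "0 \<le> b x" "b x \<le> 1" "b x \<noteq> 0 \<Longrightarrow> norm x \<le> r + 1" "h x * b x = h x" for x
    using supp[of x] by (auto simp: b_def max_def min_def split: if_splits)
  define k where "k n x = max 0 (min N (g n x)) * b x" for n x
  show ?thesis
  proof (intro exI[of _ k] conjI allI impI)
    show "continuous_on UNIV (k n)" for n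
      unfolding k_def b_def by (intro continuous_intros g)
    show "0 \<le> k n x" for n x using b by (simp add: k_def)
    show "k n x \<le> N" for n x
      unfolding k_def by (rule order_trans[OF mult_left_le[OF b(2)]]) (use N in auto)
    show "k n x \<noteq> 0 \<Longrightarrow> norm x \<le> r + 1" for n x using b(3) by (auto simp: k_def)
    show "AE x in lborel. (\<lambda>n. k n x) \<longlonglongrightarrow> h x"
      using ae
    proof eventually_elim
      case (elim x)
      have "(\<lambda>n. k n x) \<longlonglongrightarrow> max 0 (min N (h x)) * b x"
        unfolding k_def by (intro tendsto_intros g(2)[OF elim])
      moreover have "max 0 (min N (h x)) * b x = h x" using h(2,3)[of x] b(4)[of x] by simp
      ultimately show ?case by simp
    qed
  qed
qed

text \<open>Testing with approximants of the truncation T = min h n gives, in the limit, twice the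
  integral of h T bounded by M plus the integral of T^2. Since T^2 <= h T and the integral of T^2 is
  finite, it can be absorbed and is at most M, uniformly in n; monotone convergence concludes. The
  bounded support supplies the dominating functions.\<close>

lemma square_integrable_if_fourier:
  fixes h :: "real^2 \<Rightarrow> real"
  assumes h: "integrable lborel h" and nn: "\<And>x. 0 \<le> h x" and supp: "\<And>x. h x \<noteq> 0 \<Longrightarrow> norm x \<le> r"
    and L2: "integrable lborel (\<lambda>\<xi>. (cmod (fourier (\<lambda>x. of_real (h x)) \<xi>))\<^sup>2)"
  shows "integrable lborel (\<lambda>x. (h x)\<^sup>2)"
proof -
  have [measurable]: "h \<in> borel_measurable borel" using h by auto
  define M where "M = (LINT \<xi>|lborel. (cmod (fourier (\<lambda>x. of_real (h x)) \<xi>))\<^sup>2)"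
  define T where "T n x = min (h x) (real n)" for n x
  have Tm [measurable]: "T n \<in> borel_measurable borel" for n unfolding T_def by measurable
  have Tb: "0 \<le> T n x" "T n x \<le> real n" "T n x \<le> h x" for n x using nn by (auto simp: T_def)
  have box: "integrable lborel (\<lambda>x::real^2. c * indicator (cball 0 (r + 1)) x)" for c :: real
    by (intro integrable_mult_right integrable_real_indicator) (auto intro: emeasure_bounded_finite simp flip: infinity_ennreal_def)
  have Ti: "integrable lborel (\<lambda>x. (T n x)\<^sup>2)" and bound: "(LINT x|lborel. (T n x)\<^sup>2) \<le> M" for n
  proof -
    have T0: "T n x \<noteq> 0 \<Longrightarrow> norm x \<le> r" for x using supp[of x] Tb[of n x] by (auto simp: T_def)
    obtain k where K: "\<forall>i. continuous_on UNIV (k i)"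
      "\<forall>i x. 0 \<le> k i x \<and> k i x \<le> real n \<and> (k i x \<noteq> 0 \<longrightarrow> norm x \<le> r + 1)"
      "AE x in lborel. (\<lambda>i. k i x) \<longlonglongrightarrow> T n x"
      using bounded_truncation_approx[OF Tm[of n] Tb(1)[of n] Tb(2)[of n] T0] by blast
    have k: "continuous_on UNIV (k i)" "0 \<le> k i x" "k i x \<le> real n"
      "k i x \<noteq> 0 \<Longrightarrow> norm x \<le> r + 1" "AE x in lborel. (\<lambda>i. k i x) \<longlonglongrightarrow> T n x" for i x
      using K by auto
    have km [measurable]: "k i \<in> borel_measurable borel" for i
      using k(1) by (rule borel_measurable_continuous_onI)
    have kb: "\<bar>k i x\<bar> \<le> real n * indicator (cball 0 (r + 1)) x" for i x
      using k(2)[of i x] k(3)[of i x] k(4)[of i x] by (auto simp: indicator_def)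
    have kb2: "(k i x)\<^sup>2 \<le> (real n)\<^sup>2 * indicator (cball 0 (r + 1)) x" for i x
      using k(2)[of i x] k(3)[of i x] k(4)[of i x] by (auto simp: indicator_def power_mono)
    have ki: "integrable lborel (k i)" for i
      by (rule Bochner_Integration.integrable_bound[OF box[of "real n"]]) (use kb[of i] in auto)
    have k2i: "integrable lborel (\<lambda>x. (k i x)\<^sup>2)" for i
      by (rule Bochner_Integration.integrable_bound[OF box[of "(real n)\<^sup>2"]]) (use kb2[of i] in auto)
    have "integrable lborel (\<lambda>x. (T n x)\<^sup>2) \<and> (\<lambda>i. LINT x|lborel. (k i x)\<^sup>2) \<longlonglongrightarrow> (LINT x|lborel. (T n x)\<^sup>2)"
    proof (intro conjI integrable_dominated_convergence[OF _ _ box[of "(real n)\<^sup>2"]]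
        integral_dominated_convergence[OF _ _ box[of "(real n)\<^sup>2"]])
      show "AE x in lborel. (\<lambda>i. (k i x)\<^sup>2) \<longlonglongrightarrow> (T n x)\<^sup>2"
        using k(5) by eventually_elim (intro tendsto_intros)
      then show "AE x in lborel. (\<lambda>i. (k i x)\<^sup>2) \<longlonglongrightarrow> (T n x)\<^sup>2" .
    qed (use kb2 in auto)
    then have Ti: "integrable lborel (\<lambda>x. (T n x)\<^sup>2)"
      and l1: "(\<lambda>i. LINT x|lborel. (k i x)\<^sup>2) \<longlonglongrightarrow> (LINT x|lborel. (T n x)\<^sup>2)" by auto
    show "integrable lborel (\<lambda>x. (T n x)\<^sup>2)" by (rule Ti)
    have nh: "integrable lborel (\<lambda>x. real n * h x)" using h by simp
    have hT: "integrable lborel (\<lambda>x. h x * T n x)"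
      by (rule Bochner_Integration.integrable_bound[OF nh])
         (use Tb nn in \<open>auto simp: abs_mult mult.commute[of "real n"] intro!: AE_I2 mult_left_mono\<close>)
    have l2: "(\<lambda>i. LINT x|lborel. h x * k i x) \<longlonglongrightarrow> (LINT x|lborel. h x * T n x)"
    proof (rule integral_dominated_convergence[OF _ _ nh])
      show "AE x in lborel. (\<lambda>i. h x * k i x) \<longlonglongrightarrow> h x * T n x"
        using k(5) by eventually_elim (intro tendsto_intros)
      show "AE x in lborel. norm (h x * k i x) \<le> real n * h x" for i
        using k(2,3) nn by (auto simp: abs_mult mult.commute[of "real n"] intro!: AE_I2 mult_left_mono)
    qed auto
    have "2 * (LINT x|lborel. h x * k i x) \<le> M + (LINT x|lborel. (k i x)\<^sup>2)" for i
      unfolding M_def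
    proof (rule square_test_bound[OF h L2 k(1) ki _ k2i])
      show "\<bar>k i x\<bar> \<le> real n" for x using k(2)[of i x] k(3)[of i x] by simp
    qed
    then have "2 * (LINT x|lborel. h x * T n x) \<le> M + (LINT x|lborel. (T n x)\<^sup>2)"
      by (intro LIMSEQ_le[OF tendsto_mult[OF tendsto_const l2] tendsto_add[OF tendsto_const l1]]) auto
    moreover have "(LINT x|lborel. (T n x)\<^sup>2) \<le> (LINT x|lborel. h x * T n x)"
      by (rule integral_mono[OF Ti hT]) (use Tb in \<open>auto simp: power2_eq_square intro!: mult_right_mono\<close>)
    ultimately show "(LINT x|lborel. (T n x)\<^sup>2) \<le> M" by simp
  qed
  have mono: "(T m x)\<^sup>2 \<le> (T n x)\<^sup>2" if "m \<le> n" for m n x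
    using that Tb[of m x] by (intro power_mono) (auto simp: T_def)
  have inc: "incseq (\<lambda>n. LINT x|lborel. (T n x)\<^sup>2)"
    by (intro incseq_SucI integral_mono Ti mono) simp
  then obtain L where L: "(\<lambda>n. LINT x|lborel. (T n x)\<^sup>2) \<longlonglongrightarrow> L"
    using incseq_convergent[OF inc, of M] bound by metis
  show ?thesis
  proof (rule integrable_monotone_convergence[OF _ _ _ L])
    show "AE x in lborel. mono (\<lambda>n. (T n x)\<^sup>2)" using mono by (intro AE_I2 monoI) auto
    show "AE x in lborel. (\<lambda>n. (T n x)\<^sup>2) \<longlonglongrightarrow> (h x)\<^sup>2"
    proof (rule AE_I2)
      fix x
      obtain m where "h x \<le> real m" using real_arch_simple by blast
      then have "\<forall>\<^sub>F n in sequentially. (T n x)\<^sup>2 = (h x)\<^sup>2"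
        by (intro eventually_sequentiallyI[of m]) (auto simp: T_def min_def)
      then show "(\<lambda>n. (T n x)\<^sup>2) \<longlonglongrightarrow> (h x)\<^sup>2" by (rule tendsto_eventually)
    qed
  qed (use Ti in auto)
qed

lemma integrable_japanese_bracket:
  fixes q :: real
  assumes "q > 1"
  shows "integrable lborel (\<lambda>x::real. (1 + x\<^sup>2) powr (- q / 2))"
proof -
  \<comment> \<open>The tail x^(-q) on a half line; with its reflection and the indicator of [-1, 1]
    it forms an integrable majorant.\<close>
  define f where "f x = (if x < 1 then 0 else x powr - q)" for x :: real
  have fm: "f \<in> borel_measurable borel" unfolding f_def by measurable
  have "((\<lambda>x. x powr - q) has_integral - (1 powr (- q + 1)) / (- q + 1)) {1..}"
    using assms by (intro has_integral_powr_to_inf) auto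
  then have "(f has_integral - (1 powr (- q + 1)) / (- q + 1)) UNIV"
    unfolding has_integral_restrict_UNIV[of "{1..}", symmetric]
    by (rule has_integral_eq[rotated]) (auto simp: f_def)
  then have "(\<integral>\<^sup>+ x. ennreal (f x) \<partial>lborel) = ennreal (- (1 powr (- q + 1)) / (- q + 1))"
    by (rule nn_integral_has_integral_lborel[OF fm, rotated]) (simp add: f_def)
  then have "integrable lborel f"
    using fm by (intro integrableI_nonneg) (auto simp: f_def[abs_def] less_top)
  moreover then have "integrable lborel (\<lambda>x. f (- x))"
    using lborel_integrable_real_affine[of f "-1" 0] by simp
  moreover have "integrable lborel (indicator {-1..1::real} :: real \<Rightarrow> real)"
    by (rule integrable_real_indicator) auto
  ultimately have int: "integrable lborel (\<lambda>x. f x + f (- x) + indicator {-1..1} x)"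
    by (intro Bochner_Integration.integrable_add)
  show ?thesis
  proof (rule Bochner_Integration.integrable_bound[OF int])
    have small: "(1 + x\<^sup>2) powr (- q / 2) \<le> 1" for x :: real
      using assms powr_mono2'[of "- q / 2" 1 "1 + x\<^sup>2"] by simp
    have large: "(1 + x\<^sup>2) powr (- q / 2) \<le> \<bar>x\<bar> powr - q" if "\<bar>x\<bar> \<ge> 1" for x :: real
    proof -
      have "(1 + x\<^sup>2) powr (- q / 2) \<le> (\<bar>x\<bar> powr 2) powr (- q / 2)"
        using that assms by (intro powr_mono2') (auto simp: powr_numeral)
      then show ?thesis unfolding powr_powr by simp
    qed
    have "(1 + x\<^sup>2) powr (- q / 2) \<le> f x + f (- x) + indicator {-1..1} x" for x
    proof (cases "\<bar>x\<bar> \<le> 1")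
      case True
      then show ?thesis using small[of x] by (auto simp: f_def indicator_def intro: add_increasing)
    next
      case False
      then show ?thesis using large[of x] by (auto simp: f_def indicator_def)
    qed
    moreover have "0 \<le> f x + f (- x) + indicator {-1..1} x" for x by (auto simp: f_def)
    ultimately show "AE x in lborel. norm ((1 + x\<^sup>2) powr (- q / 2)) \<le> norm (f x + f (- x) + indicator {-1..1} x)"
      by (intro AE_I2) auto
  qed measurable
qed

text \<open>Since (1 + \<xi>1^2)(1 + \<xi>2^2) <= (1 + |\<xi>|^2)^2, the square of the Fourier
  transform is bounded by C^2 times a product of one-dimensional weights (1 + x^2)^(-l/2), each
  integrable because l > 1. No polar coordinates are involved.\<close>

lemma sobolev_inf_fourier_L2:
  assumes "f \<in> sobolev_inf l" "l > 1"
  shows "integrable lborel (\<lambda>\<xi>. (cmod (fourier f \<xi>))\<^sup>2)"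
proof -
  have f: "integrable lborel f"
    and es: "esssup lborel (\<lambda>\<xi>. ereal ((1 + (norm \<xi>)\<^sup>2) powr (l / 2) * cmod (fourier f \<xi>))) < \<infinity>"
    using assms(1) by (auto simp: sobolev_inf_def)
  obtain C where C: "esssup lborel (\<lambda>\<xi>. ereal ((1 + (norm \<xi>)\<^sup>2) powr (l / 2) * cmod (fourier f \<xi>))) \<le> ereal C"
    using ereal_dense2[OF es] less_imp_le by blast
  let ?J = "\<lambda>x::real. (1 + x\<^sup>2) powr (- l / 2)"
  have J: "integrable lborel (\<lambda>\<xi>::real^2. C\<^sup>2 * (?J (\<xi> $ 1) * ?J (\<xi> $ 2)))"
    using integrable_japanese_bracket[OF assms(2)] by (intro integrable_mult_right product_integral_real2)
  show ?thesis
  proof (rule Bochner_Integration.integrable_bound[OF J])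
    show "(\<lambda>\<xi>. (cmod (fourier f \<xi>))\<^sup>2) \<in> borel_measurable lborel"
      using fourier_measurable[OF f] by measurable
    have "AE \<xi> in lborel. ereal ((1 + (norm \<xi>)\<^sup>2) powr (l / 2) * cmod (fourier f \<xi>)) \<le> ereal C"
      using esssup_AE[of "\<lambda>\<xi>. ereal ((1 + (norm \<xi>)\<^sup>2) powr (l / 2) * cmod (fourier f \<xi>))" lborel]
      by eventually_elim (erule order_trans[OF _ C])
    then show "AE \<xi> in lborel. norm ((cmod (fourier f \<xi>))\<^sup>2) \<le> norm (C\<^sup>2 * (?J (\<xi> $ 1) * ?J (\<xi> $ 2)))"
    proof eventually_elim
      case (elim \<xi>)
      let ?A = "1 + (norm \<xi>)\<^sup>2" and ?a = "(1 + (\<xi> $ 1)\<^sup>2) * (1 + (\<xi> $ 2)\<^sup>2)"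
      have A: "?A \<ge> 1" by simp
      have ap: "?a > 0" by (intro mult_pos_pos) (auto simp: add_pos_nonneg)
      have aA: "?a \<le> ?A\<^sup>2"
        unfolding power2_eq_square[of ?A] by (intro mult_mono) (auto simp: norm_real2)
      have "(?A powr (l / 2) * cmod (fourier f \<xi>))\<^sup>2 \<le> C\<^sup>2"
        using elim by (intro power_mono) auto
      then have 1: "(?A powr (l / 2))\<^sup>2 * (cmod (fourier f \<xi>))\<^sup>2 \<le> C\<^sup>2"
        by (simp add: power_mult_distrib)
      have 2: "(?A powr (l / 2))\<^sup>2 = (?A\<^sup>2) powr (l / 2)"
        by (simp add: power2_eq_square powr_mult)
      have "?a powr (l / 2) * (cmod (fourier f \<xi>))\<^sup>2 \<le> (?A powr (l / 2))\<^sup>2 * (cmod (fourier f \<xi>))\<^sup>2"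
        unfolding 2 using ap aA assms(2) by (intro mult_right_mono powr_mono2) auto
      with 1 have "?a powr (l / 2) * (cmod (fourier f \<xi>))\<^sup>2 \<le> C\<^sup>2" by simp
      then have "(cmod (fourier f \<xi>))\<^sup>2 \<le> C\<^sup>2 * ?a powr (- l / 2)"
        using ap by (simp add: powr_minus field_simps)
      also have "?a powr (- l / 2) = ?J (\<xi> $ 1) * ?J (\<xi> $ 2)" by (rule powr_mult)
      finally show ?case by simp
    qed
  qed
qed

lemma smoothing_kernel_square_integrable:
  assumes "smoothing_kernel \<phi>" "l > 1" "(\<lambda>x. complex_of_real (\<phi> x)) \<in> sobolev_inf l"
  shows "integrable lborel (\<lambda>x. (\<phi> x)\<^sup>2)"
proof -
  obtain r where "\<And>x. \<phi> x \<noteq> 0 \<Longrightarrow> norm x \<le> r"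
    using assms(1) unfolding smoothing_kernel_def bounded_iff by auto
  then show ?thesis
    using assms(1) sobolev_inf_fourier_L2[OF assms(3,2)]
    by (intro square_integrable_if_fourier[of \<phi> r]) (auto simp: smoothing_kernel_def)
qed

subsection \<open>Translation estimates\<close>

text \<open>Serves sets in the plane displaced by vectors as well as sets on a line displaced by
  numbers, hence the two type parameters. One \<eta> is both the radius of a window and the bound on
  the displacement, so the minimum over a finite subcover is admissible for every window.\<close>

lemma compact_cover_measure:
  fixes A :: "'d::real_normed_vector \<Rightarrow> 'a::euclidean_space set"
  assumes "compact K" and meas: "\<And>d. A d \<in> sets borel"
    and local: "\<And>p. p \<in> K \<Longrightarrow> \<exists>\<eta>>0. \<exists>C\<ge>0. \<forall>d. norm d < \<eta> \<longrightarrow> measure lborel (A d \<inter> ball p \<eta>) \<le> C * norm d"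
  shows "\<exists>\<eta>>0. \<exists>C\<ge>0. \<forall>d. norm d < \<eta> \<longrightarrow> measure lborel (A d \<inter> K) \<le> C * norm d"
proof -
  obtain \<eta> C where loc: "\<And>p. p \<in> K \<Longrightarrow> \<eta> p > 0 \<and> C p \<ge> 0 \<and>
      (\<forall>d. norm d < \<eta> p \<longrightarrow> measure lborel (A d \<inter> ball p (\<eta> p)) \<le> C p * norm d)"
    using local by metis
  obtain D where D: "D \<subseteq> K" "finite D" "K \<subseteq> (\<Union>p\<in>D. ball p (\<eta> p))"
    by (rule compactE_image[OF \<open>compact K\<close>, of K "\<lambda>p. ball p (\<eta> p)"]) (use loc in auto)
  define \<eta>' where "\<eta>' = Min (insert 1 (\<eta> ` D))"
  have \<eta>': "\<eta>' > 0" "\<And>p. p \<in> D \<Longrightarrow> \<eta>' \<le> \<eta> p"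
    using D loc by (auto simp: \<eta>'_def subset_iff)
  have "0 \<le> sum C D" using D loc by (intro sum_nonneg) auto
  moreover have "\<forall>d. norm d < \<eta>' \<longrightarrow> measure lborel (A d \<inter> K) \<le> sum C D * norm d"
  proof (intro allI impI)
    fix d :: 'd assume d: "norm d < \<eta>'"
    have fm: "A d \<inter> ball p (\<eta> p) \<in> fmeasurable lborel" for p
    proof (rule fmeasurableI2[of "ball p (\<eta> p)"])
      show "ball p (\<eta> p) \<in> fmeasurable lborel" by (intro fmeasurableI) (auto intro: emeasure_bounded_finite simp flip: infinity_ennreal_def)
    qed (use meas in auto)
    have "measure lborel (A d \<inter> K) \<le> measure lborel (\<Union>p\<in>D. A d \<inter> ball p (\<eta> p))"
    proof (rule measure_mono_fmeasurable)
      show "A d \<inter> K \<subseteq> (\<Union>p\<in>D. A d \<inter> ball p (\<eta> p))" using D by auto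
      show "A d \<inter> K \<in> sets lborel" using meas compact_imp_closed[OF \<open>compact K\<close>] by auto
      show "(\<Union>p\<in>D. A d \<inter> ball p (\<eta> p)) \<in> fmeasurable lborel"
        using D(2) fm by (intro fmeasurable.finite_UN) auto
    qed
    also have "\<dots> \<le> (\<Sum>p\<in>D. measure lborel (A d \<inter> ball p (\<eta> p)))"
      by (rule measure_UNION_le[OF D(2)]) (use meas in auto)
    also have "\<dots> \<le> (\<Sum>p\<in>D. C p * norm d)"
    proof (rule sum_mono)
      fix p assume p: "p \<in> D"
      then have "norm d < \<eta> p" using d \<eta>'(2)[OF p] by simp
      then show "measure lborel (A d \<inter> ball p (\<eta> p)) \<le> C p * norm d" using loc[of p] p D(1) by blast
    qed
    also have "\<dots> = sum C D * norm d" by (simp add: sum_distrib_right)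
    finally show "measure lborel (A d \<inter> K) \<le> sum C D * norm d" .
  qed
  ultimately show ?thesis using \<eta>'(1) by blast
qed

text \<open>An interval of half length \<open>L\<close> around any point of \<open>B\<close> covers
  it; the factor 2 is harmless in the applications.\<close>

lemma emeasure_real_diameter:
  fixes B :: "real set"
  assumes "B \<in> sets borel" "\<And>x y. x \<in> B \<Longrightarrow> y \<in> B \<Longrightarrow> \<bar>x - y\<bar> \<le> L"
  shows "emeasure lborel B \<le> ennreal (2 * L)"
proof (cases "B = {}")
  case False
  then obtain b where b: "b \<in> B" by blast
  have "B \<subseteq> {b - L..b + L}" using assms(2)[OF b] by force
  then have "emeasure lborel B \<le> emeasure lborel {b - L..b + L}" by (intro emeasure_mono) auto
  also have "\<dots> = ennreal (2 * L)" using assms(2)[OF b b] by simp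
  finally show ?thesis .
qed simp

text \<open>Fubini in the order of coordinates chosen by \<open>i\<close> and \<open>j\<close>:
  short sections over a bounded strip. Both orders occur, as a boundary may be a graph over either
  axis.\<close>

lemma emeasure_sections:
  fixes A :: "(real^2) set"
  assumes A: "A \<in> sets borel" and ij: "i = 1 \<and> j = 2 \<or> i = 2 \<and> j = (1::2)" and L: "L \<ge> 0" "R \<ge> 0"
    and strip: "\<And>x. x \<in> A \<Longrightarrow> \<bar>x $ i - c\<bar> \<le> R"
    and diam: "\<And>x y. x \<in> A \<Longrightarrow> y \<in> A \<Longrightarrow> x $ i = y $ i \<Longrightarrow> \<bar>x $ j - y $ j\<bar> \<le> L"
  shows "emeasure lborel A \<le> ennreal (2 * R * (2 * L))"
proof -
  let ?P = "lborel \<Otimes>\<^sub>M lborel :: (real \<times> real) measure"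
  define B where "B = vec2 -` A"
  have "vec2 -` A \<inter> space ?P \<in> sets ?P" using vec2_measurable A by (rule measurable_sets)
  then have B: "B \<in> sets ?P" by (simp add: B_def space_pair_measure)
  have eB: "emeasure lborel A = emeasure ?P B"
    unfolding lborel_real2 using A by (subst emeasure_distr) (auto simp: B_def space_pair_measure)
  have bound: "(\<integral>\<^sup>+ x. ennreal (2 * L) * indicator {c - R..c + R} x \<partial>lborel) = ennreal (2 * R * (2 * L))"
    using L by (simp add: nn_integral_cmult ennreal_mult[symmetric] mult_ac)
  from ij show ?thesis
  proof
    assume [simp]: "i = 1 \<and> j = 2"
    have "emeasure ?P B = (\<integral>\<^sup>+ x. emeasure lborel (Pair x -` B) \<partial>lborel)"
      by (rule lborel.emeasure_pair_measure_alt[OF B])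
    also have "\<dots> \<le> (\<integral>\<^sup>+ x. ennreal (2 * L) * indicator {c - R..c + R} x \<partial>lborel)"
    proof (rule nn_integral_mono)
      fix x
      have "emeasure lborel (Pair x -` B) \<le> ennreal (2 * L)"
      proof (rule emeasure_real_diameter)
        show "\<bar>y - z\<bar> \<le> L" if "y \<in> Pair x -` B" "z \<in> Pair x -` B" for y z
          using diam[of "vec2 (x, y)" "vec2 (x, z)"] that by (simp add: B_def)
      qed (use sets_Pair1[OF B, of x] in simp)
      moreover have "x \<in> {c - R..c + R} \<or> Pair x -` B = {}" using strip by (force simp: B_def)
      ultimately show "emeasure lborel (Pair x -` B) \<le> ennreal (2 * L) * indicator {c - R..c + R} x"
        by (auto simp: indicator_def)
    qed
    finally show ?thesis using eB bound by simp
  next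
    assume [simp]: "i = 2 \<and> j = 1"
    have "emeasure ?P B = (\<integral>\<^sup>+ y. emeasure lborel ((\<lambda>x. (x, y)) -` B) \<partial>lborel)"
      by (rule lborel_pair.emeasure_pair_measure_alt2[OF B])
    also have "\<dots> \<le> (\<integral>\<^sup>+ x. ennreal (2 * L) * indicator {c - R..c + R} x \<partial>lborel)"
    proof (rule nn_integral_mono)
      fix y
      have "emeasure lborel ((\<lambda>x. (x, y)) -` B) \<le> ennreal (2 * L)"
      proof (rule emeasure_real_diameter)
        show "\<bar>x - z\<bar> \<le> L" if "x \<in> (\<lambda>x. (x, y)) -` B" "z \<in> (\<lambda>x. (x, y)) -` B" for x z
          using diam[of "vec2 (x, y)" "vec2 (z, y)"] that by (simp add: B_def)
      qed (use sets_Pair2[OF B, of y] in simp)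
      moreover have "y \<in> {c - R..c + R} \<or> (\<lambda>x. (x, y)) -` B = {}" using strip by (force simp: B_def)
      ultimately show "emeasure lborel ((\<lambda>x. (x, y)) -` B) \<le> ennreal (2 * L) * indicator {c - R..c + R} y"
        by (auto simp: indicator_def)
    qed
    finally show ?thesis using eB bound by simp
  qed
qed

lemma frechet_real2_bound:
  fixes D :: "real^2 \<Rightarrow> real"
  assumes "bounded_linear D"
  shows "\<bar>D v\<bar> \<le> (\<bar>D (axis 1 1)\<bar> + \<bar>D (axis 2 1)\<bar>) * norm v"
proof -
  interpret bounded_linear D by fact
  have "v = v $ 1 *\<^sub>R axis 1 1 + v $ 2 *\<^sub>R axis 2 1"
    by (simp add: vec_eq_iff forall_2 axis_def)
  then have "D v = v $ 1 * D (axis 1 1) + v $ 2 * D (axis 2 1)"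
    by (metis add scaleR real_scaleR_def)
  then have "\<bar>D v\<bar> \<le> \<bar>v $ 1\<bar> * \<bar>D (axis 1 1)\<bar> + \<bar>v $ 2\<bar> * \<bar>D (axis 2 1)\<bar>"
    by (metis abs_mult abs_triangle_ineq)
  also have "\<dots> \<le> norm v * \<bar>D (axis 1 1)\<bar> + norm v * \<bar>D (axis 2 1)\<bar>"
    using component_le_norm_cart[of v] by (intro add_mono mult_right_mono) auto
  finally show ?thesis by (simp add: algebra_simps)
qed

lemma smooth_on_lipschitz:
  fixes f :: "real^2 \<Rightarrow> real"
  assumes "open U" "smooth_on U f" "cball p r \<subseteq> U"
  obtains L where "L \<ge> 0" "\<And>x y. x \<in> cball p r \<Longrightarrow> y \<in> cball p r \<Longrightarrow> \<bar>f x - f y\<bar> \<le> L * norm (x - y)"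
proof -
  define g where "g x = \<bar>slope f (axis 1 1) x\<bar> + \<bar>slope f (axis 2 1) x\<bar>" for x
  have "continuous_on (cball p r) g"
    unfolding g_def using smooth_on_continuous_on[OF smooth_on_frechet[OF assms(2)]] assms(3)
    by (intro continuous_intros continuous_on_subset[OF _ assms(3)])
  then have "compact (g ` cball p r)" by (intro compact_continuous_image) auto
  then obtain B where B: "\<And>x. x \<in> cball p r \<Longrightarrow> norm (g x) \<le> B"
    using compact_imp_bounded bounded_iff by (metis imageI)
  show thesis
  proof (rule that[of "max B 0"])
    fix x y assume xy: "x \<in> cball p r" "y \<in> cball p r"
    have "norm (f x - f y) \<le> max B 0 * norm (x - y)"
    proof (rule differentiable_bound[where S = "cball p r" and f' = "\<lambda>x. frechet_derivative f (at x)"])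
      fix z assume z: "z \<in> cball p r"
      have d: "(f has_derivative frechet_derivative f (at z)) (at z)"
        using smooth_on_has_derivative[OF assms(2)] assms(3) z by auto
      then show "(f has_derivative frechet_derivative f (at z)) (at z within cball p r)"
        by (rule has_derivative_at_withinI)
      show "onorm (frechet_derivative f (at z)) \<le> max B 0"
      proof (rule onorm_le)
        fix v
        have "\<bar>slope f v z\<bar> \<le> g z * norm v"
          unfolding g_def by (rule frechet_real2_bound[OF has_derivative_bounded_linear[OF d]])
        also have "\<dots> \<le> max B 0 * norm v" using B[OF z] by (intro mult_right_mono) auto
        finally show "norm (slope f v z) \<le> max B 0 * norm v" by simp
      qed
    qed (use xy in auto)
    then show "\<bar>f x - f y\<bar> \<le> max B 0 * norm (x - y)" by simp
  qed simp
qed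

lemma emeasure_lborel_bounded_imp_measure_le:
  "emeasure lborel A \<le> ennreal c \<Longrightarrow> 0 \<le> c \<Longrightarrow> measure lborel A \<le> c"
  by (simp add: measure_def enn2real_leI)

text \<open>Between \<open>x\<close> and \<open>x + d\<close> the function \<rho> crosses the level
  0, so |\<rho> x| <= M |d|. Along a coordinate axis with nonzero partial derivative \<rho> changes
  at least at rate m, so each section of the set has diameter at most 2 M |d| / m.\<close>

lemma tube_local:
  assumes ld: "local_defining \<Omega> U \<rho>" and p: "p \<in> U" and cl: "closed \<Omega>"
  shows "\<exists>\<eta>>0. \<exists>C\<ge>0. \<forall>d. norm d < \<eta> \<longrightarrow>
    measure lborel ({x. (x + d \<in> \<Omega>) \<noteq> (x \<in> \<Omega>)} \<inter> ball p \<eta>) \<le> C * norm d"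
proof -
  have U: "open U" "smooth_on U \<rho>" and mem: "\<And>x. x \<in> U \<Longrightarrow> x \<in> \<Omega> \<longleftrightarrow> \<rho> x \<le> 0"
    and grad: "\<exists>v. slope \<rho> v p \<noteq> 0"
    using ld p by (auto simp: local_defining_def)
  note der = smooth_on_has_derivative[OF U(2)]
  obtain v where "slope \<rho> v p \<noteq> 0" using grad by blast
  then have "\<bar>slope \<rho> (axis 1 1) p\<bar> + \<bar>slope \<rho> (axis 2 1) p\<bar> \<noteq> 0"
    using frechet_real2_bound[OF has_derivative_bounded_linear[OF der[OF p]], of v]
    by (metis abs_le_zero_iff mult_zero_left)
  then have "\<exists>(i::2) (j::2). (i = 1 \<and> j = 2 \<or> i = 2 \<and> j = 1) \<and> slope \<rho> (axis j 1) p \<noteq> 0"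
    by (cases "slope \<rho> (axis 1 1) p = 0") auto
  then obtain i :: 2 and j :: 2 where ij: "i = 1 \<and> j = 2 \<or> i = 2 \<and> j = (1::2)" and nz: "slope \<rho> (axis j 1) p \<noteq> 0" by blast
  define m where "m = \<bar>slope \<rho> (axis j 1) p\<bar> / 2"
  have m: "m > 0" using nz by (simp add: m_def)
  define W where "W = U \<inter> {x. \<bar>slope \<rho> (axis j 1) x\<bar> > m}"
  have "continuous_on U (\<lambda>x. \<bar>slope \<rho> (axis j 1) x\<bar>)"
    by (intro continuous_intros smooth_on_continuous_on smooth_on_frechet U)
  from continuous_open_preimage[OF this U(1), of "{m<..}"]
  have "open W" by (simp add: W_def vimage_def Int_def)
  moreover have "p \<in> W" using p m by (simp add: W_def m_def)
  ultimately obtain r where r: "r > 0" "cball p r \<subseteq> W" by (meson open_contains_cball)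
  then have rU: "cball p r \<subseteq> U" by (auto simp: W_def)
  obtain M where M: "M \<ge> 0" "\<And>x y. x \<in> cball p r \<Longrightarrow> y \<in> cball p r \<Longrightarrow> \<bar>\<rho> x - \<rho> y\<bar> \<le> M * norm (x - y)"
    using smooth_on_lipschitz[OF U rU] by blast
  define C where "C = 2 * r * (2 * (2 * M / m))"
  \<comment> \<open>A quarter of the radius: for \<open>x\<close>, \<open>y\<close> in the small
    ball and \<open>norm d < r / 4\<close>, the point \<open>x + d\<close> and all points
    \<open>y + t *\<^sub>R axis j 1\<close> used below stay in \<open>cball p r\<close>.\<close>
  have "r / 4 > 0" "C \<ge> 0" using r M m by (auto simp: C_def)
  moreover have "\<forall>d. norm d < r / 4 \<longrightarrow>
      measure lborel ({x. (x + d \<in> \<Omega>) \<noteq> (x \<in> \<Omega>)} \<inter> ball p (r / 4)) \<le> C * norm d"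
  proof (intro allI impI)
    fix d :: "real^2" assume d: "norm d < r / 4"
    let ?A = "{x. (x + d \<in> \<Omega>) \<noteq> (x \<in> \<Omega>)} \<inter> ball p (r / 4)"
    have mb: "{x. x + d \<in> \<Omega>} \<in> sets borel"
      using cl by (intro borel_closed closed_vimage[of \<Omega> "\<lambda>x. x + d", unfolded vimage_def]) (auto intro: continuous_intros)
    have "?A = ({x. x + d \<in> \<Omega>} - \<Omega> \<union> (\<Omega> - {x. x + d \<in> \<Omega>})) \<inter> ball p (r / 4)" by auto
    then have Am: "?A \<in> sets borel" using mb cl by auto
    have small: "\<bar>\<rho> x\<bar> \<le> M * norm d" if "x \<in> ?A" for x
    proof -
      have xb: "x \<in> cball p r" "x + d \<in> cball p r"
        using that d r norm_triangle_ineq[of "x - p" d] by (auto simp: dist_norm norm_minus_commute algebra_simps)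
      then have "(\<rho> (x + d) \<le> 0) \<noteq> (\<rho> x \<le> 0)" using that mem rU by auto
      then have "\<bar>\<rho> x\<bar> \<le> \<bar>\<rho> (x + d) - \<rho> x\<bar>" by linarith
      also have "\<dots> \<le> M * norm d" using M(2)[OF xb(2,1)] by simp
      finally show ?thesis .
    qed
    have diam: "\<bar>x $ j - y $ j\<bar> \<le> 2 * M / m * norm d" if x: "x \<in> ?A" and y: "y \<in> ?A" and eq: "x $ i = y $ i" for x y
    proof -
      have "x - y = (x $ j - y $ j) *\<^sub>R axis j 1"
        using ij eq by (auto simp: vec_eq_iff forall_2 axis_def)
      then have xy: "x = y + (x $ j - y $ j) *\<^sub>R axis j 1" by (metis add_diff_cancel_left' diff_add_cancel add.commute)
      let ?c = "\<lambda>t. y + t *\<^sub>R axis j 1"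
      have cb: "?c t \<in> cball p r" if "\<bar>t\<bar> \<le> \<bar>x $ j - y $ j\<bar>" for t
      proof -
        have "\<bar>x $ j - y $ j\<bar> \<le> norm (x - y)" using component_le_norm_cart[of "x - y" j] by simp
        moreover have "norm (y - p) < r / 4" "norm (x - p) < r / 4" using x y by (auto simp: dist_norm norm_minus_commute)
        moreover have "norm (x - y) \<le> norm (x - p) + norm (y - p)"
          using norm_triangle_ineq4[of "x - p" "y - p"] by simp
        moreover have "norm (?c t - p) \<le> norm (y - p) + \<bar>t\<bar>"
          using norm_triangle_ineq[of "y - p" "t *\<^sub>R axis j 1"] by (simp add: algebra_simps)
        ultimately have "norm (?c t - p) \<le> r" using that r(1) by linarith
        then show ?thesis by (simp add: dist_norm norm_minus_commute)
      qed
      have "\<exists>z. \<bar>z - 0\<bar> \<le> \<bar>x $ j - y $ j - 0\<bar> \<and> \<rho> (?c (x $ j - y $ j)) - \<rho> (?c 0) = (x $ j - y $ j - 0) * slope \<rho> (axis j 1) (?c z)"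
      proof (rule mean_value_abs)
        fix z assume "\<bar>z - 0\<bar> \<le> \<bar>x $ j - y $ j - 0\<bar>"
        then have zU: "?c z \<in> U" using cb[of z] rU by auto
        interpret bounded_linear "frechet_derivative \<rho> (at (?c z))"
          using der[OF zU] by (rule has_derivative_bounded_linear)
        have "(?c has_derivative (\<lambda>h. h *\<^sub>R axis j 1)) (at z)" by (auto intro!: derivative_eq_intros)
        from has_derivative_compose[OF this der[OF zU]]
        show "((\<lambda>t. \<rho> (?c t)) has_real_derivative slope \<rho> (axis j 1) (?c z)) (at z)"
          by (simp add: scaleR has_field_derivative_def mult_commute_abs)
      qed
      then obtain z where z: "\<bar>z\<bar> \<le> \<bar>x $ j - y $ j\<bar>" "\<rho> x - \<rho> y = (x $ j - y $ j) * slope \<rho> (axis j 1) (?c z)"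
        using xy by auto
      have "m \<le> \<bar>slope \<rho> (axis j 1) (?c z)\<bar>" using cb[OF z(1)] r(2) by (auto simp: W_def)
      then have "\<bar>x $ j - y $ j\<bar> * m \<le> \<bar>\<rho> x - \<rho> y\<bar>"
        unfolding z(2) abs_mult by (intro mult_left_mono) auto
      also have "\<dots> \<le> 2 * (M * norm d)" using small[OF x] small[OF y] by linarith
      finally show ?thesis using m by (simp add: field_simps)
    qed
    have "emeasure lborel ?A \<le> ennreal (2 * r * (2 * (2 * M / m * norm d)))"
    proof (rule emeasure_sections[OF Am ij, where c = "p $ i"])
      fix x assume "x \<in> ?A"
      then have "norm (x - p) < r / 4" by (simp add: dist_norm norm_minus_commute)
      then show "\<bar>x $ i - p $ i\<bar> \<le> r"
        using component_le_norm_cart[of "x - p" i] r by simp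
    qed (use diam M m r in auto)
    then show "measure lborel ?A \<le> C * norm d"
      using M m r by (intro emeasure_lborel_bounded_imp_measure_le) (auto simp: C_def mult_ac)
  qed
  ultimately show ?thesis by blast
qed


lemma smooth_boundaryE:
  assumes "smooth_boundary \<Omega>" "p \<in> frontier \<Omega>"
  obtains U \<rho> where "local_defining \<Omega> U \<rho>" "p \<in> U"
proof -
  have "\<exists>U \<rho>. local_defining \<Omega> U \<rho> \<and> p \<in> U"
    using bspec[OF assms(1)[unfolded smooth_boundary_def] assms(2)] unfolding local_defining_def by blast
  then show thesis using that by blast
qed

lemma not_frontier_locally_constant:
  fixes p :: "'a::metric_space"
  assumes "p \<notin> frontier S"
  obtains r where "r > 0" "\<And>x y. x \<in> ball p r \<Longrightarrow> y \<in> ball p r \<Longrightarrow> x \<in> S \<longleftrightarrow> y \<in> S"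
proof -
  have "p \<in> interior S \<or> p \<in> - closure S" using assms by (auto simp: frontier_def)
  moreover have "open (interior S)" "open (- closure S)" by auto
  ultimately obtain r where "r > 0" "ball p r \<subseteq> interior S \<or> ball p r \<subseteq> - closure S"
    by (meson openE)
  then have "ball p r \<subseteq> S \<or> ball p r \<inter> S = {}"
    using interior_subset[of S] closure_subset[of S] by blast
  then show thesis using \<open>r > 0\<close> by (intro that[of r]) auto
qed

lemma translate_diff_borel:
  fixes \<Omega> :: "'a::euclidean_space set"
  assumes "closed \<Omega>"
  shows "{x. (x + d \<in> \<Omega>) \<noteq> (x \<in> \<Omega>)} \<in> sets borel"
proof -
  have "{x. x + d \<in> \<Omega>} \<in> sets borel"
    using assms by (intro borel_closed closed_vimage[of \<Omega> "\<lambda>x. x + d", unfolded vimage_def]) (auto intro: continuous_intros)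
  moreover have "{x. (x + d \<in> \<Omega>) \<noteq> (x \<in> \<Omega>)} = {x. x + d \<in> \<Omega>} - \<Omega> \<union> (\<Omega> - {x. x + d \<in> \<Omega>})" by auto
  ultimately show ?thesis using assms by auto
qed

lemma tube:
  assumes cl: "closed \<Omega>" and sub: "\<Omega> \<subseteq> ball 0 1" and sb: "smooth_boundary \<Omega>"
  shows "\<exists>\<eta>>0. \<exists>C\<ge>0. \<forall>d. norm d < \<eta> \<longrightarrow> measure lborel {x. (x + d \<in> \<Omega>) \<noteq> (x \<in> \<Omega>)} \<le> C * norm d"
proof -
  define A where "A d = {x. (x + d \<in> \<Omega>) \<noteq> (x \<in> \<Omega>)}" for d
  have "\<exists>\<eta>>0. \<exists>C\<ge>0. \<forall>d. norm d < \<eta> \<longrightarrow> measure lborel (A d \<inter> cball 0 2) \<le> C * norm d"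
  proof (rule compact_cover_measure)
    show "A d \<in> sets borel" for d unfolding A_def by (rule translate_diff_borel[OF cl])
    fix p :: "real^2"
    show "\<exists>\<eta>>0. \<exists>C\<ge>0. \<forall>d. norm d < \<eta> \<longrightarrow> measure lborel (A d \<inter> ball p \<eta>) \<le> C * norm d"
    proof (cases "p \<in> frontier \<Omega>")
      case True
      then obtain U \<rho> where "local_defining \<Omega> U \<rho>" "p \<in> U" using smooth_boundaryE[OF sb] by blast
      then show ?thesis unfolding A_def using tube_local cl by blast
    next
      case False
      then obtain r where r: "r > 0" "\<And>x y. x \<in> ball p r \<Longrightarrow> y \<in> ball p r \<Longrightarrow> x \<in> \<Omega> \<longleftrightarrow> y \<in> \<Omega>"
        by (rule not_frontier_locally_constant) blast
      have "A d \<inter> ball p (r / 2) = {}" if "norm d < r / 2" for d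
      proof -
        have "x + d \<in> \<Omega> \<longleftrightarrow> x \<in> \<Omega>" if "x \<in> ball p (r / 2)" for x
        proof (rule r(2))
          show "x + d \<in> ball p r"
            using that \<open>norm d < r / 2\<close> norm_triangle_ineq[of "x - p" d]
            by (simp add: dist_norm norm_minus_commute algebra_simps)
        qed (use that r(1) in auto)
        then show ?thesis by (auto simp: A_def)
      qed
      then have "\<forall>d. norm d < r / 2 \<longrightarrow> measure lborel (A d \<inter> ball p (r / 2)) \<le> 0 * norm d" by simp
      moreover have "r / 2 > 0" "(0::real) \<le> 0" using r by auto
      ultimately show ?thesis by blast
    qed
  qed simp
  then obtain \<eta> C where \<eta>: "\<eta> > 0" "C \<ge> 0" "\<And>d. norm d < \<eta> \<Longrightarrow> measure lborel (A d \<inter> cball 0 2) \<le> C * norm d"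
    by blast
  \<comment> \<open>A displacement shorter than 1 moves no point from outside
    \<open>cball 0 2\<close> into the unit disc, so the compact window loses nothing.\<close>
  have "A d \<inter> cball 0 2 = A d" if "norm d < 1" for d
  proof -
    have "x \<in> cball 0 2" if "x \<in> A d" for x
    proof (rule ccontr)
      assume "x \<notin> cball 0 2"
      then have "norm x > 2" by simp
      moreover have "norm x \<le> norm (x + d) + norm d" using norm_triangle_ineq4[of "x + d" d] by simp
      ultimately have "norm (x + d) > 1" "norm x > 1" using \<open>norm d < 1\<close> by auto
      then have "x + d \<notin> \<Omega>" "x \<notin> \<Omega>" using sub by (auto simp: subset_iff)
      then show False using that by (simp add: A_def)
    qed
    then show ?thesis by auto
  qed
  then have "\<forall>d. norm d < min \<eta> 1 \<longrightarrow> measure lborel (A d) \<le> C * norm d"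
    using \<eta>(3) by (metis min_less_iff_conj)
  moreover have "min \<eta> 1 > 0" using \<eta> by simp
  ultimately show ?thesis using \<eta>(2) unfolding A_def by blast
qed

lemma admissibleD:
  assumes "admissible \<Omega> u"
  shows "compact \<Omega>" "closed \<Omega>" "\<Omega> \<subseteq> ball 0 1" "smooth_boundary \<Omega>" "smooth_on UNIV u" "u x > 0" "finite (Upsilon \<Omega>)"
  using assms by (auto simp: admissible_def compact_smooth_domain_def compact_imp_closed)

lemma cutoff_bounds:
  assumes "admissible \<Omega> u"
  obtains M where "M > 0" "\<And>x. 0 \<le> cutoff u \<Omega> x" "\<And>x. cutoff u \<Omega> x \<le> M"
    "cutoff u \<Omega> \<in> borel_measurable borel" "\<And>x. norm x \<ge> 1 \<Longrightarrow> cutoff u \<Omega> x = 0"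
proof -
  note adm = admissibleD[OF assms]
  have uc: "continuous_on UNIV u" using adm(5) by (rule smooth_on_continuous_on)
  then have "compact (u ` cball 0 1)"
    by (intro compact_continuous_image) (auto intro: continuous_on_subset)
  then obtain B where B: "\<And>x. x \<in> cball 0 1 \<Longrightarrow> norm (u x) \<le> B"
    using compact_imp_bounded bounded_iff by (metis imageI)
  show thesis
  proof (rule that[of "max B 1"])
    show "0 \<le> cutoff u \<Omega> x" for x using adm(6)[of x] by (simp add: cutoff_def less_imp_le)
    show "cutoff u \<Omega> x \<le> max B 1" for x
    proof (cases "x \<in> \<Omega>")
      case True
      then have "x \<in> cball 0 1" using adm(3) by (auto simp: subset_iff less_imp_le)
      then show ?thesis using B[of x] True by (auto simp: cutoff_def)
    qed (simp add: cutoff_def)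
    have "u \<in> borel_measurable borel" using uc by (rule borel_measurable_continuous_onI)
    then show "cutoff u \<Omega> \<in> borel_measurable borel"
      unfolding cutoff_def
      by (intro borel_measurable_times borel_measurable_indicator borel_closed adm(2))
    show "cutoff u \<Omega> x = 0" if "norm x \<ge> 1" for x
      using adm(3) that by (auto simp: cutoff_def indicator_def subset_iff)
  qed simp
qed

text \<open>On the tube where membership changes, the difference is at most M and the tube has
  measure O(|d|); elsewhere the Lipschitz bound of \<open>u\<close> applies. As the difference is
  also bounded, its L2 norm is O(sqrt |d|).\<close>

lemma cutoff_translate_L1:
  assumes "admissible \<Omega> u"
  shows "\<exists>\<eta>>0. \<exists>C\<ge>0. \<forall>d. norm d < \<eta> \<longrightarrow>
    integrable lborel (\<lambda>x. \<bar>cutoff u \<Omega> (x + d) - cutoff u \<Omega> x\<bar>) \<and>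
    (LINT x|lborel. \<bar>cutoff u \<Omega> (x + d) - cutoff u \<Omega> x\<bar>) \<le> C * norm d"
proof -
  note adm = admissibleD[OF assms]
  let ?f = "cutoff u \<Omega>"
  obtain M where M: "M > 0" "\<And>x. 0 \<le> ?f x" "\<And>x. ?f x \<le> M" and fm [measurable]: "?f \<in> borel_measurable borel"
    using cutoff_bounds[OF assms] by metis
  obtain \<eta> C where C: "\<eta> > 0" "C \<ge> 0" "\<And>d. norm d < \<eta> \<Longrightarrow> measure lborel {x. (x + d \<in> \<Omega>) \<noteq> (x \<in> \<Omega>)} \<le> C * norm d"
    using tube[OF adm(2-4)] by blast
  obtain L where L: "L \<ge> 0" "\<And>x y. x \<in> cball 0 2 \<Longrightarrow> y \<in> cball 0 2 \<Longrightarrow> \<bar>u x - u y\<bar> \<le> L * norm (x - y)"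
    using smooth_on_lipschitz[OF open_UNIV adm(5), of 0 2] by auto
  define V where "V = measure lborel (cball (0::real^2) 2)"
  have "\<forall>d. norm d < min \<eta> 1 \<longrightarrow> integrable lborel (\<lambda>x. \<bar>?f (x + d) - ?f x\<bar>) \<and>
    (LINT x|lborel. \<bar>?f (x + d) - ?f x\<bar>) \<le> (L * V + M * C) * norm d"
  proof (intro allI impI)
    fix d :: "real^2" assume d: "norm d < min \<eta> 1"
    define A where "A = {x. (x + d \<in> \<Omega>) \<noteq> (x \<in> \<Omega>)}"
    define B where "B x = L * norm d * indicator (cball 0 2) x + M * indicator A x" for x
    have inb: "x \<in> cball 0 2" if "x \<in> \<Omega> \<or> x + d \<in> \<Omega>" for x
    proof -
      have "norm x \<le> norm (x + d) + norm d" using norm_triangle_ineq4[of "x + d" d] by simp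
      then show ?thesis using that adm(3) d by (auto simp: subset_iff)
    qed
    have le: "\<bar>?f (x + d) - ?f x\<bar> \<le> B x" for x
    proof (cases "x \<in> A")
      case True
      have "\<bar>?f (x + d) - ?f x\<bar> \<le> M" using M(2,3)[of x] M(2,3)[of "x + d"] by linarith
      then show ?thesis using True L(1) M(1) by (auto simp: B_def indicator_def intro: add_increasing)
    next
      case False
      show ?thesis
      proof (cases "x \<in> \<Omega>")
        case True
        then have "x + d \<in> \<Omega>" using False by (simp add: A_def)
        then have "\<bar>u (x + d) - u x\<bar> \<le> L * norm d"
          using L(2)[of "x + d" x] inb True adm(3) by (force simp: subset_iff)
        then show ?thesis using inb[of x] True \<open>x + d \<in> \<Omega>\<close> False by (auto simp: cutoff_def B_def)
      next
        case F: False
        then have "x + d \<notin> \<Omega>" using False by (simp add: A_def)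
        then show ?thesis using F L(1) M(1) by (auto simp: cutoff_def B_def)
      qed
    qed
    have Am: "A \<in> sets borel" unfolding A_def by (rule translate_diff_borel[OF adm(2)])
    have "A \<subseteq> cball 0 2" using inb by (auto simp: A_def)
    then have "emeasure lborel A \<le> emeasure lborel (cball (0::real^2) 2)" by (intro emeasure_mono) auto
    also have fin: "emeasure lborel (cball (0::real^2) 2) < \<infinity>" by (intro emeasure_bounded_finite) auto
    finally have finA: "emeasure lborel A < \<infinity>" .
    have Bi: "integrable lborel B" unfolding B_def
      using fin finA Am by (intro Bochner_Integration.integrable_add integrable_mult_right integrable_real_indicator) auto
    have BI: "(LINT x|lborel. B x) = L * norm d * V + M * measure lborel A"
      unfolding B_def using fin finA Am
      by (subst Bochner_Integration.integral_add) (auto intro!: integrable_mult_right integrable_real_indicator simp: V_def)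
    have i: "integrable lborel (\<lambda>x. \<bar>?f (x + d) - ?f x\<bar>)"
    proof (rule Bochner_Integration.integrable_bound[OF Bi])
      show "(\<lambda>x. \<bar>?f (x + d) - ?f x\<bar>) \<in> borel_measurable lborel" by measurable
      have "norm \<bar>?f (x + d) - ?f x\<bar> \<le> norm (B x)" for x using le[of x] by auto
      then show "AE x in lborel. norm \<bar>?f (x + d) - ?f x\<bar> \<le> norm (B x)" by auto
    qed
    have "(LINT x|lborel. \<bar>?f (x + d) - ?f x\<bar>) \<le> (LINT x|lborel. B x)"
      by (rule integral_mono[OF i Bi]) (rule le)
    also have "\<dots> \<le> L * norm d * V + M * (C * norm d)"
      unfolding BI A_def using C(3)[of d] d M(1) by (intro add_left_mono mult_left_mono) auto
    finally show "integrable lborel (\<lambda>x. \<bar>?f (x + d) - ?f x\<bar>) \<and>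
        (LINT x|lborel. \<bar>?f (x + d) - ?f x\<bar>) \<le> (L * V + M * C) * norm d"
      using i by (simp add: algebra_simps)
  qed
  moreover have "min \<eta> 1 > 0" "L * V + M * C \<ge> 0" using C L M by (auto simp: V_def)
  ultimately show ?thesis by blast
qed

section \<open>Modulus of continuity of the smoothed transform\<close>

lemma weighted_AM_GM:
  fixes c x y :: real
  assumes "c > 0"
  shows "x * y \<le> c / 2 * x\<^sup>2 + y\<^sup>2 / (2 * c)"
proof -
  have "2 * c * (x * y) \<le> (c * x)\<^sup>2 + y\<^sup>2"
    using sum_squares_bound[of "c * x" y] by (simp add: mult_ac)
  also have "\<dots> = 2 * c * (c / 2 * x\<^sup>2 + y\<^sup>2 / (2 * c))"
    using assms by (simp add: distrib_left power_mult_distrib) (simp add: power2_eq_square)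
  finally show ?thesis using assms by simp
qed

lemma smoothing_kernelD:
  assumes "smoothing_kernel \<phi>"
  shows "\<phi> x \<ge> 0" "integrable lborel \<phi>" "\<phi> \<in> borel_measurable borel" "(LINT x|lborel. \<phi> x) = 1"
  using assms by (auto simp: smoothing_kernel_def dest: borel_measurable_integrable)

lemma square_tail_small:
  fixes \<phi> :: "'a::euclidean_space \<Rightarrow> real"
  assumes L2: "integrable lborel (\<lambda>x. (\<phi> x)\<^sup>2)" and m [measurable]: "\<phi> \<in> borel_measurable borel" and "\<kappa> > 0"
  obtains N :: nat where "integrable lborel (\<lambda>x. (max 0 (\<phi> x - real N))\<^sup>2)"
    "(LINT x|lborel. (max 0 (\<phi> x - real N))\<^sup>2) < \<kappa>"
proof -
  have le: "(max 0 (\<phi> x - real N))\<^sup>2 \<le> (\<phi> x)\<^sup>2" for x N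
    by (cases "\<phi> x \<le> real N") (auto simp: max_def intro: power_mono)
  have int: "integrable lborel (\<lambda>x. (max 0 (\<phi> x - real N))\<^sup>2)" for N
    by (rule Bochner_Integration.integrable_bound[OF L2]) (use le in \<open>auto intro!: AE_I2\<close>)
  have "(\<lambda>N. LINT x|lborel. (max 0 (\<phi> x - real N))\<^sup>2) \<longlonglongrightarrow> (LINT x|(lborel :: 'a measure). (0 :: real))"
  proof (rule integral_dominated_convergence[OF _ _ L2])
    show "AE x in lborel. (\<lambda>N. (max 0 (\<phi> x - real N))\<^sup>2) \<longlonglongrightarrow> 0"
    proof (rule AE_I2)
      fix x
      obtain m where "\<phi> x \<le> real m" using real_arch_simple by blast
      then have "\<forall>\<^sub>F N in sequentially. (max 0 (\<phi> x - real N))\<^sup>2 = 0"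
        by (intro eventually_sequentiallyI[of m]) auto
      then show "(\<lambda>N. (max 0 (\<phi> x - real N))\<^sup>2) \<longlonglongrightarrow> 0" by (rule tendsto_eventually)
    qed
  qed (use le in auto)
  then have "\<forall>\<^sub>F N in sequentially. (LINT x|lborel. (max 0 (\<phi> x - real N))\<^sup>2) < \<kappa>"
    using order_tendstoD(2)[of _ 0 sequentially \<kappa>] \<open>\<kappa> > 0\<close> by simp
  then show thesis using that int by (auto simp: eventually_sequentially)
qed

lemma convolution_eq:
  assumes "smoothing_kernel \<phi>" and [measurable]: "f \<in> borel_measurable borel"
  shows "convolution \<phi> f x = (LINT z|lborel. \<phi> z * f (x - z))"
proof -
  note [measurable] = smoothing_kernelD(3)[OF assms(1)]
  have "(\<lambda>y. \<phi> (x - y) * f y) \<in> borel_measurable borel" by measurable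
  from lborel_affine_integral(2)[OF this, of "-1" x]
  show ?thesis by (simp add: convolution_def)
qed

lemma kernel_times_bounded_integrable:
  assumes "smoothing_kernel \<phi>" and [measurable]: "f \<in> borel_measurable borel" and "\<And>x. \<bar>f x\<bar> \<le> (M::real)"
  shows "integrable lborel (\<lambda>z. \<phi> z * f z)"
proof (rule Bochner_Integration.integrable_bound[of lborel "\<lambda>z. M * \<phi> z"])
  note [measurable] = smoothing_kernelD(3)[OF assms(1)]
  show "integrable lborel (\<lambda>z. M * \<phi> z)" using smoothing_kernelD(2)[OF assms(1)] by simp
  show "(\<lambda>z. \<phi> z * f z) \<in> borel_measurable lborel" by measurable
  have "norm (\<phi> z * f z) \<le> norm (M * \<phi> z)" for z
    using smoothing_kernelD(1)[OF assms(1), of z] order_trans[OF assms(3) abs_ge_self, of z]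
    by (auto simp: abs_mult mult.commute[of M] mult.commute[of "\<bar>M\<bar>"] intro!: mult_left_mono)
  then show "AE z in lborel. norm (\<phi> z * f z) \<le> norm (M * \<phi> z)" by auto
qed

text \<open>The kernel is at most N + P, where P is its excess over N. The bounded part contributes
  N C |d|, which is of smaller order. For P, the weighted inequality with weight s \<mu>, where s =
  sqrt |d|, stands for Cauchy-Schwarz and yields s times the sum of \<mu>/2 times the integral of
  P^2 and M C / (2 \<mu>). First \<mu> is fixed, large, and then N, so that the tail of the kernel
  is small.\<close>

lemma cutoff_convolution_modulus:
  assumes K: "smoothing_kernel \<phi>" and L2: "integrable lborel (\<lambda>x. (\<phi> x)\<^sup>2)" and adm: "admissible \<Omega> u" and "\<epsilon> > 0"
  shows "\<exists>\<delta>>0. \<forall>x y. norm (x - y) < \<delta> \<longrightarrow>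
    \<bar>convolution \<phi> (cutoff u \<Omega>) x - convolution \<phi> (cutoff u \<Omega>) y\<bar> \<le> \<epsilon> * sqrt (norm (x - y))"
proof -
  let ?f = "cutoff u \<Omega>"
  note \<phi> = smoothing_kernelD[OF K]
  note [measurable] = \<phi>(3)
  obtain M where M: "M > 0" "\<And>x. 0 \<le> ?f x" "\<And>x. ?f x \<le> M" and [measurable]: "?f \<in> borel_measurable borel"
    using cutoff_bounds[OF adm] by metis
  obtain \<eta> C where C: "\<eta> > 0" "C \<ge> 0" "\<And>d. norm d < \<eta> \<Longrightarrow> integrable lborel (\<lambda>x. \<bar>?f (x + d) - ?f x\<bar>)"
    "\<And>d. norm d < \<eta> \<Longrightarrow> (LINT x|lborel. \<bar>?f (x + d) - ?f x\<bar>) \<le> C * norm d"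
    using cutoff_translate_L1[OF adm] by blast
  \<comment> \<open>Large enough that M C / (2 \<mu>) is at most \<epsilon>/3; the summand 1 keeps
    \<mu> positive when C = 0.\<close>
  define \<mu> where "\<mu> = (M * C + 1) * 3 / (2 * \<epsilon>)"
  have \<mu>: "\<mu> > 0" using M C \<open>\<epsilon> > 0\<close> by (auto simp: \<mu>_def intro!: divide_pos_pos add_nonneg_pos)
  have \<mu>2: "M * C / (2 * \<mu>) \<le> \<epsilon> / 3"
  proof -
    have "M * C * 3 \<le> 2 * \<mu> * \<epsilon>" using \<open>\<epsilon> > 0\<close> by (simp add: \<mu>_def)
    then show ?thesis using \<mu> by (simp add: field_simps)
  qed
  have "2 * \<epsilon> / (3 * \<mu>) > 0" using \<mu> \<open>\<epsilon> > 0\<close> by simp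
  then obtain N where N: "integrable lborel (\<lambda>x. (max 0 (\<phi> x - real N))\<^sup>2)"
    "(LINT x|lborel. (max 0 (\<phi> x - real N))\<^sup>2) < 2 * \<epsilon> / (3 * \<mu>)"
    using square_tail_small[OF L2 \<phi>(3)] by metis
  define P where "P x = max 0 (\<phi> x - real N)" for x
  have P: "integrable lborel (\<lambda>x. (P x)\<^sup>2)" "\<mu> / 2 * (LINT x|lborel. (P x)\<^sup>2) \<le> \<epsilon> / 3"
    using N \<mu> by (auto simp: P_def field_simps)
  \<comment> \<open>For |d| < q^2 the contribution N C s^2 of the bounded part is at most
    (\<epsilon>/3) s.\<close>
  define q where "q = \<epsilon> / (3 * (real N * C + 1))"
  have D: "real N * C + 1 > 0" using C(2) by (intro add_nonneg_pos) auto
  have q: "q > 0" "real N * C * q \<le> \<epsilon> / 3"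
  proof -
    show "q > 0" using D \<open>\<epsilon> > 0\<close> by (simp add: q_def)
    have "(real N * C + 1) * q = \<epsilon> / 3" using D by (simp add: q_def field_simps)
    then show "real N * C * q \<le> \<epsilon> / 3" using \<open>q > 0\<close> by (simp add: distrib_right)
  qed
  define \<delta> where "\<delta> = min \<eta> (q\<^sup>2)"
  show ?thesis
  proof (intro exI[of _ \<delta>] conjI allI impI)
    show "\<delta> > 0" using C q by (simp add: \<delta>_def)
    fix x y :: "real^2" assume xy: "norm (x - y) < \<delta>"
    define d where "d = x - y"
    show "\<bar>convolution \<phi> ?f x - convolution \<phi> ?f y\<bar> \<le> \<epsilon> * sqrt (norm (x - y))"
    proof (cases "d = 0")
      case False
      define s where "s = sqrt (norm d)"
      have s: "s > 0" "s\<^sup>2 = norm d" "s < q"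
        using False xy q(1) by (auto simp: s_def d_def \<delta>_def real_less_lsqrt)
      have d\<eta>: "norm d < \<eta>" using xy by (simp add: \<delta>_def d_def)
      define \<psi> where "\<psi> w = \<bar>?f (w + d) - ?f w\<bar>" for w
      have [measurable]: "\<psi> \<in> borel_measurable borel" unfolding \<psi>_def by measurable
      have \<psi>: "0 \<le> \<psi> w" "\<psi> w \<le> M" for w
        using M(2,3)[of w] M(2,3)[of "w + d"] unfolding \<psi>_def by linarith+
      have \<psi>i: "integrable lborel (\<lambda>z. \<psi> (y - z))" "(LINT z|lborel. \<psi> (y - z)) \<le> C * s\<^sup>2"
      proof -
        have "integrable lborel \<psi>" "(LINT z|lborel. \<psi> z) \<le> C * s\<^sup>2"
          using C(3,4)[OF d\<eta>] s(2) by (simp_all add: \<psi>_def[abs_def])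
        then show "integrable lborel (\<lambda>z. \<psi> (y - z))" "(LINT z|lborel. \<psi> (y - z)) \<le> C * s\<^sup>2"
          using lborel_affine_integral[of \<psi> "-1" y] by simp_all
      qed
      have fb: "\<bar>?f z\<bar> \<le> M" for z using M(2,3)[of z] by simp
      have i: "integrable lborel (\<lambda>z. \<phi> z * ?f (x - z))" "integrable lborel (\<lambda>z. \<phi> z * ?f (y - z))"
        by (rule kernel_times_bounded_integrable[OF K _ fb], measurable)+
      define B where "B z = real N * \<psi> (y - z) + s * \<mu> / 2 * (P z)\<^sup>2 + M / (2 * s * \<mu>) * \<psi> (y - z)" for z
      have Bi: "integrable lborel B"
        unfolding B_def by (intro Bochner_Integration.integrable_add integrable_mult_right \<psi>i P)
      have le: "\<bar>\<phi> z * ?f (x - z) - \<phi> z * ?f (y - z)\<bar> \<le> B z" for z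
      proof -
        let ?p = "\<psi> (y - z)"
        have "\<bar>\<phi> z * ?f (x - z) - \<phi> z * ?f (y - z)\<bar> = \<phi> z * ?p"
        proof -
          have "y - z + d = x - z" by (simp add: d_def)
          then have "?p = \<bar>?f (x - z) - ?f (y - z)\<bar>" by (simp only: \<psi>_def)
          then show ?thesis using \<phi>(1)[of z] by (simp add: abs_mult flip: right_diff_distrib)
        qed
        also have "\<dots> \<le> (real N + P z) * ?p"
          using \<psi>(1) by (intro mult_right_mono) (auto simp: P_def)
        also have "P z * ?p \<le> s * \<mu> / 2 * (P z)\<^sup>2 + ?p\<^sup>2 / (2 * s * \<mu>)"
          using weighted_AM_GM[of "s * \<mu>" "P z" ?p] s \<mu> by (simp add: mult.assoc)
        then have "(real N + P z) * ?p \<le> real N * ?p + s * \<mu> / 2 * (P z)\<^sup>2 + ?p\<^sup>2 / (2 * s * \<mu>)"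
          by (simp add: algebra_simps)
        also have "?p\<^sup>2 / (2 * s * \<mu>) \<le> M / (2 * s * \<mu>) * ?p"
        proof -
          have "?p\<^sup>2 \<le> M * ?p" using \<psi>[of "y - z"] by (simp add: power2_eq_square mult_right_mono)
          then show ?thesis using s \<mu> by (simp add: divide_right_mono)
        qed
        finally show ?thesis by (simp add: B_def)
      qed
      have "\<bar>convolution \<phi> ?f x - convolution \<phi> ?f y\<bar> = \<bar>LINT z|lborel. \<phi> z * ?f (x - z) - \<phi> z * ?f (y - z)\<bar>"
        using i by (simp add: convolution_eq[OF K])
      also have "\<dots> \<le> (LINT z|lborel. B z)"
        using Bochner_Integration.integral_norm_bound_integral[of lborel "\<lambda>z. \<phi> z * ?f (x - z) - \<phi> z * ?f (y - z)" B] i Bi le by simp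
      also have "\<dots> = real N * (LINT z|lborel. \<psi> (y - z)) + s * \<mu> / 2 * (LINT z|lborel. (P z)\<^sup>2)
          + M / (2 * s * \<mu>) * (LINT z|lborel. \<psi> (y - z))"
        unfolding B_def using \<psi>i P by simp
      also have "\<dots> \<le> real N * (C * s\<^sup>2) + s * (\<epsilon> / 3) + M / (2 * s * \<mu>) * (C * s\<^sup>2)"
      proof (intro add_mono mult_left_mono \<psi>i)
        show "s * \<mu> / 2 * (LINT z|lborel. (P z)\<^sup>2) \<le> s * (\<epsilon> / 3)"
          using mult_left_mono[OF P(2), of s] s by (simp add: mult.assoc)
      qed (use s \<mu> M in auto)
      also have "\<dots> = s * (real N * C * s + \<epsilon> / 3 + M * C / (2 * \<mu>))"
        using s(1) \<mu> by (simp add: field_simps power2_eq_square)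
      also have "\<dots> \<le> s * (\<epsilon> / 3 + \<epsilon> / 3 + \<epsilon> / 3)"
      proof -
        have "real N * C * s \<le> real N * C * q" using s C(2) by (intro mult_left_mono) auto
        then show ?thesis using s \<mu>2 q(2) by (intro mult_left_mono) auto
      qed
      finally show ?thesis by (simp add: s_def d_def mult.commute)
    qed (simp add: d_def)
  qed
qed

lemma ray_measurable:
  fixes f :: "real^2 \<Rightarrow> real"
  assumes "f \<in> borel_measurable borel"
  shows "(\<lambda>p. f (x - fst p + snd p *\<^sub>R v)) \<in> borel_measurable (lborel \<Otimes>\<^sub>M (lborel :: real measure))"
proof -
  have "(\<lambda>p::(real^2)\<times>real. x - fst p + snd p *\<^sub>R v) \<in> borel_measurable (lborel \<Otimes>\<^sub>M lborel)"
    by (simp add: lborel_prod) (intro borel_measurable_continuous_onI continuous_intros)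
  then show ?thesis by (rule measurable_compose[OF _ assms])
qed

text \<open>Beyond t = r + 3 the ray has left the unit disc, because |x - z| <= 2 + r where the
  kernel is nonzero. The half line thus becomes a bounded interval, on which Fubini exchanges
  averaging by the kernel with integration along the ray.\<close>

lemma convolution_ray:
  assumes K: "smoothing_kernel \<phi>" and r: "\<And>z. \<phi> z \<noteq> 0 \<Longrightarrow> norm z \<le> r" and x: "norm x \<le> 2" and v: "norm v = 1"
    and f [measurable]: "f \<in> borel_measurable borel" and M: "\<And>x. 0 \<le> f x" "\<And>x. f x \<le> M"
    and supp: "\<And>x. norm x \<ge> 1 \<Longrightarrow> f x = 0" and T: "T = r + 3"
  shows "(\<lambda>y. LINT t:{0..}|lborel. f (y + t *\<^sub>R v)) \<in> borel_measurable borel"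
    and "integrable lborel (\<lambda>z. \<phi> z * (LINT t:{0..}|lborel. f (x - z + t *\<^sub>R v)))"
    and "(LINT z|lborel. \<phi> z * (LINT t:{0..}|lborel. f (x - z + t *\<^sub>R v))) =
      (LINT t|lborel. indicator {0..T} t * convolution \<phi> f (x + t *\<^sub>R v))"
proof -
  note \<phi> = smoothing_kernelD[OF K]
  note [measurable] = \<phi>(3)
  have "(\<lambda>p::(real^2) \<times> real. fst p + snd p *\<^sub>R v) \<in> borel_measurable (lborel \<Otimes>\<^sub>M lborel)"
    by (simp add: lborel_prod) (intro borel_measurable_continuous_onI continuous_intros)
  from measurable_compose[OF this f]
  have "(\<lambda>p::(real^2) \<times> real. indicator {0..} (snd p) *\<^sub>R f (fst p + snd p *\<^sub>R v)) \<in> borel_measurable (lborel \<Otimes>\<^sub>M lborel)"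
    by measurable
  then have "(\<lambda>y. LINT t|lborel. indicator {0..} t *\<^sub>R f (y + t *\<^sub>R v)) \<in> borel_measurable lborel"
    by (intro lborel.borel_measurable_lebesgue_integral) (simp add: case_prod_beta')
  then show "(\<lambda>y. LINT t:{0..}|lborel. f (y + t *\<^sub>R v)) \<in> borel_measurable borel"
    by (simp add: set_lebesgue_integral_def)
  define g where "g z t = \<phi> z * (indicator {0..T} t * f (x - z + t *\<^sub>R v))" for z and t :: real
  have gm: "(\<lambda>p. g (fst p) (snd p)) \<in> borel_measurable (lborel \<Otimes>\<^sub>M lborel)"
    unfolding g_def using ray_measurable[OF f, of x v] by measurable
  have trunc: "\<phi> z * (indicator {0..} t *\<^sub>R f (x - z + t *\<^sub>R v)) = g z t" for z t
  proof (cases "\<phi> z = 0 \<or> t \<le> T")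
    case False
    then have "norm z \<le> r" "t > r + 3" using r[of z] T by auto
    moreover have "t = norm (t *\<^sub>R v)" using \<open>t > r + 3\<close> \<open>norm z \<le> r\<close> v norm_ge_zero[of z] by (simp del: norm_ge_zero)
    moreover have "norm (t *\<^sub>R v) \<le> norm (x - z + t *\<^sub>R v) + norm (x - z)"
      using norm_triangle_ineq4[of "x - z + t *\<^sub>R v" "x - z"] by simp
    moreover have "norm (x - z) \<le> 2 + r" using norm_triangle_ineq4[of x z] x \<open>norm z \<le> r\<close> by simp
    ultimately have "norm (x - z + t *\<^sub>R v) \<ge> 1" by linarith
    then show ?thesis by (simp add: g_def supp)
  qed (auto simp: g_def indicator_def)
  have eq: "\<phi> z * (LINT t:{0..}|lborel. f (x - z + t *\<^sub>R v)) = (LINT t|lborel. g z t)" for z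
    unfolding set_lebesgue_integral_def integral_mult_right_zero[symmetric] trunc ..
  have "emeasure lborel {0..T} < \<infinity>" by (rule emeasure_bounded_finite) simp
  then have J: "integrable lborel (\<lambda>t. M * indicator {0..T} t :: real)"
    by (intro integrable_mult_right integrable_real_indicator) simp_all
  have gi: "integrable (lborel \<Otimes>\<^sub>M lborel) (\<lambda>p. g (fst p) (snd p))"
  proof (rule Bochner_Integration.integrable_bound)
    show "integrable (lborel \<Otimes>\<^sub>M lborel) (\<lambda>p. \<phi> (fst p) * (M * indicator {0..T} (snd p)))"
    proof (rule lborel_pair.Fubini_integrable)
      show "integrable lborel (\<lambda>x. LINT y|lborel. norm (\<phi> (fst (x, y)) * (M * indicator {0..T} (snd (x, y)))))"
        using \<phi>(1,2) by (simp add: abs_mult)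
    qed (use J in auto)
    have "norm (g (fst p) (snd p)) \<le> norm (\<phi> (fst p) * (M * indicator {0..T} (snd p)))" for p
      using M[of "x - fst p + snd p *\<^sub>R v"] \<phi>(1)[of "fst p"]
      by (auto simp: g_def abs_mult indicator_def intro!: mult_left_mono)
    then show "AE p in (lborel \<Otimes>\<^sub>M lborel). norm (g (fst p) (snd p)) \<le> norm (\<phi> (fst p) * (M * indicator {0..T} (snd p)))"
      by auto
  qed (rule gm)
  then have gi': "integrable (lborel \<Otimes>\<^sub>M lborel) (\<lambda>(z, t). g z t)" by (simp add: case_prod_beta')
  show "integrable lborel (\<lambda>z. \<phi> z * (LINT t:{0..}|lborel. f (x - z + t *\<^sub>R v)))"
    unfolding eq using lborel_pair.integrable_fst'[OF gi] by simp
  have "(LINT z|lborel. LINT t|lborel. g z t) = (LINT t|lborel. LINT z|lborel. g z t)"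
    using lborel_pair.Fubini_integral[OF gi'] by simp
  moreover have "(LINT z|lborel. g z t) = indicator {0..T} t * convolution \<phi> f (x + t *\<^sub>R v)" for t
    unfolding convolution_eq[OF K f] g_def by (simp add: algebra_simps flip: integral_mult_right_zero)
  ultimately show "(LINT z|lborel. \<phi> z * (LINT t:{0..}|lborel. f (x - z + t *\<^sub>R v))) =
      (LINT t|lborel. indicator {0..T} t * convolution \<phi> f (x + t *\<^sub>R v))"
    unfolding eq by simp
qed

text \<open>Smoothing commutes with integration along rays: the transform of a discontinuous
  \<open>f\<close> is an integral of the convolution over segments of fixed length, and the modulus
  of the convolution passes to it.\<close>

lemma V_smooth_ray:
  assumes K: "smoothing_kernel \<phi>" and r: "\<And>z. \<phi> z \<noteq> 0 \<Longrightarrow> norm z \<le> r" and x: "norm x \<le> 2"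
    and f: "f \<in> borel_measurable borel" and M: "\<And>x. 0 \<le> f x" "\<And>x. f x \<le> M"
    and supp: "\<And>x. norm x \<ge> 1 \<Longrightarrow> f x = 0"
  shows "V_smooth a b \<psi> \<phi> f x \<alpha> =
    a * (LINT t|lborel. indicator {0..r + 3} t * convolution \<phi> f (x + t *\<^sub>R dir (\<alpha> + 2 * \<psi> - pi / 2))) +
    b * (LINT t|lborel. indicator {0..r + 3} t * convolution \<phi> f (x + t *\<^sub>R dir (\<alpha> - pi / 2)))"
proof -
  note ray = convolution_ray[OF K r x norm_dir f M supp refl]
  have m: "(\<lambda>y. V_line a b \<psi> f y \<alpha>) \<in> borel_measurable borel"
    unfolding V_line_def by (intro borel_measurable_add borel_measurable_times borel_measurable_const ray(1))
  show ?thesis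
    unfolding V_smooth_def convolution_eq[OF K m] unfolding V_line_def
    using ray(2) by (simp add: distrib_left mult.left_commute[of "\<phi> _"] ray(3))
qed

lemma V_smooth_modulus:
  assumes K: "smoothing_kernel \<phi>" and L2: "integrable lborel (\<lambda>x. (\<phi> x)\<^sup>2)" and adm: "admissible \<Omega> u"
    and ab: "a > 0" "b > 0"
  shows "V_smooth a b \<psi> \<phi> (cutoff u \<Omega>) x \<alpha> \<ge> 0"
    and "\<epsilon> > 0 \<Longrightarrow> \<exists>\<delta>>0. \<forall>x\<in>cball 0 2. \<forall>y\<in>cball 0 2. norm (x - y) < \<delta> \<longrightarrow>
      \<bar>V_smooth a b \<psi> \<phi> (cutoff u \<Omega>) x \<alpha> - V_smooth a b \<psi> \<phi> (cutoff u \<Omega>) y \<alpha>\<bar> \<le> \<epsilon> * sqrt (norm (x - y))"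
proof -
  let ?f = "cutoff u \<Omega>"
  obtain M where M: "M > 0" "\<And>x. 0 \<le> ?f x" "\<And>x. ?f x \<le> M" and f: "?f \<in> borel_measurable borel"
    and supp: "\<And>x. norm x \<ge> 1 \<Longrightarrow> ?f x = 0"
    using cutoff_bounds[OF adm] by metis
  show "V_smooth a b \<psi> \<phi> ?f x \<alpha> \<ge> 0"
    unfolding V_smooth_def convolution_def V_line_def set_lebesgue_integral_def
    using ab M(2) smoothing_kernelD(1)[OF K]
    by (intro integral_nonneg_AE AE_I2 mult_nonneg_nonneg add_nonneg_nonneg) auto
  obtain r' where "\<And>z. \<phi> z \<noteq> 0 \<Longrightarrow> norm z \<le> r'"
    using K unfolding smoothing_kernel_def bounded_iff by auto
  then obtain r where r: "r \<ge> 0" "\<And>z. \<phi> z \<noteq> 0 \<Longrightarrow> norm z \<le> r" by (metis max.coboundedI1 max.coboundedI2 order_refl)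
  define F where "F = convolution \<phi> ?f"
  assume "\<epsilon> > 0"
  \<comment> \<open>The segments have length \<open>r + 3\<close> and weights \<open>a\<close> and
    \<open>b\<close>, so this constant for the convolution adds up to \<epsilon>.\<close>
  define \<kappa> where "\<kappa> = \<epsilon> / ((a + b) * (r + 3))"
  have \<kappa>: "\<kappa> > 0" using \<open>\<epsilon> > 0\<close> ab r by (auto simp: \<kappa>_def intro!: divide_pos_pos mult_pos_pos)
  obtain \<delta> where \<delta>: "\<delta> > 0" "\<And>x y. norm (x - y) < \<delta> \<Longrightarrow> \<bar>F x - F y\<bar> \<le> \<kappa> * sqrt (norm (x - y))"
    using cutoff_convolution_modulus[OF K L2 adm \<kappa>] unfolding F_def by blast
  have Fm: "F \<in> borel_measurable borel"
  proof -
    note [measurable] = f smoothing_kernelD(3)[OF K]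
    have "(\<lambda>p. \<phi> (snd p) * ?f (fst p - snd p)) \<in> borel_measurable (lborel \<Otimes>\<^sub>M lborel)" by measurable
    then have "(\<lambda>x. LINT z|lborel. \<phi> z * ?f (x - z)) \<in> borel_measurable lborel"
      by (intro lborel.borel_measurable_lebesgue_integral) (simp add: case_prod_beta')
    then show ?thesis unfolding F_def convolution_eq[OF K f, abs_def] by simp
  qed
  have Fb: "\<bar>F x\<bar> \<le> M" for x
  proof -
    have fb: "\<bar>?f z\<bar> \<le> M" for z using M(2,3)[of z] by simp
    have i: "integrable lborel (\<lambda>z. \<phi> z * ?f (x - z))"
      by (rule kernel_times_bounded_integrable[OF K _ fb]) (use f in measurable)
    have "norm (F x) \<le> (LINT z|lborel. M * \<phi> z)"
      unfolding F_def convolution_eq[OF K f]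
      by (rule Bochner_Integration.integral_norm_bound_integral[OF i])
         (use smoothing_kernelD[OF K] fb in \<open>auto simp: abs_mult mult.commute[of M] intro!: mult_left_mono\<close>)
    then show ?thesis using smoothing_kernelD(4)[OF K] by simp
  qed
  have Fi: "integrable lborel (\<lambda>t. indicator {0..r + 3} t * F (x + t *\<^sub>R v))" for x v
  proof (rule Bochner_Integration.integrable_bound)
    show "integrable lborel (\<lambda>t. M * indicator {0..r + 3} t :: real)"
      using r(1) by (intro integrable_mult_right integrable_real_indicator) auto
    have "(\<lambda>t::real. x + t *\<^sub>R v) \<in> borel_measurable borel"
      by (intro borel_measurable_continuous_onI continuous_intros)
    from measurable_compose[OF this Fm]
    show "(\<lambda>t. indicator {0..r + 3} t * F (x + t *\<^sub>R v)) \<in> borel_measurable lborel" by measurable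
    have "norm (indicator {0..r + 3} t * F (x + t *\<^sub>R v)) \<le> norm (M * indicator {0..r + 3} t)" for t
      using Fb[of "x + t *\<^sub>R v"] M(1) by (auto simp: indicator_def)
    then show "AE t in lborel. norm (indicator {0..r + 3} t * F (x + t *\<^sub>R v)) \<le> norm (M * indicator {0..r + 3} t)" by auto
  qed
  have diff: "\<bar>(LINT t|lborel. indicator {0..r + 3} t * F (x + t *\<^sub>R v)) - (LINT t|lborel. indicator {0..r + 3} t * F (y + t *\<^sub>R v))\<bar>
      \<le> \<kappa> * (r + 3) * sqrt (norm (x - y))" if "norm (x - y) < \<delta>" for x y v
  proof -
    have "norm (LINT t|lborel. indicator {0..r + 3} t * F (x + t *\<^sub>R v) - indicator {0..r + 3} t * F (y + t *\<^sub>R v))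
        \<le> (LINT t|lborel. \<kappa> * sqrt (norm (x - y)) * indicator {0..r + 3} t)"
    proof (rule Bochner_Integration.integral_norm_bound_integral)
      show "integrable lborel (\<lambda>t. \<kappa> * sqrt (norm (x - y)) * indicator {0..r + 3} t)"
        using r(1) by (intro integrable_mult_right integrable_real_indicator) auto
      show "norm (indicator {0..r + 3} t * F (x + t *\<^sub>R v) - indicator {0..r + 3} t * F (y + t *\<^sub>R v))
          \<le> \<kappa> * sqrt (norm (x - y)) * indicator {0..r + 3} t" for t
        using \<delta>(2)[of "x + t *\<^sub>R v" "y + t *\<^sub>R v"] that by (auto simp: indicator_def)
    qed (intro Bochner_Integration.integrable_diff Fi)
    then show ?thesis using Fi r(1) by (simp add: mult_ac)
  qed
  show "\<exists>\<delta>>0. \<forall>x\<in>cball 0 2. \<forall>y\<in>cball 0 2. norm (x - y) < \<delta> \<longrightarrow>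
      \<bar>V_smooth a b \<psi> \<phi> ?f x \<alpha> - V_smooth a b \<psi> \<phi> ?f y \<alpha>\<bar> \<le> \<epsilon> * sqrt (norm (x - y))"
  proof (intro exI[of _ \<delta>] conjI ballI impI \<delta>(1))
    fix x y :: "real^2" assume x: "x \<in> cball 0 2" and y: "y \<in> cball 0 2" and xy: "norm (x - y) < \<delta>"
    let ?I = "\<lambda>x v. LINT t|lborel. indicator {0..r + 3} t * F (x + t *\<^sub>R v)"
    let ?v = "dir (\<alpha> + 2 * \<psi> - pi / 2)" and ?v' = "dir (\<alpha> - pi / 2)"
    have V: "V_smooth a b \<psi> \<phi> ?f z \<alpha> = a * ?I z ?v + b * ?I z ?v'" if "z \<in> cball 0 2" for z
      unfolding F_def using that by (intro V_smooth_ray[OF K r(2) _ f M(2,3) supp]) auto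
    have "\<bar>V_smooth a b \<psi> \<phi> ?f x \<alpha> - V_smooth a b \<psi> \<phi> ?f y \<alpha>\<bar> =
        \<bar>a * (?I x ?v - ?I y ?v) + b * (?I x ?v' - ?I y ?v')\<bar>"
      unfolding V[OF x] V[OF y] by (simp add: algebra_simps)
    also have "\<dots> \<le> a * \<bar>?I x ?v - ?I y ?v\<bar> + b * \<bar>?I x ?v' - ?I y ?v'\<bar>"
      using ab by (intro order_trans[OF abs_triangle_ineq]) (simp add: abs_mult)
    also have "\<dots> \<le> a * (\<kappa> * (r + 3) * sqrt (norm (x - y))) + b * (\<kappa> * (r + 3) * sqrt (norm (x - y)))"
      using ab by (intro add_mono mult_left_mono diff[OF xy]) auto
    also have "\<dots> = \<kappa> * ((a + b) * (r + 3)) * sqrt (norm (x - y))" by (simp add: algebra_simps)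
    also have "\<kappa> * ((a + b) * (r + 3)) = \<epsilon>" using ab r(1) by (simp add: \<kappa>_def)
    finally show "\<bar>V_smooth a b \<psi> \<phi> ?f x \<alpha> - V_smooth a b \<psi> \<phi> ?f y \<alpha>\<bar> \<le> \<epsilon> * sqrt (norm (x - y))" .
  qed
qed

subsection \<open>Detection of tangent lines\<close>

text \<open>Tangency through the differential of \<rho>, as opposed to the curves of
  \<open>tangent_points\<close>. The universal quantifier makes it independent of a choice of
  \<rho>, and a single defining function with nonzero slope refutes it, which is how transversality
  is used.\<close>

definition tangent_dir :: "(real^2) set \<Rightarrow> real^2 \<Rightarrow> real^2 \<Rightarrow> bool" where
  "tangent_dir \<Omega> p v \<longleftrightarrow> p \<in> frontier \<Omega> \<and>
     (\<forall>U \<rho>. local_defining \<Omega> U \<rho> \<and> p \<in> U \<longrightarrow> slope \<rho> v p = 0)"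

lemma local_definingD:
  assumes "local_defining \<Omega> U \<rho>"
  shows "open U" "smooth_on U \<rho>" "\<And>x. x \<in> U \<Longrightarrow> x \<in> \<Omega> \<longleftrightarrow> \<rho> x \<le> 0"
    "\<And>x. x \<in> U \<Longrightarrow> (\<rho> has_derivative frechet_derivative \<rho> (at x)) (at x)"
  using assms smooth_on_has_derivative by (auto simp: local_defining_def)

lemma slope_dir_nonzero:
  assumes "local_defining \<Omega> U \<rho>" "x \<in> U" "slope \<rho> (dir (\<theta> + pi / 2)) x = 0"
  shows "slope \<rho> (dir \<theta>) x \<noteq> 0"
proof
  assume 0: "slope \<rho> (dir \<theta>) x = 0"
  interpret bounded_linear "frechet_derivative \<rho> (at x)"
    using local_definingD(4)[OF assms(1,2)] by (rule has_derivative_bounded_linear)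
  obtain v where v: "slope \<rho> v x \<noteq> 0" using assms unfolding local_defining_def by blast
  have "slope \<rho> (pt \<theta> s t) x = 0" for s t using 0 assms(3) by (simp add: pt_def add scaleR)
  then show False using v pt_cases[of v \<theta>] by metis
qed

lemma line_change_borel:
  assumes "closed \<Omega>"
  shows "{t. (pt \<theta> s t \<in> \<Omega>) \<noteq> (pt \<theta> s' t \<in> \<Omega>)} \<in> sets borel"
proof -
  have m: "{t. pt \<theta> s t \<in> \<Omega>} \<in> sets borel" for s
    using assms by (intro borel_closed closed_vimage[of \<Omega> "pt \<theta> s", unfolded vimage_def]) (auto intro: continuous_intros)
  have "{t. (pt \<theta> s t \<in> \<Omega>) \<noteq> (pt \<theta> s' t \<in> \<Omega>)} =
    {t. pt \<theta> s t \<in> \<Omega>} - {t. pt \<theta> s' t \<in> \<Omega>} \<union> ({t. pt \<theta> s' t \<in> \<Omega>} - {t. pt \<theta> s t \<in> \<Omega>})" by auto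
  then show ?thesis using m by auto
qed

text \<open>The one-dimensional counterpart of \<open>tube_local\<close>: on a transversal line
  \<rho> itself has nonzero derivative, so the parameters at which membership can change lie within
  O(|h|) of each other.\<close>

lemma transversal_window:
  assumes ld: "local_defining \<Omega> U \<rho>" and p: "pt \<theta> s0 t0 \<in> U" and nz: "slope \<rho> (dir (\<theta> + pi / 2)) (pt \<theta> s0 t0) \<noteq> 0"
    and cl: "closed \<Omega>"
  shows "\<exists>\<eta>>0. \<exists>C\<ge>0. \<forall>h. norm h < \<eta> \<longrightarrow>
    measure lborel ({t. (pt \<theta> (s0 + h) t \<in> \<Omega>) \<noteq> (pt \<theta> s0 t \<in> \<Omega>)} \<inter> ball t0 \<eta>) \<le> C * norm h"
proof -
  let ?p = "pt \<theta> s0 t0"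
  define e where "e = dir (\<theta> + pi / 2)"
  note U = local_definingD[OF ld]
  define m where "m = \<bar>slope \<rho> e ?p\<bar> / 2"
  have m: "m > 0" using nz by (simp add: m_def e_def)
  define W where "W = U \<inter> {x. \<bar>slope \<rho> e x\<bar> > m}"
  have "continuous_on U (\<lambda>x. \<bar>slope \<rho> e x\<bar>)"
    by (intro continuous_intros smooth_on_continuous_on smooth_on_frechet U)
  from continuous_open_preimage[OF this U(1), of "{m<..}"]
  have "open W" by (simp add: W_def vimage_def Int_def)
  moreover have "?p \<in> W" using p m by (simp add: W_def m_def)
  ultimately obtain r where r: "r > 0" "cball ?p r \<subseteq> W" by (meson open_contains_cball)
  then have rU: "cball ?p r \<subseteq> U" by (auto simp: W_def)
  obtain M where M: "M \<ge> 0" "\<And>x y. x \<in> cball ?p r \<Longrightarrow> y \<in> cball ?p r \<Longrightarrow> \<bar>\<rho> x - \<rho> y\<bar> \<le> M * norm (x - y)"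
    using smooth_on_lipschitz[OF U(1,2) rU] by blast
  have inb: "pt \<theta> (s0 + h) t \<in> cball ?p r" if "\<bar>h\<bar> \<le> r / 4" "\<bar>t - t0\<bar> \<le> 3 * r / 4" for h t
    using dist_pt_le[of \<theta> s0 t0 "s0 + h" t] that by (simp add: abs_minus_commute)
  have "\<forall>h. norm h < r / 4 \<longrightarrow>
      measure lborel ({t. (pt \<theta> (s0 + h) t \<in> \<Omega>) \<noteq> (pt \<theta> s0 t \<in> \<Omega>)} \<inter> ball t0 (r / 4)) \<le> 2 * (2 * M / m) * norm h"
  proof (intro allI impI)
    fix h :: real assume h: "norm h < r / 4"
    let ?A = "{t. (pt \<theta> (s0 + h) t \<in> \<Omega>) \<noteq> (pt \<theta> s0 t \<in> \<Omega>)} \<inter> ball t0 (r / 4)"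
    have small: "\<bar>\<rho> (pt \<theta> s0 t)\<bar> \<le> M * \<bar>h\<bar>" if "t \<in> ?A" for t
    proof -
      have xb: "pt \<theta> s0 t \<in> cball ?p r" "pt \<theta> (s0 + h) t \<in> cball ?p r"
      proof -
        have "\<bar>t - t0\<bar> < r / 4" using that by (simp add: dist_real_def abs_minus_commute)
        then show "pt \<theta> s0 t \<in> cball ?p r" "pt \<theta> (s0 + h) t \<in> cball ?p r"
          using h r(1) inb[of 0 t] inb[of h t] by simp_all
      qed
      then have "(\<rho> (pt \<theta> (s0 + h) t) \<le> 0) \<noteq> (\<rho> (pt \<theta> s0 t) \<le> 0)" using that U(3) rU by auto
      then have "\<bar>\<rho> (pt \<theta> s0 t)\<bar> \<le> \<bar>\<rho> (pt \<theta> (s0 + h) t) - \<rho> (pt \<theta> s0 t)\<bar>" by linarith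
      also have "\<dots> \<le> M * norm (pt \<theta> (s0 + h) t - pt \<theta> s0 t)" using M(2)[OF xb(2,1)] by simp
      also have "norm (pt \<theta> (s0 + h) t - pt \<theta> s0 t) = \<bar>h\<bar>" unfolding pt_diff by (simp add: pt_def)
      finally show ?thesis .
    qed
    have diam: "\<bar>x - y\<bar> \<le> 2 * M / m * \<bar>h\<bar>" if x: "x \<in> ?A" and y: "y \<in> ?A" for x y
    proof -
      have xy: "\<bar>x - t0\<bar> < r / 4" "\<bar>y - t0\<bar> < r / 4" using x y by (simp_all add: dist_real_def abs_minus_commute)
      have cb: "pt \<theta> s0 t \<in> cball ?p r" if "\<bar>t - y\<bar> \<le> \<bar>x - y\<bar>" for t
      proof -
        have "\<bar>t - t0\<bar> \<le> 3 * r / 4" using that xy by linarith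
        then show ?thesis using inb[of 0 t] r(1) by simp
      qed
      have "\<exists>z. \<bar>z - y\<bar> \<le> \<bar>x - y\<bar> \<and> \<rho> (pt \<theta> s0 x) - \<rho> (pt \<theta> s0 y) = (x - y) * slope \<rho> e (pt \<theta> s0 z)"
        unfolding e_def
        by (rule mean_value_abs, rule has_derivative_pt_line(2), rule U(4)) (use cb rU in auto)
      then obtain z where z: "\<bar>z - y\<bar> \<le> \<bar>x - y\<bar>" "\<rho> (pt \<theta> s0 x) - \<rho> (pt \<theta> s0 y) = (x - y) * slope \<rho> e (pt \<theta> s0 z)"
        by blast
      have "m \<le> \<bar>slope \<rho> e (pt \<theta> s0 z)\<bar>" using cb[OF z(1)] r(2) by (auto simp: W_def)
      then have "\<bar>x - y\<bar> * m \<le> \<bar>\<rho> (pt \<theta> s0 x) - \<rho> (pt \<theta> s0 y)\<bar>"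
        unfolding z(2) abs_mult by (intro mult_left_mono) auto
      also have "\<dots> \<le> 2 * (M * \<bar>h\<bar>)" using small[OF x] small[OF y] by linarith
      finally show ?thesis using m by (simp add: field_simps)
    qed
    have "?A \<in> sets borel" using line_change_borel[OF cl] by auto
    from emeasure_real_diameter[OF this diam]
    have "emeasure lborel ?A \<le> ennreal (2 * (2 * M / m * \<bar>h\<bar>))" by simp
    then show "measure lborel ?A \<le> 2 * (2 * M / m) * norm h"
      using M m by (intro emeasure_lborel_bounded_imp_measure_le) (auto simp: mult_ac)
  qed
  moreover have "r / 4 > 0" "2 * (2 * M / m) \<ge> 0" using r M m by auto
  ultimately show ?thesis by blast
qed

text \<open>Away from tangencies the chord changes at bounded speed, which is negligible against
  sqrt |h|.\<close>

lemma line_change_measure: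
  assumes cl: "closed \<Omega>" and sb: "smooth_boundary \<Omega>" and K: "compact K"
    and nt: "\<And>t. t \<in> K \<Longrightarrow> \<not> tangent_dir \<Omega> (pt \<theta> s0 t) (dir (\<theta> + pi / 2))"
  shows "\<exists>\<eta>>0. \<exists>C\<ge>0. \<forall>h. norm h < \<eta> \<longrightarrow>
    measure lborel ({t. (pt \<theta> (s0 + h) t \<in> \<Omega>) \<noteq> (pt \<theta> s0 t \<in> \<Omega>)} \<inter> K) \<le> C * norm h"
proof (rule compact_cover_measure[OF K])
  show "{t. (pt \<theta> (s0 + h) t \<in> \<Omega>) \<noteq> (pt \<theta> s0 t \<in> \<Omega>)} \<in> sets borel" for h
    by (rule line_change_borel[OF cl])
  fix t0 assume t0: "t0 \<in> K"
  show "\<exists>\<eta>>0. \<exists>C\<ge>0. \<forall>h. norm h < \<eta> \<longrightarrow>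
    measure lborel ({t. (pt \<theta> (s0 + h) t \<in> \<Omega>) \<noteq> (pt \<theta> s0 t \<in> \<Omega>)} \<inter> ball t0 \<eta>) \<le> C * norm h"
  proof (cases "pt \<theta> s0 t0 \<in> frontier \<Omega>")
    case True
    then obtain U \<rho> where "local_defining \<Omega> U \<rho>" "pt \<theta> s0 t0 \<in> U" "slope \<rho> (dir (\<theta> + pi / 2)) (pt \<theta> s0 t0) \<noteq> 0"
      using nt[OF t0] unfolding tangent_dir_def by blast
    then show ?thesis by (rule transversal_window[OF _ _ _ cl])
  next
    case False
    then obtain r where r: "r > 0" "\<And>x y. x \<in> ball (pt \<theta> s0 t0) r \<Longrightarrow> y \<in> ball (pt \<theta> s0 t0) r \<Longrightarrow> x \<in> \<Omega> \<longleftrightarrow> y \<in> \<Omega>"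
      by (rule not_frontier_locally_constant) blast
    have "{t. (pt \<theta> (s0 + h) t \<in> \<Omega>) \<noteq> (pt \<theta> s0 t \<in> \<Omega>)} \<inter> ball t0 (r / 2) = {}" if "norm h < r / 2" for h
    proof -
      have "pt \<theta> (s0 + h') t \<in> ball (pt \<theta> s0 t0) r" if "\<bar>h'\<bar> < r / 2" "\<bar>t - t0\<bar> < r / 2" for h' t
        using dist_pt_le[of \<theta> s0 t0 "s0 + h'" t] that by (simp add: abs_minus_commute)
      from this[of 0] this[of h]
      have "pt \<theta> s0 t \<in> ball (pt \<theta> s0 t0) r" "pt \<theta> (s0 + h) t \<in> ball (pt \<theta> s0 t0) r" if "t \<in> ball t0 (r / 2)" for t
        using that \<open>norm h < r / 2\<close> r(1) by (simp_all add: dist_real_def abs_minus_commute)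
      then show ?thesis using r(2) by blast
    qed
    then have "\<forall>h. norm h < r / 2 \<longrightarrow>
      measure lborel ({t. (pt \<theta> (s0 + h) t \<in> \<Omega>) \<noteq> (pt \<theta> s0 t \<in> \<Omega>)} \<inter> ball t0 (r / 2)) \<le> 0 * norm h" by simp
    moreover have "r / 2 > 0" "(0::real) \<le> 0" using r by auto
    ultimately show ?thesis by blast
  qed
qed

text \<open>By Taylor's formula \<rho> has one sign on the tangent line near \<open>t0\<close> and
  is at most |\<beta>| (t - t0)^2 in size, whereas a shift of the line by h to the suitable side
  changes it by at least |\<alpha>| h / 2 in the opposite sense. So membership flips for |t - t0| <
  c sqrt h, and elsewhere in the window it can change only in the same sense, which rules out
  cancellation. At \<open>t0\<close> itself \<rho> vanishes and the point belongs to \<Omega>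
  whatever the sign \<kappa>; hence \<open>t0\<close> is excluded.\<close>

lemma tangential_window:
  assumes ld: "local_defining \<Omega> U \<rho>" and p: "pt \<theta> s0 t0 \<in> U" and zero: "\<rho> (pt \<theta> s0 t0) = 0"
    and tang: "slope \<rho> (dir (\<theta> + pi / 2)) (pt \<theta> s0 t0) = 0"
    and curv: "slope (slope \<rho> (dir (\<theta> + pi / 2))) (dir (\<theta> + pi / 2)) (pt \<theta> s0 t0) \<noteq> 0"
  obtains \<eta> c \<sigma> \<kappa> :: real where "\<eta> > 0" "c > 0" "\<bar>\<sigma>\<bar> = 1" "\<bar>\<kappa>\<bar> = 1"
    "\<And>h t. 0 < h \<Longrightarrow> h < \<eta> \<Longrightarrow> \<bar>t - t0\<bar> < \<eta> \<Longrightarrow> t \<noteq> t0 \<Longrightarrow>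
       0 \<le> \<kappa> * (indicator \<Omega> (pt \<theta> (s0 + \<sigma> * h) t) - indicator \<Omega> (pt \<theta> s0 t))"
    "\<And>h t. 0 < h \<Longrightarrow> h < \<eta> \<Longrightarrow> \<bar>t - t0\<bar> < \<eta> \<Longrightarrow> t \<noteq> t0 \<Longrightarrow> \<bar>t - t0\<bar> < c * sqrt h \<Longrightarrow>
       \<kappa> * (indicator \<Omega> (pt \<theta> (s0 + \<sigma> * h) t) - indicator \<Omega> (pt \<theta> s0 t)) = 1"
proof -
  let ?p = "pt \<theta> s0 t0"
  define d e where "d = dir \<theta>" and "e = dir (\<theta> + pi / 2)"
  note U = local_definingD[OF ld]
  define \<alpha> \<beta> where "\<alpha> = slope \<rho> d ?p" and "\<beta> = slope (slope \<rho> e) e ?p"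
  have ab: "\<alpha> \<noteq> 0" "\<beta> \<noteq> 0"
    using slope_dir_nonzero[OF ld p tang] curv by (auto simp: \<alpha>_def \<beta>_def d_def e_def)
  have sm: "smooth_on U (slope \<rho> d)" "smooth_on U (slope \<rho> e)" "smooth_on U (slope (slope \<rho> e) e)"
    by (intro smooth_on_frechet U(2))+
  define W where "W = U \<inter> {x. \<bar>slope \<rho> d x - \<alpha>\<bar> < \<bar>\<alpha>\<bar> / 2} \<inter> (U \<inter> {x. \<bar>slope (slope \<rho> e) e x - \<beta>\<bar> < \<bar>\<beta>\<bar> / 2})"
  have "open W"
  proof -
    have 1: "continuous_on U (\<lambda>x. \<bar>slope \<rho> d x - \<alpha>\<bar>)" "continuous_on U (\<lambda>x. \<bar>slope (slope \<rho> e) e x - \<beta>\<bar>)"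
      by (intro continuous_intros smooth_on_continuous_on sm)+
    have "open (U \<inter> {x. \<bar>slope \<rho> d x - \<alpha>\<bar> < \<bar>\<alpha>\<bar> / 2})"
      using continuous_open_preimage[OF 1(1) U(1), of "{..<\<bar>\<alpha>\<bar> / 2}"] by (simp add: vimage_def Int_def)
    moreover have "open (U \<inter> {x. \<bar>slope (slope \<rho> e) e x - \<beta>\<bar> < \<bar>\<beta>\<bar> / 2})"
      using continuous_open_preimage[OF 1(2) U(1), of "{..<\<bar>\<beta>\<bar> / 2}"] by (simp add: vimage_def Int_def)
    ultimately show ?thesis unfolding W_def by (rule open_Int)
  qed
  moreover have "?p \<in> W" using p ab by (simp add: W_def \<alpha>_def \<beta>_def)
  ultimately obtain r where r: "r > 0" "ball ?p r \<subseteq> W" by (meson openE)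
  define \<eta> where "\<eta> = r / 2"
  have inW: "pt \<theta> s t \<in> W" if "\<bar>s - s0\<bar> < \<eta>" "\<bar>t - t0\<bar> < \<eta>" for s t
    using dist_pt_le[of \<theta> s0 t0 s t] that r(2) by (auto simp: \<eta>_def abs_minus_commute)
  have WU: "W \<subseteq> U" by (auto simp: W_def)
  define q where "q t = \<rho> (pt \<theta> s0 t)" for t
  have q: "sgn \<beta> * q t > 0" "sgn \<beta> * q t \<le> \<bar>\<beta>\<bar> * (t - t0)\<^sup>2" if t: "\<bar>t - t0\<bar> < \<eta>" "t \<noteq> t0" for t
  proof -
    define D where "D k = (if k = 0 then q else if k = 1 then (\<lambda>t. slope \<rho> e (pt \<theta> s0 t)) else (\<lambda>t. slope (slope \<rho> e) e (pt \<theta> s0 t)))" for k :: nat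
    have "\<exists>z. (if t < t0 then t < z \<and> z < t0 else t0 < z \<and> z < t) \<and>
      q t = (\<Sum>k<2. D k t0 / fact k * (t - t0) ^ k) + D 2 z / fact 2 * (t - t0) ^ 2"
    proof (rule Taylor[of 2 D q "min t t0" "max t t0"])
      show "\<forall>k z. k < 2 \<and> min t t0 \<le> z \<and> z \<le> max t t0 \<longrightarrow> (D k has_real_derivative D (Suc k) z) (at z)"
      proof (intro allI impI)
        fix k :: nat and z assume k: "k < 2 \<and> min t t0 \<le> z \<and> z \<le> max t t0"
        then have "\<bar>z - t0\<bar> < \<eta>" using t by (auto simp: min_def max_def split: if_splits)
        then have z: "pt \<theta> s0 z \<in> U" using inW[of s0 z] WU r by (auto simp: \<eta>_def)
        from k consider "k = 0" | "k = 1" by linarith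
        then show "(D k has_real_derivative D (Suc k) z) (at z)"
        proof cases
          case 1
          then show ?thesis
            using has_derivative_pt_line(2)[OF U(4)[OF z]] by (simp add: D_def q_def[abs_def] e_def)
        next
          case 2
          then show ?thesis
            using has_derivative_pt_line(2)[OF smooth_on_has_derivative[OF sm(2) z]] by (simp add: D_def e_def)
        qed
      qed
    qed (auto simp: D_def t)
    then obtain z where z: "if t < t0 then t < z \<and> z < t0 else t0 < z \<and> z < t"
      "q t = (\<Sum>k<2. D k t0 / fact k * (t - t0) ^ k) + D 2 z / fact 2 * (t - t0) ^ 2" by blast
    have "(\<Sum>k<2. D k t0 / fact k * (t - t0) ^ k) = 0"
      using zero tang by (simp add: D_def q_def e_def numeral_2_eq_2)
    then have qt: "q t = slope (slope \<rho> e) e (pt \<theta> s0 z) / 2 * (t - t0)\<^sup>2"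
      using z(2) by (simp add: D_def)
    have "\<bar>z - t0\<bar> < \<eta>" using z(1) t by (auto split: if_splits)
    then have "pt \<theta> s0 z \<in> W" using inW[of s0 z] r by (auto simp: \<eta>_def)
    then have zb: "\<bar>slope (slope \<rho> e) e (pt \<theta> s0 z) - \<beta>\<bar> < \<bar>\<beta>\<bar> / 2" by (simp add: W_def)
    then have b: "0 < sgn \<beta> * slope (slope \<rho> e) e (pt \<theta> s0 z)" "sgn \<beta> * slope (slope \<rho> e) e (pt \<theta> s0 z) \<le> 2 * \<bar>\<beta>\<bar>"
      using ab by (auto simp: sgn_if abs_if split: if_splits)
    have t2: "(t - t0)\<^sup>2 > 0" using t by simp
    have eq: "sgn \<beta> * q t = (sgn \<beta> * slope (slope \<rho> e) e (pt \<theta> s0 z)) / 2 * (t - t0)\<^sup>2" by (simp add: qt)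
    show "sgn \<beta> * q t > 0" unfolding eq using b t2 by simp
    have "(sgn \<beta> * slope (slope \<rho> e) e (pt \<theta> s0 z)) / 2 * (t - t0)\<^sup>2 \<le> \<bar>\<beta>\<bar> * (t - t0)\<^sup>2"
      by (rule mult_right_mono) (use b(2) in auto)
    then show "sgn \<beta> * q t \<le> \<bar>\<beta>\<bar> * (t - t0)\<^sup>2" unfolding eq .
  qed
  \<comment> \<open>\<sigma> is the side to which \<open>sgn \<beta> * \<rho>\<close> decreases;
    \<kappa> is 1 if the shifted line gains points of \<Omega> and -1 if it loses them.\<close>
  define \<sigma> \<kappa> where "\<sigma> = - sgn \<alpha> * sgn \<beta>" and "\<kappa> = sgn \<beta>"
  \<comment> \<open>Solves \<open>\<bar>\<beta>\<bar> * (t - t0)\<^sup>2 < \<bar>\<alpha>\<bar> / 2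
    * h\<close> for \<open>\<bar>t - t0\<bar>\<close> in units of \<open>sqrt h\<close>.\<close>
  define c where "c = sqrt (\<bar>\<alpha>\<bar> / (2 * \<bar>\<beta>\<bar>))"
  have c: "c > 0" using ab by (simp add: c_def)
  have shift: "sgn \<beta> * \<rho> (pt \<theta> (s0 + \<sigma> * h) t) \<le> sgn \<beta> * q t - \<bar>\<alpha>\<bar> / 2 * h"
    if h: "0 < h" "h < \<eta>" and t: "\<bar>t - t0\<bar> < \<eta>" for h t
  proof -
    have s1: "\<bar>\<sigma>\<bar> = 1" using ab by (simp add: \<sigma>_def abs_mult)
    have "\<exists>z. \<bar>z - s0\<bar> \<le> \<bar>s0 + \<sigma> * h - s0\<bar> \<and> \<rho> (pt \<theta> (s0 + \<sigma> * h) t) - \<rho> (pt \<theta> s0 t) = (s0 + \<sigma> * h - s0) * slope \<rho> d (pt \<theta> z t)"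
      unfolding d_def
    proof (rule mean_value_abs, rule has_derivative_pt_line(1), rule U(4))
      fix z assume "\<bar>z - s0\<bar> \<le> \<bar>s0 + \<sigma> * h - s0\<bar>"
      then have "\<bar>z - s0\<bar> < \<eta>" using h s1 by (simp add: abs_mult)
      then show "pt \<theta> z t \<in> U" using inW t WU by blast
    qed
    then obtain z where z: "\<bar>z - s0\<bar> \<le> \<bar>\<sigma> * h\<bar>" "\<rho> (pt \<theta> (s0 + \<sigma> * h) t) - q t = \<sigma> * h * slope \<rho> d (pt \<theta> z t)"
      by (auto simp: q_def)
    have "pt \<theta> z t \<in> W" using inW[of z t] z(1) h t s1 by (simp add: abs_mult)
    then have "\<bar>slope \<rho> d (pt \<theta> z t) - \<alpha>\<bar> < \<bar>\<alpha>\<bar> / 2" by (simp add: W_def)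
    then have "sgn \<alpha> * slope \<rho> d (pt \<theta> z t) \<ge> \<bar>\<alpha>\<bar> / 2"
      using ab by (auto simp: sgn_if abs_if split: if_splits)
    then have "h * (sgn \<alpha> * slope \<rho> d (pt \<theta> z t)) \<ge> h * (\<bar>\<alpha>\<bar> / 2)" using h by (intro mult_left_mono) auto
    moreover have "sgn \<beta> * (\<sigma> * h * slope \<rho> d (pt \<theta> z t)) = - (h * (sgn \<alpha> * slope \<rho> d (pt \<theta> z t)))"
      using ab by (simp add: \<sigma>_def sgn_if)
    ultimately show ?thesis using z(2) by (simp add: algebra_simps)
  qed
  have mem: "pt \<theta> (s0 + \<sigma> * h) t \<in> \<Omega> \<longleftrightarrow> \<rho> (pt \<theta> (s0 + \<sigma> * h) t) \<le> 0" "pt \<theta> s0 t \<in> \<Omega> \<longleftrightarrow> q t \<le> 0"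
    if "0 < h" "h < \<eta>" "\<bar>t - t0\<bar> < \<eta>" for h t
  proof -
    have "\<bar>\<sigma>\<bar> = 1" using ab by (simp add: \<sigma>_def abs_mult)
    then have "pt \<theta> (s0 + \<sigma> * h) t \<in> U" "pt \<theta> s0 t \<in> U"
      using inW[of "s0 + \<sigma> * h" t] inW[of s0 t] that WU by (auto simp: abs_mult)
    then show "pt \<theta> (s0 + \<sigma> * h) t \<in> \<Omega> \<longleftrightarrow> \<rho> (pt \<theta> (s0 + \<sigma> * h) t) \<le> 0" "pt \<theta> s0 t \<in> \<Omega> \<longleftrightarrow> q t \<le> 0"
      using U(3) by (auto simp: q_def)
  qed
  show thesis
  proof (rule that[of \<eta> c \<sigma> \<kappa>])
    show "\<eta> > 0" "c > 0" "\<bar>\<sigma>\<bar> = 1" "\<bar>\<kappa>\<bar> = 1" using r c ab by (auto simp: \<eta>_def \<sigma>_def \<kappa>_def abs_mult)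
    fix h t :: real assume h: "0 < h" "h < \<eta>" and t: "\<bar>t - t0\<bar> < \<eta>" "t \<noteq> t0"
    let ?I = "indicator \<Omega> (pt \<theta> (s0 + \<sigma> * h) t) :: real" and ?J = "indicator \<Omega> (pt \<theta> s0 t) :: real"
    have J: "?J = (if \<beta> > 0 then 0 else 1)"
      using q(1)[OF t] mem(2)[OF h t(1)] ab by (auto simp: sgn_if indicator_def split: if_splits)
    then show "0 \<le> \<kappa> * (?I - ?J)" using ab by (auto simp: \<kappa>_def sgn_if indicator_def)
    assume small: "\<bar>t - t0\<bar> < c * sqrt h"
    have "(t - t0)\<^sup>2 < (c * sqrt h)\<^sup>2" using small power_strict_mono[of "\<bar>t - t0\<bar>" "c * sqrt h" 2] by simp
    also have "\<dots> = \<bar>\<alpha>\<bar> / (2 * \<bar>\<beta>\<bar>) * h" using h ab by (simp add: c_def power_mult_distrib)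
    finally have "\<bar>\<beta>\<bar> * (t - t0)\<^sup>2 < \<bar>\<alpha>\<bar> / 2 * h" using ab by (simp add: field_simps)
    then have "sgn \<beta> * \<rho> (pt \<theta> (s0 + \<sigma> * h) t) < 0" using shift[OF h t(1)] q(2)[OF t] by linarith
    then have "?I = (if \<beta> > 0 then 1 else 0)"
      using mem(1)[OF h t(1)] ab by (auto simp: sgn_if indicator_def split: if_splits)
    then show "\<kappa> * (?I - ?J) = 1" using J ab by (auto simp: \<kappa>_def sgn_if)
  qed
qed


section \<open>Chord integrals of integrands with modulus o(sqrt d)\<close>

definition sqrt_modulus :: "(real^2 \<Rightarrow> real) \<Rightarrow> bool" where
  "sqrt_modulus G \<longleftrightarrow> (\<forall>\<epsilon>>0. \<exists>\<delta>>0. \<forall>x\<in>cball 0 2. \<forall>y\<in>cball 0 2. norm (x - y) < \<delta> \<longrightarrow>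
     \<bar>G x - G y\<bar> \<le> \<epsilon> * sqrt (norm (x - y)))"

lemma exp_minus_lipschitz:
  fixes x y :: real
  assumes "0 \<le> x" "0 \<le> y"
  shows "\<bar>exp (- x) - exp (- y)\<bar> \<le> \<bar>x - y\<bar>"
proof -
  have *: "\<bar>exp (- x) - exp (- y)\<bar> \<le> \<bar>x - y\<bar>" if "0 \<le> x" "x \<le> y" for x y :: real
  proof -
    have "1 - exp (- (y - x)) \<le> y - x" using exp_ge_add_one_self[of "- (y - x)"] by linarith
    then have "exp (- x) * (1 - exp (- (y - x))) \<le> 1 * (y - x)"
      using that by (intro mult_mono) auto
    moreover have "exp (- x) * (1 - exp (- (y - x))) = exp (- x) - exp (- y)"
      by (simp add: right_diff_distrib flip: exp_add)
    moreover have "exp (- y) \<le> exp (- x)" using that by simp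
    ultimately show ?thesis using that by simp
  qed
  show ?thesis using *[of x y] *[of y x] assms by (cases "x \<le> y") (auto simp: abs_minus_commute)
qed

text \<open>Nonnegativity of \<open>V\<close> puts the exponent where exp(-x) has Lipschitz constant
  1, and \<open>h\<close> is Lipschitz, hence of smaller order than the square root at short
  distances. The disc of radius 2 contains all points with both coordinates at most 1 in absolute
  value, in any frame.\<close>

lemma sqrt_modulus_smooth_times_exp:
  assumes h: "smooth_on UNIV h" and V: "sqrt_modulus V" "\<And>x. V x \<ge> 0"
  shows "sqrt_modulus (\<lambda>x. h x * exp (- V x))"
  unfolding sqrt_modulus_def
proof (intro allI impI)
  fix \<epsilon> :: real assume "\<epsilon> > 0"
  obtain L where L: "L \<ge> 0" "\<And>x y. x \<in> cball 0 2 \<Longrightarrow> y \<in> cball 0 2 \<Longrightarrow> \<bar>h x - h y\<bar> \<le> L * norm (x - y)"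
    using smooth_on_lipschitz[OF open_UNIV h, of 0 2] by auto
  have "compact (h ` cball 0 2)"
    using continuous_on_subset[OF smooth_on_continuous_on[OF h]] by (intro compact_continuous_image) auto
  then obtain B' where "\<And>x. x \<in> cball 0 2 \<Longrightarrow> norm (h x) \<le> B'"
    using compact_imp_bounded bounded_iff by (metis imageI)
  then obtain B where B: "B > 0" "\<And>x. x \<in> cball 0 2 \<Longrightarrow> \<bar>h x\<bar> \<le> B"
    by (metis max.strict_coboundedI2 max.coboundedI1 real_norm_def zero_less_one)
  obtain \<delta> where \<delta>: "\<delta> > 0" "\<And>x y. x \<in> cball 0 2 \<Longrightarrow> y \<in> cball 0 2 \<Longrightarrow> norm (x - y) < \<delta> \<Longrightarrow>
      \<bar>V x - V y\<bar> \<le> \<epsilon> / (2 * B) * sqrt (norm (x - y))"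
    using V(1)[unfolded sqrt_modulus_def, rule_format, of "\<epsilon> / (2 * B)"] \<open>\<epsilon> > 0\<close> B(1) by auto
  define q where "q = \<epsilon> / (2 * (L + 1))"
  have q: "q > 0" "L * q \<le> \<epsilon> / 2"
  proof -
    show "q > 0" using L \<open>\<epsilon> > 0\<close> by (simp add: q_def)
    have "(L + 1) * q = \<epsilon> / 2" using L by (simp add: q_def field_simps)
    then show "L * q \<le> \<epsilon> / 2" using \<open>q > 0\<close> by (simp add: distrib_right)
  qed
  show "\<exists>\<delta>>0. \<forall>x\<in>cball 0 2. \<forall>y\<in>cball 0 2. norm (x - y) < \<delta> \<longrightarrow>
     \<bar>h x * exp (- V x) - h y * exp (- V y)\<bar> \<le> \<epsilon> * sqrt (norm (x - y))"
  proof (intro exI[of _ "min \<delta> (q\<^sup>2)"] conjI ballI impI)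
    show "min \<delta> (q\<^sup>2) > 0" using \<delta> q by simp
    fix x y :: "real^2" assume x: "x \<in> cball 0 2" and y: "y \<in> cball 0 2" and xy: "norm (x - y) < min \<delta> (q\<^sup>2)"
    define s where "s = sqrt (norm (x - y))"
    have s: "s \<ge> 0" "norm (x - y) = s * s" "s \<le> q"
      using xy q(1) by (auto simp: s_def real_less_lsqrt less_imp_le)
    have "h x * exp (- V x) - h y * exp (- V y) = (h x - h y) * exp (- V x) + h y * (exp (- V x) - exp (- V y))"
      by (simp add: algebra_simps)
    then have "\<bar>h x * exp (- V x) - h y * exp (- V y)\<bar> \<le> \<bar>h x - h y\<bar> * exp (- V x) + \<bar>h y\<bar> * \<bar>exp (- V x) - exp (- V y)\<bar>"
      using abs_triangle_ineq[of "(h x - h y) * exp (- V x)" "h y * (exp (- V x) - exp (- V y))"] by (simp add: abs_mult)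
    also have "\<dots> \<le> (L * (s * s)) * 1 + B * (\<epsilon> / (2 * B) * s)"
    proof (intro add_mono mult_mono)
      show "\<bar>h x - h y\<bar> \<le> L * (s * s)" using L(2)[OF x y] s by simp
      show "exp (- V x) \<le> 1" using V(2)[of x] by simp
      show "\<bar>exp (- V x) - exp (- V y)\<bar> \<le> \<epsilon> / (2 * B) * s"
        using exp_minus_lipschitz[OF V(2) V(2), of x y] \<delta>(2)[OF x y] xy by (simp add: s_def)
    qed (use L B y s in auto)
    also have "\<dots> = (L * s) * s + \<epsilon> / 2 * s" using B(1) by simp
    also have "\<dots> \<le> (\<epsilon> / 2) * s + \<epsilon> / 2 * s"
    proof -
      have "L * s \<le> L * q" using s L by (intro mult_left_mono) auto
      then show ?thesis using q s by (intro add_mono mult_right_mono) auto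
    qed
    finally show "\<bar>h x * exp (- V x) - h y * exp (- V y)\<bar> \<le> \<epsilon> * sqrt (norm (x - y))"
      by (simp add: s_def)
  qed
qed

lemma sqrt_modulus_continuous:
  assumes "sqrt_modulus G"
  shows "continuous_on (cball 0 2) G"
  unfolding continuous_on_iff
proof (intro ballI allI impI)
  fix x :: "real^2" and e :: real assume x: "x \<in> cball 0 2" and e: "e > 0"
  obtain \<delta> where \<delta>: "\<delta> > 0" "\<And>x y. x \<in> cball 0 2 \<Longrightarrow> y \<in> cball 0 2 \<Longrightarrow> norm (x - y) < \<delta> \<Longrightarrow>
      \<bar>G x - G y\<bar> \<le> e * sqrt (norm (x - y))"
    using assms e unfolding sqrt_modulus_def by meson
  show "\<exists>d>0. \<forall>y\<in>cball 0 2. dist y x < d \<longrightarrow> dist (G y) (G x) < e"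
  proof (intro exI[of _ "min \<delta> 1"] conjI ballI impI)
    fix y :: "real^2" assume y: "y \<in> cball 0 2" "dist y x < min \<delta> 1"
    then have "\<bar>G y - G x\<bar> \<le> e * sqrt (norm (y - x))" using \<delta>(2) x by (simp add: dist_norm)
    also have "\<dots> < e * 1" using y(2) e by (intro mult_strict_left_mono) (auto simp: dist_norm)
    finally show "dist (G y) (G x) < e" by (simp add: dist_real_def)
  qed (use \<delta> in auto)
qed

text \<open>The weight \<open>G\<close> is a parameter because the two data sets carry different
  attenuation factors; the estimates use only its modulus and, on one side, its sign.\<close>

definition chord_integral :: "(real^2) set \<Rightarrow> (real^2 \<Rightarrow> real) \<Rightarrow> real \<Rightarrow> real \<Rightarrow> real" where
  "chord_integral \<Omega> G \<theta> s = (LINT t|lborel. G (pt \<theta> s t) * indicator \<Omega> (pt \<theta> s t))"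

lemma chord_in_disc:
  assumes "\<Omega> \<subseteq> ball 0 1" "pt \<theta> s t \<in> \<Omega>"
  shows "\<bar>s\<bar> < 1" "\<bar>t\<bar> < 1"
proof -
  have "norm (pt \<theta> s t) < 1" using assms by auto
  then show "\<bar>s\<bar> < 1" "\<bar>t\<bar> < 1" using abs_le_norm_pt[of s \<theta> t] abs_le_norm_pt(2)[of t \<theta> s] by auto
qed

lemma pt_in_cball2: "\<bar>s\<bar> \<le> 1 \<Longrightarrow> \<bar>t\<bar> \<le> 1 \<Longrightarrow> pt \<theta> s t \<in> cball 0 2"
  using norm_pt_le[of \<theta> s t] by simp

lemma chord_integrable:
  fixes G :: "real^2 \<Rightarrow> real"
  assumes cl: "closed \<Omega>" and sub: "\<Omega> \<subseteq> ball 0 1" and G: "continuous_on (cball 0 2) G" and s: "\<bar>s\<bar> \<le> 1" "\<bar>s'\<bar> \<le> 1"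
    and A: "A \<in> sets borel"
  shows "integrable lborel (\<lambda>t. G (pt \<theta> s t) * indicator \<Omega> (pt \<theta> s' t) * indicator A t)"
proof -
  have c: "continuous_on {-1..1} (\<lambda>t. G (pt \<theta> s t))"
    by (rule continuous_on_compose2[OF G]) (use pt_in_cball2 s in \<open>auto intro!: continuous_intros\<close>)
  have i: "integrable lborel (\<lambda>t. indicator {-1..1} t *\<^sub>R G (pt \<theta> s t))"
    using borel_integrable_atLeastAtMost'[OF c] by (simp add: set_integrable_def)
  have m: "{t. pt \<theta> s' t \<in> \<Omega>} \<in> sets borel"
    using cl by (intro borel_closed closed_vimage[of \<Omega> "pt \<theta> s'", unfolded vimage_def]) (auto intro: continuous_intros)
  have "integrable lborel (\<lambda>t. indicator {-1..1} t *\<^sub>R G (pt \<theta> s t) * (indicator {t. pt \<theta> s' t \<in> \<Omega>} t * indicator A t))"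
  proof (rule Bochner_Integration.integrable_bound[OF i])
    show "(\<lambda>t. indicator {-1..1} t *\<^sub>R G (pt \<theta> s t) * (indicator {t. pt \<theta> s' t \<in> \<Omega>} t * indicator A t)) \<in> borel_measurable lborel"
      using borel_measurable_integrable[OF i] m A by (intro borel_measurable_times) auto
  qed (auto simp: abs_mult indicator_def)
  also have "(\<lambda>t. indicator {-1..1} t *\<^sub>R G (pt \<theta> s t) * (indicator {t. pt \<theta> s' t \<in> \<Omega>} t * indicator A t)) =
      (\<lambda>t. G (pt \<theta> s t) * indicator \<Omega> (pt \<theta> s' t) * indicator A t)"
  proof
    fix t
    show "indicator {-1..1} t *\<^sub>R G (pt \<theta> s t) * (indicator {t. pt \<theta> s' t \<in> \<Omega>} t * indicator A t) =
      G (pt \<theta> s t) * indicator \<Omega> (pt \<theta> s' t) * indicator A t"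
      using chord_in_disc(2)[OF sub, of \<theta> s' t] by (auto simp: indicator_def)
  qed
  finally show ?thesis .
qed

text \<open>The variation of the integrand along the chord is of smaller order than the square root of the
  displacement, so only the change of the chord itself matters.\<close>
lemma chord_integral_variation:
  assumes cl: "closed \<Omega>" and sub: "\<Omega> \<subseteq> ball 0 1" and G: "sqrt_modulus G" and s0: "\<bar>s0\<bar> < 1"
    and K: "K \<in> sets borel"
    and KC: "\<exists>\<eta>>0. \<exists>C\<ge>0. \<forall>h. norm h < \<eta> \<longrightarrow>
      measure lborel ({t. (pt \<theta> (s0 + h) t \<in> \<Omega>) \<noteq> (pt \<theta> s0 t \<in> \<Omega>)} \<inter> K) \<le> C * norm h" and "\<epsilon> > 0"
  shows "\<exists>\<delta>>0. \<forall>h. \<bar>h\<bar> < \<delta> \<longrightarrow>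
    \<bar>chord_integral \<Omega> G \<theta> (s0 + h) - chord_integral \<Omega> G \<theta> s0 -
      (LINT t|lborel. G (pt \<theta> s0 t) * (indicator \<Omega> (pt \<theta> (s0 + h) t) - indicator \<Omega> (pt \<theta> s0 t)) * indicator (- K) t)\<bar>
    \<le> \<epsilon> * sqrt \<bar>h\<bar>"
proof -
  note Gc = sqrt_modulus_continuous[OF G]
  note ci = chord_integrable[OF cl sub Gc]
  have "compact (G ` cball 0 2)" using Gc by (intro compact_continuous_image) auto
  then obtain B' where "\<And>x. x \<in> cball 0 2 \<Longrightarrow> norm (G x) \<le> B'"
    using compact_imp_bounded bounded_iff by (metis imageI)
  then obtain B where B: "B > 0" "\<And>x. x \<in> cball 0 2 \<Longrightarrow> \<bar>G x\<bar> \<le> B"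
    by (metis max.strict_coboundedI2 max.coboundedI1 real_norm_def zero_less_one)
  obtain \<eta> C where C: "\<eta> > 0" "C \<ge> 0" "\<And>h. \<bar>h\<bar> < \<eta> \<Longrightarrow>
      measure lborel ({t. (pt \<theta> (s0 + h) t \<in> \<Omega>) \<noteq> (pt \<theta> s0 t \<in> \<Omega>)} \<inter> K) \<le> C * \<bar>h\<bar>"
    using KC by auto
  obtain \<delta> where \<delta>: "\<delta> > 0" "\<And>x y. x \<in> cball 0 2 \<Longrightarrow> y \<in> cball 0 2 \<Longrightarrow> norm (x - y) < \<delta> \<Longrightarrow>
      \<bar>G x - G y\<bar> \<le> \<epsilon> / 4 * sqrt (norm (x - y))"
    using G[unfolded sqrt_modulus_def, rule_format, of "\<epsilon> / 4"] \<open>\<epsilon> > 0\<close> by auto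
  \<comment> \<open>For |h| <= q^2 the linear bound B C |h| is at most (\<epsilon>/2) sqrt
    |h|.\<close>
  define q where "q = \<epsilon> / (2 * (B * C + 1))"
  have BC: "B * C + 1 > 0" using B C by (intro add_nonneg_pos) auto
  have q: "q > 0" "B * C * q \<le> \<epsilon> / 2"
  proof -
    show "q > 0" using BC \<open>\<epsilon> > 0\<close> by (simp add: q_def)
    have "(B * C + 1) * q = \<epsilon> / 2" using BC by (simp add: q_def field_simps)
    then show "B * C * q \<le> \<epsilon> / 2" using \<open>q > 0\<close> by (simp add: distrib_right)
  qed
  define \<delta>' where "\<delta>' = Min {\<delta>, \<eta>, q\<^sup>2, 1 - \<bar>s0\<bar>}"
  have \<delta>': "\<delta>' > 0" "\<delta>' \<le> \<delta>" "\<delta>' \<le> \<eta>" "\<delta>' \<le> q\<^sup>2" "\<delta>' \<le> 1 - \<bar>s0\<bar>"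
    using \<delta>(1) C(1) q(1) s0 by (auto simp: \<delta>'_def)
  show ?thesis
  proof (intro exI[of _ \<delta>'] conjI allI impI \<delta>'(1))
    fix h assume h: "\<bar>h\<bar> < \<delta>'"
    have s: "\<bar>s0 + h\<bar> \<le> 1" "\<bar>s0\<bar> \<le> 1" using h \<delta>'(5) s0 by auto
    let ?i = "\<lambda>t. indicator \<Omega> (pt \<theta> (s0 + h) t) :: real" and ?j = "\<lambda>t. indicator \<Omega> (pt \<theta> s0 t) :: real"
    let ?G = "\<lambda>t. G (pt \<theta> s0 t)" and ?H = "\<lambda>t. G (pt \<theta> (s0 + h) t)"
    let ?k = "\<lambda>t. indicator K t :: real" and ?k' = "\<lambda>t. indicator (- K) t :: real"
    have K': "- K \<in> sets borel" using K by auto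
    have I: "integrable lborel (\<lambda>t. ?H t * ?i t)" "integrable lborel (\<lambda>t. ?G t * ?i t)" "integrable lborel (\<lambda>t. ?G t * ?j t)"
      using ci[OF s(1) s(1), of UNIV] ci[OF s(2) s(1), of UNIV] ci[OF s(2) s(2), of UNIV] by auto
    have IK: "integrable lborel (\<lambda>t. ?G t * ?i t * ?k t)" "integrable lborel (\<lambda>t. ?G t * ?j t * ?k t)"
      "integrable lborel (\<lambda>t. ?G t * ?i t * ?k' t)" "integrable lborel (\<lambda>t. ?G t * ?j t * ?k' t)"
      using ci[OF s(2) s(1) K] ci[OF s(2) s(2) K] ci[OF s(2) s(1) K'] ci[OF s(2) s(2) K'] .
    have IK': "integrable lborel (\<lambda>t. ?G t * (?i t - ?j t) * ?k t)" "integrable lborel (\<lambda>t. ?G t * (?i t - ?j t) * ?k' t)"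
      using Bochner_Integration.integrable_diff[OF IK(1,2)] Bochner_Integration.integrable_diff[OF IK(3,4)]
      by (simp_all add: algebra_simps)
    have D: "integrable lborel (\<lambda>t. (?H t - ?G t) * ?i t)"
      using Bochner_Integration.integrable_diff[OF I(1,2)] by (simp add: algebra_simps)
    \<comment> \<open>Two errors remain: the integrand moves, on the chord of the shifted line, and
      membership changes on \<open>K\<close>, on a set of measure O(|h|). The change of membership
      off \<open>K\<close> is the main term and has been subtracted.\<close>
    have "(LINT t|lborel. ?H t * ?i t) - (LINT t|lborel. ?G t * ?j t) - (LINT t|lborel. ?G t * (?i t - ?j t) * ?k' t)
        = (LINT t|lborel. ?H t * ?i t - ?G t * ?j t - ?G t * (?i t - ?j t) * ?k' t)"
      using I(1,3) IK' by simp
    also have "\<dots> = (LINT t|lborel. (?H t - ?G t) * ?i t + ?G t * (?i t - ?j t) * ?k t)"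
      by (rule Bochner_Integration.integral_cong) (auto simp: indicator_def)
    also have "\<dots> = (LINT t|lborel. (?H t - ?G t) * ?i t) + (LINT t|lborel. ?G t * (?i t - ?j t) * ?k t)"
      using D IK' by simp
    finally have eq: "chord_integral \<Omega> G \<theta> (s0 + h) - chord_integral \<Omega> G \<theta> s0 - (LINT t|lborel. ?G t * (?i t - ?j t) * ?k' t) =
        (LINT t|lborel. (?H t - ?G t) * ?i t) + (LINT t|lborel. ?G t * (?i t - ?j t) * ?k t)"
      unfolding chord_integral_def .
    have "norm (LINT t|lborel. (?H t - ?G t) * ?i t) \<le> (LINT t|lborel. \<epsilon> / 4 * sqrt \<bar>h\<bar> * indicator {-1..1::real} t)"
    proof (rule Bochner_Integration.integral_norm_bound_integral[OF D])
      show "integrable lborel (\<lambda>t. \<epsilon> / 4 * sqrt \<bar>h\<bar> * indicator {-1..1::real} t)"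
        by (intro integrable_mult_right integrable_real_indicator) auto
      fix t
      show "norm ((?H t - ?G t) * ?i t) \<le> \<epsilon> / 4 * sqrt \<bar>h\<bar> * indicator {-1..1::real} t"
      proof (cases "pt \<theta> (s0 + h) t \<in> \<Omega>")
        case True
        then have t: "\<bar>t\<bar> \<le> 1" using chord_in_disc(2)[OF sub] by (simp add: less_imp_le)
        have n: "norm (pt \<theta> (s0 + h) t - pt \<theta> s0 t) = \<bar>h\<bar>" unfolding pt_diff by (simp add: pt_def)
        have "\<bar>?H t - ?G t\<bar> \<le> \<epsilon> / 4 * sqrt \<bar>h\<bar>"
          using \<delta>(2)[OF pt_in_cball2[OF s(1) t, of \<theta>] pt_in_cball2[OF s(2) t, of \<theta>]] h \<delta>'(2) n by simp
        then show ?thesis using True t by (simp add: indicator_def abs_le_iff)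
      qed (use \<open>\<epsilon> > 0\<close> in \<open>simp add: indicator_def\<close>)
    qed
    then have 1: "\<bar>LINT t|lborel. (?H t - ?G t) * ?i t\<bar> \<le> \<epsilon> / 2 * sqrt \<bar>h\<bar>" by simp
    define A where "A = {t. (pt \<theta> (s0 + h) t \<in> \<Omega>) \<noteq> (pt \<theta> s0 t \<in> \<Omega>)} \<inter> K"
    have A: "A \<in> sets borel" unfolding A_def using line_change_borel[OF cl] K by auto
    have Asub: "A \<subseteq> {-1..1}" using chord_in_disc(2)[OF sub] by (fastforce simp: A_def abs_less_iff)
    then have "emeasure lborel A \<le> emeasure lborel {-1..1::real}" by (intro emeasure_mono) auto
    then have fin: "emeasure lborel A < \<infinity>" by (rule order.strict_trans1) simp
    have "norm (LINT t|lborel. ?G t * (?i t - ?j t) * ?k t) \<le> (LINT t|lborel. B * indicator A t)"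
    proof (rule Bochner_Integration.integral_norm_bound_integral[OF IK'(1)])
      show "integrable lborel (\<lambda>t. B * indicator A t)"
        using fin A by (intro integrable_mult_right integrable_real_indicator) auto
      fix t
      show "norm (?G t * (?i t - ?j t) * ?k t) \<le> B * indicator A t"
      proof (cases "t \<in> A")
        case True
        then have "\<bar>t\<bar> \<le> 1" using Asub by (auto simp: abs_le_iff)
        then have "\<bar>?G t\<bar> \<le> B" using B(2) pt_in_cball2 s(2) by blast
        then show ?thesis using True by (auto simp: A_def indicator_def)
      qed (auto simp: A_def indicator_def)
    qed
    also have "\<dots> \<le> B * (C * \<bar>h\<bar>)"
      using fin A C(3)[of h] h \<delta>'(3) B(1) by (simp add: A_def)
    also have "\<dots> = (B * C * sqrt \<bar>h\<bar>) * sqrt \<bar>h\<bar>" by simp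
    also have "\<dots> \<le> \<epsilon> / 2 * sqrt \<bar>h\<bar>"
    proof (rule mult_right_mono)
      have "sqrt \<bar>h\<bar> \<le> q" using h \<delta>'(4) q(1) by (intro real_le_lsqrt) auto
      then have "B * C * sqrt \<bar>h\<bar> \<le> B * C * q" using B C by (intro mult_left_mono) auto
      then show "B * C * sqrt \<bar>h\<bar> \<le> \<epsilon> / 2" using q(2) by simp
    qed simp
    finally have "\<bar>LINT t|lborel. ?G t * (?i t - ?j t) * ?k t\<bar> \<le> \<epsilon> / 2 * sqrt \<bar>h\<bar>" by simp
    then show "\<bar>chord_integral \<Omega> G \<theta> (s0 + h) - chord_integral \<Omega> G \<theta> s0 - (LINT t|lborel. ?G t * (?i t - ?j t) * ?k' t)\<bar> \<le> \<epsilon> * sqrt \<bar>h\<bar>"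
      unfolding eq using 1 by linarith
  qed
qed


text \<open>Without a tangency on this line the data of \<open>\<Omega>2\<close> vary by at most
  \<epsilon> sqrt h around \<open>s0\<close>. Those of \<open>\<Omega>1\<close> vary, up to
  \<epsilon> sqrt h, by the contribution of the tangential window, which has one sign and is at
  least 2 m c sqrt h. The hypothesis \<open>uniq\<close> matters because a second tangency could
  contribute with the opposite sign.\<close>

lemma curved_tangent_detected:
  assumes \<Omega>1: "closed \<Omega>1" "\<Omega>1 \<subseteq> ball 0 1" "smooth_boundary \<Omega>1" and G1: "sqrt_modulus G1" "\<And>x. x \<in> \<Omega>1 \<Longrightarrow> G1 x > 0"
    and \<Omega>2: "closed \<Omega>2" "\<Omega>2 \<subseteq> ball 0 1" "smooth_boundary \<Omega>2" and G2: "sqrt_modulus G2"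
    and ld: "local_defining \<Omega>1 U \<rho>" and p: "pt \<theta> s0 t0 \<in> U" and zero: "\<rho> (pt \<theta> s0 t0) = 0"
    and tang: "slope \<rho> (dir (\<theta> + pi / 2)) (pt \<theta> s0 t0) = 0"
    and curv: "slope (slope \<rho> (dir (\<theta> + pi / 2))) (dir (\<theta> + pi / 2)) (pt \<theta> s0 t0) \<noteq> 0"
    and uniq: "\<And>t. tangent_dir \<Omega>1 (pt \<theta> s0 t) (dir (\<theta> + pi / 2)) \<Longrightarrow> t = t0"
    and eq: "\<And>s. chord_integral \<Omega>1 G1 \<theta> s = chord_integral \<Omega>2 G2 \<theta> s"
  shows "\<exists>t. tangent_dir \<Omega>2 (pt \<theta> s0 t) (dir (\<theta> + pi / 2))"
proof (rule ccontr)
  assume no: "\<not> (\<exists>t. tangent_dir \<Omega>2 (pt \<theta> s0 t) (dir (\<theta> + pi / 2)))"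
  let ?p = "pt \<theta> s0 t0"
  have p1: "?p \<in> \<Omega>1" using local_definingD(3)[OF ld p] zero by simp
  have st0: "\<bar>s0\<bar> < 1" "\<bar>t0\<bar> < 1" using chord_in_disc[OF \<Omega>1(2) p1] by auto
  obtain \<eta> c \<sigma> \<kappa> :: real where w: "\<eta> > 0" "c > 0" "\<bar>\<sigma>\<bar> = 1" "\<bar>\<kappa>\<bar> = 1"
    "\<And>h t. 0 < h \<Longrightarrow> h < \<eta> \<Longrightarrow> \<bar>t - t0\<bar> < \<eta> \<Longrightarrow> t \<noteq> t0 \<Longrightarrow>
       0 \<le> \<kappa> * (indicator \<Omega>1 (pt \<theta> (s0 + \<sigma> * h) t) - indicator \<Omega>1 (pt \<theta> s0 t))"
    "\<And>h t. 0 < h \<Longrightarrow> h < \<eta> \<Longrightarrow> \<bar>t - t0\<bar> < \<eta> \<Longrightarrow> t \<noteq> t0 \<Longrightarrow> \<bar>t - t0\<bar> < c * sqrt h \<Longrightarrow>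
       \<kappa> * (indicator \<Omega>1 (pt \<theta> (s0 + \<sigma> * h) t) - indicator \<Omega>1 (pt \<theta> s0 t)) = 1"
    using tangential_window[OF ld p zero tang curv] by metis
  have Gc: "continuous_on (cball 0 2) G1" by (rule sqrt_modulus_continuous[OF G1(1)])
  define m where "m = G1 ?p / 2"
  have m: "m > 0" using G1(2)[OF p1] by (simp add: m_def)
  have "continuous_on {-1..1} (\<lambda>t. G1 (pt \<theta> s0 t))"
    by (rule continuous_on_compose2[OF Gc]) (use pt_in_cball2 st0(1) in \<open>auto intro!: continuous_intros simp: less_imp_le abs_le_iff\<close>)
  then have Gt0: "isCont (\<lambda>t. G1 (pt \<theta> s0 t)) t0"
    using st0(2) by (intro continuous_on_interior[of "{-1..1}"]) (auto simp: abs_less_iff)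
  have "\<forall>\<^sub>F t in nhds t0. G1 (pt \<theta> s0 t) > m"
    by (rule order_tendstoD(1)[OF iffD1[OF tendsto_at_iff_tendsto_nhds Gt0[unfolded continuous_at]]])
       (use m in \<open>simp add: m_def\<close>)
  then obtain \<eta>1 where \<eta>1: "\<eta>1 > 0" "\<And>t. \<bar>t - t0\<bar> < \<eta>1 \<Longrightarrow> G1 (pt \<theta> s0 t) > m"
    by (auto simp: eventually_nhds_metric dist_real_def)
  define \<eta>2 where "\<eta>2 = min \<eta> \<eta>1"
  have \<eta>2: "\<eta>2 > 0" "\<eta>2 \<le> \<eta>" "\<eta>2 \<le> \<eta>1" using w(1) \<eta>1(1) by (auto simp: \<eta>2_def)
  \<comment> \<open>All relevant parameters outside the tangential window; by \<open>uniq\<close>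
    there is no tangency with \<open>\<Omega>1\<close> on \<open>K\<close>. For |t| > 1 the line is
    outside the disc.\<close>
  define K where "K = {-1..1} - ball t0 \<eta>2"
  have K: "compact K" unfolding K_def by (intro compact_diff) auto
  have K_borel: "K \<in> sets borel" using compact_imp_closed[OF K] by auto
  have nt1: "\<not> tangent_dir \<Omega>1 (pt \<theta> s0 t) (dir (\<theta> + pi / 2))" if "t \<in> K" for t
    using uniq[of t] that \<eta>2(1) by (auto simp: K_def)
  \<comment> \<open>With r = c sqrt h the two errors add up to 2 \<epsilon> sqrt h = m r, half of
    the lower bound 2 m r.\<close>
  define \<epsilon> where "\<epsilon> = m * c / 2"
  have \<epsilon>: "\<epsilon> > 0" using m w by (simp add: \<epsilon>_def)
  let ?i = "\<lambda>h t. indicator \<Omega>1 (pt \<theta> (s0 + h) t) :: real" and ?j = "\<lambda>t. indicator \<Omega>1 (pt \<theta> s0 t) :: real"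
  obtain \<delta>1 where \<delta>1: "\<delta>1 > 0" "\<And>h. \<bar>h\<bar> < \<delta>1 \<Longrightarrow>
    \<bar>chord_integral \<Omega>1 G1 \<theta> (s0 + h) - chord_integral \<Omega>1 G1 \<theta> s0 -
      (LINT t|lborel. G1 (pt \<theta> s0 t) * (?i h t - ?j t) * indicator (- K) t)\<bar> \<le> \<epsilon> * sqrt \<bar>h\<bar>"
    using chord_integral_variation[OF \<Omega>1(1,2) G1(1) st0(1) K_borel line_change_measure[OF \<Omega>1(1,3) K nt1] \<epsilon>] by blast
  have KI: "compact {-1..1::real}" "{-1..1::real} \<in> sets borel" by auto
  have nt2: "\<not> tangent_dir \<Omega>2 (pt \<theta> s0 t) (dir (\<theta> + pi / 2))" if "t \<in> {-1..1}" for t using no by blast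
  have "\<exists>\<delta>>0. \<forall>h. \<bar>h\<bar> < \<delta> \<longrightarrow>
    \<bar>chord_integral \<Omega>2 G2 \<theta> (s0 + h) - chord_integral \<Omega>2 G2 \<theta> s0 -
      (LINT t|lborel. G2 (pt \<theta> s0 t) * (indicator \<Omega>2 (pt \<theta> (s0 + h) t) - indicator \<Omega>2 (pt \<theta> s0 t)) * indicator (- {-1..1}) t)\<bar>
       \<le> \<epsilon> * sqrt \<bar>h\<bar>"
    by (rule chord_integral_variation[OF \<Omega>2(1,2) G2(1) st0(1) KI(2) line_change_measure[OF \<Omega>2(1,3) KI(1) nt2] \<epsilon>])
  moreover have "G2 (pt \<theta> s0 t) * (indicator \<Omega>2 (pt \<theta> (s0 + h) t) - indicator \<Omega>2 (pt \<theta> s0 t)) * indicator (- {-1..1}) t = 0" for h t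
  proof (cases "\<bar>t\<bar> < 1")
    case False
    then have "pt \<theta> (s0 + h) t \<notin> \<Omega>2" "pt \<theta> s0 t \<notin> \<Omega>2" using chord_in_disc(2)[OF \<Omega>2(2)] by blast+
    then show ?thesis by simp
  qed (simp add: abs_less_iff)
  ultimately obtain \<delta>2 where \<delta>2: "\<delta>2 > 0" "\<And>h. \<bar>h\<bar> < \<delta>2 \<Longrightarrow>
    \<bar>chord_integral \<Omega>2 G2 \<theta> (s0 + h) - chord_integral \<Omega>2 G2 \<theta> s0\<bar> \<le> \<epsilon> * sqrt \<bar>h\<bar>"
    by auto
  define h where "h = Min {\<delta>1, \<delta>2, \<eta>2, (\<eta>2 / c)\<^sup>2, 1 - \<bar>s0\<bar>} / 2"
  have h: "h > 0" "h < \<delta>1" "h < \<delta>2" "h < \<eta>2" "h < (\<eta>2 / c)\<^sup>2" "h < 1 - \<bar>s0\<bar>"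
  proof -
    let ?M = "Min {\<delta>1, \<delta>2, \<eta>2, (\<eta>2 / c)\<^sup>2, 1 - \<bar>s0\<bar>}"
    have "?M > 0" using \<delta>1(1) \<delta>2(1) \<eta>2(1) w(2) st0(1) by simp
    moreover have "?M \<le> \<delta>1" "?M \<le> \<delta>2" "?M \<le> \<eta>2" "?M \<le> (\<eta>2 / c)\<^sup>2" "?M \<le> 1 - \<bar>s0\<bar>"
      by (rule Min_le, simp, simp)+
    ultimately show "h > 0" "h < \<delta>1" "h < \<delta>2" "h < \<eta>2" "h < (\<eta>2 / c)\<^sup>2" "h < 1 - \<bar>s0\<bar>"
      unfolding h_def by linarith+
  qed
  define r where "r = c * sqrt h"
  have r: "r > 0" "r < \<eta>2"
  proof -
    have "sqrt h < \<eta>2 / c" using h(5) \<eta>2(1) w(2) by (intro real_less_lsqrt) auto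
    then show "r < \<eta>2" using w(2) by (simp add: r_def field_simps)
  qed (use w h in \<open>simp add: r_def\<close>)
  have sh: "\<bar>\<sigma> * h\<bar> = h" using w(3) h(1) by (simp add: abs_mult)
  let ?g = "\<lambda>t. G1 (pt \<theta> s0 t) * (?i (\<sigma> * h) t - ?j t) * indicator (- K) t"
  have gi: "integrable lborel ?g"
  proof -
    have s: "\<bar>s0\<bar> \<le> 1" "\<bar>s0 + \<sigma> * h\<bar> \<le> 1" using st0(1) sh h(6) by linarith+
    have "- K \<in> sets borel" using K_borel by auto
    note ci = chord_integrable[OF \<Omega>1(1,2) Gc s(1) _ this]
    show ?thesis
      using Bochner_Integration.integrable_diff[OF ci[OF s(2)] ci[OF s(1)]] by (simp add: algebra_simps)
  qed
  have "(LINT t|lborel. m * indicator {t0 - r..t0 + r} t) \<le> (LINT t|lborel. \<kappa> * ?g t)"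
  proof (rule integral_mono_AE)
    show "integrable lborel (\<lambda>t. m * indicator {t0 - r..t0 + r} t)"
      using r(1) by (intro integrable_mult_right integrable_real_indicator) auto
    show "integrable lborel (\<lambda>t. \<kappa> * ?g t)" using gi by simp
    \<comment> \<open>The window excludes \<open>t0\<close> and has a strict bound on
      \<open>\<bar>t - t0\<bar>\<close>, while the interval compared with it is closed; the three
      points form a null set.\<close>
    have "AE t in lborel. t \<notin> {t0, t0 - r, t0 + r}"
      by (intro AE_not_in) (auto intro: finite_imp_null_set_lborel)
    then show "AE t in lborel. m * indicator {t0 - r..t0 + r} t \<le> \<kappa> * ?g t"
    proof eventually_elim
      case (elim t)
      show ?case
      proof (cases "\<bar>t - t0\<bar> < \<eta>2")
        case True
        then have k: "indicator (- K) t = (1::real)" by (simp add: K_def dist_real_def abs_minus_commute)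
        have t: "\<bar>t - t0\<bar> < \<eta>" "G1 (pt \<theta> s0 t) > m" "t \<noteq> t0" "h < \<eta>"
          using True \<eta>2 \<eta>1(2) elim h(4) by auto
        let ?D = "\<kappa> * (?i (\<sigma> * h) t - ?j t)"
        have e: "\<kappa> * ?g t = G1 (pt \<theta> s0 t) * ?D" unfolding k by simp
        show ?thesis
        proof (cases "t \<in> {t0 - r..t0 + r}")
          case True
          then have "\<bar>t - t0\<bar> < c * sqrt h" using elim by (auto simp: r_def)
          then have "?D = 1" using w(6)[OF h(1) t(4) t(1) t(3)] by simp
          then show ?thesis unfolding e using True t(2) by simp
        next
          case False
          have "0 \<le> ?D" using w(5)[OF h(1) t(4) t(1) t(3)] .
          then show ?thesis unfolding e using False t(2) m by simp
        qed
      next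
        case False
        then have "t \<notin> {t0 - r..t0 + r}" using r by auto
        moreover have "?g t = 0"
        proof (cases "\<bar>t\<bar> < 1")
          case True
          then have "t \<in> K" using False by (auto simp: K_def dist_real_def)
          then show ?thesis by simp
        next
          case False
          then have "pt \<theta> (s0 + \<sigma> * h) t \<notin> \<Omega>1" "pt \<theta> s0 t \<notin> \<Omega>1" using chord_in_disc(2)[OF \<Omega>1(2)] by blast+
          then show ?thesis by simp
        qed
        ultimately show ?thesis by (simp only: indicator_simps(2) mult_zero_right order_refl simp_thms)
      qed
    qed
  qed
  moreover have "(LINT t|lborel. m * indicator {t0 - r..t0 + r} t) = 2 * m * r" using r by simp
  ultimately have "2 * m * r \<le> (LINT t|lborel. \<kappa> * ?g t)" by linarith
  also have "\<dots> = \<kappa> * (LINT t|lborel. ?g t)" by (rule integral_mult_right_zero)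
  also have "\<dots> \<le> \<bar>\<kappa>\<bar> * \<bar>LINT t|lborel. ?g t\<bar>" unfolding abs_mult[symmetric] by (rule abs_ge_self)
  finally have low: "2 * m * r \<le> \<bar>LINT t|lborel. ?g t\<bar>" unfolding w(4) mult_1_left .
  have "\<bar>LINT t|lborel. ?g t\<bar> \<le> 2 * (\<epsilon> * sqrt h)"
    using \<delta>1(2)[of "\<sigma> * h"] \<delta>2(2)[of "\<sigma> * h"] h eq unfolding sh by simp
  also have "\<dots> = m * r" by (simp add: \<epsilon>_def r_def)
  finally have "2 * (m * r) \<le> m * r" using low by linarith
  moreover have "m * r > 0" using m r(1) by simp
  ultimately show False by linarith
qed


lemma R_transform_chord:
  "R_transform a b \<psi> \<phi> c0 w (cutoff u \<Omega>) s \<theta> =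
    c0 * chord_integral \<Omega> (\<lambda>x. w x * u x * exp (- V_smooth a b \<psi> \<phi> (cutoff u \<Omega>) x \<theta>)) \<theta> s"
  unfolding R_transform_def line_integral_def chord_integral_def cutoff_def pt_def[symmetric]
  by (simp add: mult_ac)

lemma integrand_modulus:
  assumes "a > 0" "b > 0" "smooth_on UNIV w" "\<And>x. x \<in> ball 0 1 \<Longrightarrow> w x > 0"
    and K: "smoothing_kernel \<phi>" and L2: "integrable lborel (\<lambda>x. (\<phi> x)\<^sup>2)" and adm: "admissible \<Omega> u"
  shows "sqrt_modulus (\<lambda>x. w x * u x * exp (- V_smooth a b \<psi> \<phi> (cutoff u \<Omega>) x \<theta>))"
    and "x \<in> \<Omega> \<Longrightarrow> w x * u x * exp (- V_smooth a b \<psi> \<phi> (cutoff u \<Omega>) x \<theta>) > 0"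
proof -
  note V = V_smooth_modulus[OF K L2 adm assms(1,2)]
  have "smooth_on UNIV (\<lambda>x. w x * u x)"
    by (rule smooth_on_bilinear[OF open_UNIV bounded_bilinear_mult assms(3) admissibleD(5)[OF adm]])
  then show "sqrt_modulus (\<lambda>x. w x * u x * exp (- V_smooth a b \<psi> \<phi> (cutoff u \<Omega>) x \<theta>))"
    using V by (intro sqrt_modulus_smooth_times_exp) (auto simp: sqrt_modulus_def)
  assume "x \<in> \<Omega>"
  then have "w x > 0" "u x > 0" using assms(4)[of x] admissibleD(3,6)[OF adm] by auto
  then show "w x * u x * exp (- V_smooth a b \<psi> \<phi> (cutoff u \<Omega>) x \<theta>) > 0" by simp
qed

lemma curved_tangent_transfer:
  assumes ab: "a > 0" "b > 0" and c0: "c0 > 0" and w: "smooth_on UNIV w" "\<And>x. x \<in> ball 0 1 \<Longrightarrow> w x > 0"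
    and K: "smoothing_kernel \<phi>" and L2: "integrable lborel (\<lambda>x. (\<phi> x)\<^sup>2)"
    and adm: "admissible \<Omega>1 u1" "admissible \<Omega>2 u2"
    and eq: "\<And>s. R_transform a b \<psi> \<phi> c0 w (cutoff u1 \<Omega>1) s \<theta> = R_transform a b \<psi> \<phi> c0 w (cutoff u2 \<Omega>2) s \<theta>"
    and ld: "local_defining \<Omega>1 U \<rho>" and p: "pt \<theta> s0 t0 \<in> U" and zero: "\<rho> (pt \<theta> s0 t0) = 0"
    and tang: "slope \<rho> (dir (\<theta> + pi / 2)) (pt \<theta> s0 t0) = 0"
    and curv: "slope (slope \<rho> (dir (\<theta> + pi / 2))) (dir (\<theta> + pi / 2)) (pt \<theta> s0 t0) \<noteq> 0"
    and uniq: "\<And>t. tangent_dir \<Omega>1 (pt \<theta> s0 t) (dir (\<theta> + pi / 2)) \<Longrightarrow> t = t0"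
  shows "\<exists>t. tangent_dir \<Omega>2 (pt \<theta> s0 t) (dir (\<theta> + pi / 2))"
proof (rule curved_tangent_detected[OF _ _ _ _ _ _ _ _ _ ld p zero tang curv uniq])
  note im = integrand_modulus[OF ab w(1) _ K L2]
  show "sqrt_modulus (\<lambda>x. w x * u1 x * exp (- V_smooth a b \<psi> \<phi> (cutoff u1 \<Omega>1) x \<theta>))"
    "sqrt_modulus (\<lambda>x. w x * u2 x * exp (- V_smooth a b \<psi> \<phi> (cutoff u2 \<Omega>2) x \<theta>))"
    "\<And>x. x \<in> \<Omega>1 \<Longrightarrow> w x * u1 x * exp (- V_smooth a b \<psi> \<phi> (cutoff u1 \<Omega>1) x \<theta>) > 0"
    by (rule im(1)[OF w(2) adm(1)], assumption, rule im(1)[OF w(2) adm(2)], assumption, rule im(2)[OF w(2) adm(1)])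
  show "chord_integral \<Omega>1 (\<lambda>x. w x * u1 x * exp (- V_smooth a b \<psi> \<phi> (cutoff u1 \<Omega>1) x \<theta>)) \<theta> s =
    chord_integral \<Omega>2 (\<lambda>x. w x * u2 x * exp (- V_smooth a b \<psi> \<phi> (cutoff u2 \<Omega>2) x \<theta>)) \<theta> s" for s
    using eq[of s] c0 unfolding R_transform_chord by simp
qed (use admissibleD[OF adm(1)] admissibleD[OF adm(2)] in auto)

subsection \<open>Tangent lines and points of tangency\<close>

lemma slope_pt:
  assumes "local_defining \<Omega> U \<rho>" "x \<in> U"
  shows "slope \<rho> (pt \<theta> a b) x = a * slope \<rho> (dir \<theta>) x + b * slope \<rho> (dir (\<theta> + pi / 2)) x"
proof -
  interpret bounded_linear "frechet_derivative \<rho> (at x)"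
    using local_definingD(4)[OF assms] by (rule has_derivative_bounded_linear)
  show ?thesis by (simp add: pt_def add scaleR)
qed

lemma regular_curve_velocity:
  assumes "regular_curve_through S p \<gamma>"
  shows "(\<gamma> has_vector_derivative velocity \<gamma> 0) (at 0)" "velocity \<gamma> 0 \<noteq> 0" "\<gamma> 0 = p"
    "\<forall>\<^sub>F t in nhds 0. \<gamma> t \<in> S"
proof -
  obtain r where r: "r > 0" "smooth_on {-r<..<r} \<gamma>" "\<forall>t\<in>{-r<..<r}. velocity \<gamma> t \<noteq> 0" "\<gamma> ` {-r<..<r} \<subseteq> S"
    and "\<gamma> 0 = p"
    using assms unfolding regular_curve_through_def by blast
  then show "\<gamma> 0 = p" "velocity \<gamma> 0 \<noteq> 0" by auto
  have "\<gamma> differentiable (at 0)"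
    using smooth_on_has_derivative[OF r(2), of 0] r(1) by (auto simp: differentiable_def)
  then show "(\<gamma> has_vector_derivative velocity \<gamma> 0) (at 0)"
    by (simp add: velocity_def vector_derivative_works)
  show "\<forall>\<^sub>F t in nhds 0. \<gamma> t \<in> S"
    using eventually_nhds_in_open[of "{-r<..<r}" 0] r(1,4) by (auto elim!: eventually_mono)
qed

lemma curve_in_frontier_tangent:
  fixes \<gamma> :: "real \<Rightarrow> real^2"
  assumes ld: "local_defining \<Omega> U \<rho>" and cl: "closed \<Omega>" and \<gamma>: "(\<gamma> has_vector_derivative v) (at t)" "\<gamma> t \<in> U"
    and ev: "\<forall>\<^sub>F t in nhds t. \<gamma> t \<in> frontier \<Omega>"
  shows "slope \<rho> v (\<gamma> t) = 0"
proof -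
  note U = local_definingD[OF ld]
  interpret bounded_linear "frechet_derivative \<rho> (at (\<gamma> t))"
    using U(4)[OF \<gamma>(2)] by (rule has_derivative_bounded_linear)
  have d: "((\<lambda>t. \<rho> (\<gamma> t)) has_real_derivative slope \<rho> v (\<gamma> t)) (at t)"
    using has_derivative_compose[OF \<gamma>(1)[unfolded has_vector_derivative_def] U(4)[OF \<gamma>(2)]]
    by (simp add: scaleR has_field_derivative_def mult_commute_abs)
  have "isCont \<gamma> t" using \<gamma>(1) by (rule has_vector_derivative_continuous)
  then have "\<forall>\<^sub>F t in nhds t. \<gamma> t \<in> U"
    using U(1) \<gamma>(2) topological_tendstoD[OF iffD1[OF tendsto_at_iff_tendsto_nhds]] by (simp add: continuous_at)
  with ev have z: "\<forall>\<^sub>F t in nhds t. \<rho> (\<gamma> t) = 0"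
    by eventually_elim (use frontier_local_defining[OF ld cl] in blast)
  have "((\<lambda>t. \<rho> (\<gamma> t)) has_real_derivative 0) (at t)"
    using DERIV_cong_ev[OF refl z refl, THEN iffD2] by simp
  then show ?thesis using DERIV_unique[OF d] by simp
qed

lemma tangent_points_slope:
  assumes ld: "local_defining \<Omega> U \<rho>" and cl: "closed \<Omega>" and p: "p \<in> tangent_points (frontier \<Omega>) s \<theta>" "p \<in> U"
  shows "slope \<rho> (dir (\<theta> + pi / 2)) p = 0"
proof -
  obtain \<gamma> where \<gamma>: "regular_curve_through (frontier \<Omega>) p \<gamma>" and orth: "velocity \<gamma> 0 \<bullet> dir \<theta> = 0"
    using p(1) unfolding tangent_points_def by blast
  note rc = regular_curve_velocity[OF \<gamma>]
  obtain k where v: "velocity \<gamma> 0 = pt \<theta> 0 k" using orth pt_inner_eq by metis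
  then have k: "k \<noteq> 0" using rc(2) by (auto simp: pt_def)
  have "slope \<rho> (pt \<theta> 0 k) (\<gamma> 0) = 0"
    using curve_in_frontier_tangent[OF ld cl rc(1) _ rc(4)] p(2) rc(3) v by simp
  moreover have "slope \<rho> (pt \<theta> 0 k) p = k * slope \<rho> (dir (\<theta> + pi / 2)) p" using slope_pt[OF ld p(2)] by simp
  ultimately show ?thesis using k rc(3) by simp
qed

lemma graph_chartD:
  assumes "graph_chart S \<theta> s0 t0 \<epsilon> \<delta> g g' g''"
  shows "\<epsilon> > 0" "\<delta> > 0" "\<And>t. \<bar>t - t0\<bar> < \<delta> \<Longrightarrow> \<bar>g t - s0\<bar> < \<epsilon>"
    "\<And>t. \<bar>t - t0\<bar> < \<delta> \<Longrightarrow> (g has_real_derivative g' t) (at t)"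
    "\<And>t. \<bar>t - t0\<bar> < \<delta> \<Longrightarrow> (g' has_real_derivative g'' t) (at t)"
    "\<And>t. \<bar>t - t0\<bar> < \<delta> \<Longrightarrow> isCont g'' t"
    "\<And>s t. \<bar>s - s0\<bar> < \<epsilon> \<Longrightarrow> \<bar>t - t0\<bar> < \<delta> \<Longrightarrow> pt \<theta> s t \<in> S \<longleftrightarrow> s = g t"
  using assms unfolding graph_chart_def by auto

text \<open>The graph over the tangent direction, with its parameter shifted to 0. It connects
  tangency in terms of defining functions with the curves in the definition of
  \<open>Upsilon\<close>.\<close>

lemma regular_tangent_curve:
  assumes cl: "closed \<Omega>" and ld: "local_defining \<Omega> U \<rho>" and pU: "pt \<theta> s0 t0 \<in> U"
    and fr: "pt \<theta> s0 t0 \<in> frontier \<Omega>" and tang: "slope \<rho> (dir (\<theta> + pi / 2)) (pt \<theta> s0 t0) = 0"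
  obtains \<gamma> where "regular_curve_through (frontier \<Omega>) (pt \<theta> s0 t0) \<gamma>" "velocity \<gamma> 0 = dir (\<theta> + pi / 2)"
proof -
  let ?p = "pt \<theta> s0 t0"
  have nz: "slope \<rho> (dir \<theta>) ?p \<noteq> 0" using slope_dir_nonzero[OF ld pU tang] .
  obtain \<epsilon> \<delta> g g' g'' where ch: "graph_chart (frontier \<Omega>) \<theta> s0 t0 \<epsilon> \<delta> g g' g''"
    and sl: "\<And>t. \<bar>t - t0\<bar> < \<delta> \<Longrightarrow> slope \<rho> (pt \<theta> (g' t) 1) (pt \<theta> (g t) t) = 0"
    and sm: "smooth_on {-\<delta><..<\<delta>} (\<lambda>t. pt \<theta> (g (t0 + t)) (t0 + t))"
    and vd: "\<And>t. \<bar>t\<bar> < \<delta> \<Longrightarrow> ((\<lambda>t. pt \<theta> (g (t0 + t)) (t0 + t)) has_vector_derivative pt \<theta> (g' (t0 + t)) 1) (at t)"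
    by (rule exists_graph_chart[OF ld cl pU fr nz]) blast
  note C = graph_chartD[OF ch]
  have g0: "g t0 = s0" using C(7)[of s0 t0] fr C(1,2) by simp
  define \<gamma> where "\<gamma> t = pt \<theta> (g (t0 + t)) (t0 + t)" for t
  have vel: "velocity \<gamma> t = pt \<theta> (g' (t0 + t)) 1" if "\<bar>t\<bar> < \<delta>" for t
    unfolding velocity_def \<gamma>_def using vd[OF that] by (rule vector_derivative_at)
  have "regular_curve_through (frontier \<Omega>) ?p \<gamma>"
    unfolding regular_curve_through_def
  proof (intro exI[of _ \<delta>] conjI ballI)
    show "smooth_on {-\<delta><..<\<delta>} \<gamma>" using sm by (simp add: \<gamma>_def[abs_def])
    show "velocity \<gamma> t \<noteq> 0" if "t \<in> {-\<delta><..<\<delta>}" for t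
    proof -
      have "velocity \<gamma> t \<bullet> dir (\<theta> + pi / 2) = 1" using vel[of t] that by (simp add: abs_less_iff)
      then show ?thesis by auto
    qed
    show "\<gamma> ` {-\<delta><..<\<delta>} \<subseteq> frontier \<Omega>"
      using C(3,7) by (auto simp: \<gamma>_def abs_less_iff)
  qed (use C(2) g0 in \<open>auto simp: \<gamma>_def\<close>)
  moreover have "g' t0 * slope \<rho> (dir \<theta>) ?p = 0"
    using sl[of t0] C(2) g0 tang slope_pt[OF ld pU] by simp
  then have "velocity \<gamma> 0 = dir (\<theta> + pi / 2)" using nz vel[of 0] C(2) by (simp add: pt_def)
  ultimately show thesis by (rule that)
qed

lemma tangent_dir_tangent_points:
  assumes cl: "closed \<Omega>" and sb: "smooth_boundary \<Omega>" and td: "tangent_dir \<Omega> (pt \<theta> s0 t0) (dir (\<theta> + pi / 2))"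
  shows "pt \<theta> s0 t0 \<in> tangent_points (frontier \<Omega>) s0 \<theta>"
proof -
  have fr: "pt \<theta> s0 t0 \<in> frontier \<Omega>" using td by (simp add: tangent_dir_def)
  obtain U \<rho> where ld: "local_defining \<Omega> U \<rho>" and pU: "pt \<theta> s0 t0 \<in> U" using smooth_boundaryE[OF sb fr] .
  have "slope \<rho> (dir (\<theta> + pi / 2)) (pt \<theta> s0 t0) = 0" using td ld pU by (auto simp: tangent_dir_def)
  then obtain \<gamma> where "regular_curve_through (frontier \<Omega>) (pt \<theta> s0 t0) \<gamma>" "velocity \<gamma> 0 = dir (\<theta> + pi / 2)"
    by (rule regular_tangent_curve[OF cl ld pU fr])
  then show ?thesis using fr by (auto simp: tangent_points_def line_def)
qed

text \<open>Outside \<open>Upsilon\<close> the points of tangency on the line form a connected set.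
  Nonzero second slope makes the first slope nonzero at all nearby points of the line, so
  \<open>t0\<close> is isolated in this set, and a connected set on a line with an isolated point
  has no other point.\<close>

lemma curved_tangent_unique:
  assumes cl: "closed \<Omega>" and sb: "smooth_boundary \<Omega>" and ld: "local_defining \<Omega> U \<rho>" and pU: "pt \<theta> s0 t0 \<in> U"
    and zero: "\<rho> (pt \<theta> s0 t0) = 0" and tang: "slope \<rho> (dir (\<theta> + pi / 2)) (pt \<theta> s0 t0) = 0"
    and curv: "slope (slope \<rho> (dir (\<theta> + pi / 2))) (dir (\<theta> + pi / 2)) (pt \<theta> s0 t0) \<noteq> 0"
    and \<theta>: "\<theta> \<in> {-pi..pi}" "(s0, \<theta>) \<notin> Upsilon \<Omega>"
    and td: "tangent_dir \<Omega> (pt \<theta> s0 t) (dir (\<theta> + pi / 2))"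
  shows "t = t0"
proof (rule ccontr)
  assume "t \<noteq> t0"
  define e where "e = dir (\<theta> + pi / 2)"
  note U = local_definingD[OF ld]
  define T where "T = (\<lambda>x. x \<bullet> e) ` tangent_points (frontier \<Omega>) s0 \<theta>"
  have "connected (tangent_points (frontier \<Omega>) s0 \<theta>)" using \<theta> by (auto simp: Upsilon_def)
  then have "connected T" unfolding T_def by (intro connected_continuous_image continuous_intros)
  have Tmem: "pt \<theta> s0 x \<in> tangent_points (frontier \<Omega>) s0 \<theta>" if x: "x \<in> T" for x
  proof -
    obtain y where y: "y \<in> tangent_points (frontier \<Omega>) s0 \<theta>" "x = y \<bullet> e" using x unfolding T_def by blast
    then have "y \<bullet> dir \<theta> = s0" by (simp add: tangent_points_def line_def)
    then have "y = pt \<theta> s0 x" using pt_inner_eq[of \<theta> y] y(2) by (simp add: e_def)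
    then show ?thesis using y(1) by simp
  qed
  have inT: "x \<in> T" if "tangent_dir \<Omega> (pt \<theta> s0 x) e" for x
    unfolding T_def using tangent_dir_tangent_points[OF cl sb that[unfolded e_def]]
    by (intro image_eqI[of _ _ "pt \<theta> s0 x"]) (simp_all add: e_def)
  have fr: "pt \<theta> s0 t0 \<in> frontier \<Omega>" using frontier_local_defining[OF ld cl pU] zero by simp
  have "tangent_dir \<Omega> (pt \<theta> s0 t0) e"
    unfolding tangent_dir_def
  proof (intro conjI allI impI fr)
    fix U' \<rho>' assume a: "local_defining \<Omega> U' \<rho>' \<and> pt \<theta> s0 t0 \<in> U'"
    obtain \<gamma> where "regular_curve_through (frontier \<Omega>) (pt \<theta> s0 t0) \<gamma>" and v: "velocity \<gamma> 0 = e"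
      using regular_tangent_curve[OF cl ld pU fr tang] unfolding e_def .
    note rc = regular_curve_velocity[OF this(1)]
    show "slope \<rho>' e (pt \<theta> s0 t0) = 0"
      using curve_in_frontier_tangent[of \<Omega> U' \<rho>' \<gamma> e 0] rc a cl v by simp
  qed
  then have T0: "t0 \<in> T" by (rule inT)
  have T1: "t \<in> T" using inT td by (simp add: e_def)
  have "((\<lambda>x. slope \<rho> e (pt \<theta> s0 x)) has_real_derivative slope (slope \<rho> e) e (pt \<theta> s0 t0)) (at t0)"
    using has_derivative_pt_line(2)[OF smooth_on_has_derivative[OF smooth_on_frechet[OF U(2)] pU]] by (simp add: e_def)
  then have "\<forall>\<^sub>F x in at t0. (slope \<rho> e (pt \<theta> s0 x) - slope \<rho> e (pt \<theta> s0 t0)) / (x - t0) \<noteq> 0"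
    using curv by (intro tendsto_imp_eventually_ne) (simp_all add: has_field_derivative_iff e_def)
  then have "\<forall>\<^sub>F x in at t0. slope \<rho> e (pt \<theta> s0 x) \<noteq> 0"
    by eventually_elim (use tang in \<open>auto simp: e_def\<close>)
  moreover have "\<forall>\<^sub>F x in at t0. pt \<theta> s0 x \<in> U"
  proof -
    have "((\<lambda>x. pt \<theta> s0 x) \<longlongrightarrow> pt \<theta> s0 t0) (at t0)" by (intro tendsto_intros)
    then show ?thesis using U(1) pU by (rule topological_tendstoD)
  qed
  ultimately have "\<forall>\<^sub>F x in at t0. x \<notin> T"
    by eventually_elim (use tangent_points_slope[OF ld cl Tmem] in \<open>auto simp: e_def\<close>)
  then obtain d where d: "d > 0" "\<And>x. x \<noteq> t0 \<Longrightarrow> dist x t0 < d \<Longrightarrow> x \<notin> T"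
    by (auto simp: eventually_at)
  \<comment> \<open>On the way from \<open>t0\<close> to \<open>t\<close> and closer to
    \<open>t0\<close> than \<open>d\<close>: connectedness puts it into \<open>T\<close>, isolation
    keeps it out.\<close>
  define x where "x = (if t > t0 then t0 + min (d / 2) (t - t0) else t0 - min (d / 2) (t0 - t))"
  have "x \<noteq> t0" "dist x t0 < d" using d(1) \<open>t \<noteq> t0\<close> by (auto simp: x_def dist_real_def min_def)
  moreover have "x \<in> T"
    using connectedD_interval[OF \<open>connected T\<close> T0 T1, of x] connectedD_interval[OF \<open>connected T\<close> T1 T0, of x] d(1) \<open>t \<noteq> t0\<close>
    by (auto simp: x_def min_def split: if_splits)
  ultimately show False using d(2) by blast
qed

text \<open>The data are given only for angles in [-pi, pi]. The angle is that of the normal, a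
  quarter turn behind the tangent \<open>v\<close>, because \<open>line s \<theta>\<close> runs
  along \<open>dir (\<theta> + pi / 2)\<close>.\<close>

lemma unit_tangent_angle:
  fixes v :: "real^2"
  assumes "v \<noteq> 0"
  shows "\<exists>\<theta>\<in>{-pi..pi}. v = norm v *\<^sub>R dir (\<theta> + pi / 2)"
proof -
  have n: "norm v > 0" using assms by simp
  have "(v $ 2 / norm v)\<^sup>2 + (- v $ 1 / norm v)\<^sup>2 = ((v $ 1)\<^sup>2 + (v $ 2)\<^sup>2) / (norm v)\<^sup>2"
    by (simp add: power_divide add_divide_distrib)
  also have "\<dots> = 1" using n by (simp add: norm_real2[symmetric])
  finally obtain t where t: "0 \<le> t" "t \<le> 2 * pi" "v $ 2 / norm v = cos t" "- v $ 1 / norm v = sin t"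
    using sincos_total_2pi_le by blast
  define \<theta> where "\<theta> = (if t \<le> pi then t else t - 2 * pi)"
  have \<theta>: "\<theta> \<in> {-pi..pi}" "cos \<theta> = cos t" "sin \<theta> = sin t"
    using t(1,2) by (auto simp: \<theta>_def cos_diff sin_diff)
  have "v = norm v *\<^sub>R dir (\<theta> + pi / 2)"
  proof -
    have "v $ 2 = norm v * cos \<theta>" "v $ 1 = norm v * (- sin \<theta>)"
      unfolding \<theta>(2,3) t(3,4)[symmetric] using n by simp_all
    then show ?thesis by (simp add: vec_eq_iff forall_2 sin_add cos_add)
  qed
  then show ?thesis using \<theta>(1) by blast
qed

text \<open>Sard's theorem in dimension one. \<open>baby_Sard\<close> speaks of vectors, so the line
  is embedded as \<open>real^1\<close> and the conclusion is projected back by a Lipschitz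
  map.\<close>

lemma negligible_critical_values:
  fixes f :: "real \<Rightarrow> real"
  assumes "\<And>t. t \<in> S \<Longrightarrow> (f has_real_derivative 0) (at t)"
  shows "negligible (f ` S)"
proof -
  define F :: "real^1 \<Rightarrow> real^1" where "F x = f (x $ 1) *\<^sub>R vec 1" for x
  have "negligible (F ` (vec ` S))"
  proof (rule baby_Sard)
    fix x :: "real^1" assume "x \<in> vec ` S"
    then have "(f has_real_derivative 0) (at (x $ 1))" using assms by auto
    moreover have "(*) 0 = (\<lambda>h::real. 0)" by auto
    ultimately have "(f has_derivative (\<lambda>h. 0)) (at (x $ 1))" by (simp only: has_field_derivative_def)
    moreover have "((\<lambda>x::real^1. x $ 1) has_derivative (\<lambda>h. h $ 1)) (at x)"
      by (intro bounded_linear_imp_has_derivative bounded_linear_vec_nth)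
    ultimately have "((\<lambda>x::real^1. f (x $ 1)) has_derivative (\<lambda>h. 0)) (at x)"
      using has_derivative_compose by fastforce
    then have "(F has_derivative (\<lambda>h. 0 *\<^sub>R vec 1)) (at x)"
      unfolding F_def by (rule has_derivative_scaleR_left)
    then show "(F has_derivative (\<lambda>h. 0)) (at x within vec ` S)"
      by (simp add: has_derivative_at_withinI)
    show "rank (matrix (\<lambda>h::real^1. 0 :: real^1)) < CARD(1)"
    proof -
      have "matrix (\<lambda>h::real^1. 0 :: real^1) = 0" by (simp add: matrix_def vec_eq_iff)
      then show ?thesis by simp
    qed
  qed simp
  then have "negligible ((\<lambda>x. x $ 1) ` (F ` vec ` S))"
  proof (rule negligible_locally_Lipschitz_image[rotated])
    fix x :: "real^1"
    have "norm (y $ 1 - x $ 1) \<le> 1 * norm (y - x)" for y :: "real^1"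
      using component_le_norm_cart[of "y - x" 1] by simp
    then show "\<exists>T B. open T \<and> x \<in> T \<and> (\<forall>y\<in>F ` vec ` S \<inter> T. norm (y $ 1 - x $ 1) \<le> B * norm (y - x))"
      by (metis UNIV_I open_UNIV)
  qed simp
  moreover have "(\<lambda>x. x $ 1) ` F ` (vec ` S) = f ` S" by (force simp: F_def image_iff)
  ultimately show ?thesis by simp
qed


text \<open>Both \<open>pt \<theta> (k' t) 1\<close> and \<open>pt \<theta> m 1\<close> lie in the
  kernel of the nonzero differential of a defining function; that kernel is a line and contains at
  most one vector with second coordinate 1.\<close>

lemma chart_tangent_slope:
  assumes cl: "closed \<Omega>" and sb: "smooth_boundary \<Omega>" and ch: "graph_chart (frontier \<Omega>) \<theta> s0 t0 \<epsilon> \<delta> k k' k''"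
    and t: "\<bar>t - t0\<bar> < \<delta>" and td: "tangent_dir \<Omega> (pt \<theta> (k t) t) (pt \<theta> m 1)"
  shows "k' t = m"
proof -
  note C = graph_chartD[OF ch]
  let ?q = "pt \<theta> (k t) t"
  obtain U \<rho> where ld: "local_defining \<Omega> U \<rho>" and qU: "?q \<in> U"
    using smooth_boundaryE[OF sb] td unfolding tangent_dir_def by metis
  have "((\<lambda>t. pt \<theta> (k t) t) has_vector_derivative pt \<theta> (k' t) 1) (at t)"
    using C(4)[OF t] unfolding pt_def by (auto intro!: derivative_eq_intros)
  moreover have "\<forall>\<^sub>F x in nhds t. pt \<theta> (k x) x \<in> frontier \<Omega>"
  proof -
    have "\<forall>\<^sub>F x in nhds t. x \<in> {t0 - \<delta><..<t0 + \<delta>}"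
      using t by (intro eventually_nhds_in_open) (auto simp: abs_less_iff)
    then show ?thesis
    proof eventually_elim
      case (elim x)
      then have "\<bar>x - t0\<bar> < \<delta>" by auto
      then show ?case using C(3,7) by blast
    qed
  qed
  ultimately have "slope \<rho> (pt \<theta> (k' t) 1) ?q = 0"
    using curve_in_frontier_tangent[OF ld cl, of "\<lambda>t. pt \<theta> (k t) t" "pt \<theta> (k' t) 1" t] qU by blast
  moreover have "slope \<rho> (pt \<theta> m 1) ?q = 0" using td ld qU by (auto simp: tangent_dir_def)
  ultimately have "k' t * slope \<rho> (dir \<theta>) ?q + slope \<rho> (dir (\<theta> + pi / 2)) ?q = 0"
    "m * slope \<rho> (dir \<theta>) ?q + slope \<rho> (dir (\<theta> + pi / 2)) ?q = 0"
    using slope_pt[OF ld qU] by simp_all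
  moreover from this have "slope \<rho> (dir \<theta>) ?q \<noteq> 0"
    using slope_dir_nonzero[OF ld qU, of \<theta>] by auto
  ultimately show ?thesis by (metis add_right_cancel mult_right_cancel)
qed

text \<open>The derivative of the intercept \<open>g t - t * g' t\<close> with respect to the slope \<open>g' t\<close> is \<open>- t\<close>: a family
  of tangent lines determines its points of tangency.\<close>
lemma intercept_quotient_tendsto:
  assumes g: "(g has_real_derivative g' t0) (at t0)" "(g' has_real_derivative c) (at t0)" and c: "c \<noteq> 0"
    and X: "X \<longlonglongrightarrow> t0" "\<And>n. X n \<noteq> t0"
  shows "(\<lambda>n. ((g (X n) - X n * g' (X n)) - (g t0 - t0 * g' t0)) / (g' (X n) - g' t0)) \<longlonglongrightarrow> - t0"
proof -
  have lim: "filterlim X (at t0) sequentially" using X by (simp add: filterlim_at)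
  have "((\<lambda>t. g t - t * g' t) has_real_derivative (g' t0 - (1 * g' t0 + c * t0))) (at t0)"
    by (intro DERIV_diff DERIV_mult g DERIV_ident)
  then have 1: "((\<lambda>t. ((g t - t * g' t) - (g t0 - t0 * g' t0)) / (t - t0)) \<longlongrightarrow> - (c * t0)) (at t0)"
    by (simp add: has_field_derivative_iff)
  have 2: "((\<lambda>t. (g' t - g' t0) / (t - t0)) \<longlongrightarrow> c) (at t0)" using g(2) by (simp add: has_field_derivative_iff)
  have "((\<lambda>t. (((g t - t * g' t) - (g t0 - t0 * g' t0)) / (t - t0)) / ((g' t - g' t0) / (t - t0))) \<longlongrightarrow> - (c * t0) / c) (at t0)"
    by (intro tendsto_divide 1 2 c)
  from filterlim_compose[OF this lim] show ?thesis using c X(2) by simp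
qed

section \<open>Recovery of the points of tangency in a fixed frame\<close>

lemma slope_scale:
  assumes "local_defining \<Omega> U \<rho>" "x \<in> U"
  shows "slope \<rho> (c *\<^sub>R v) x = c * slope \<rho> v x"
proof -
  interpret bounded_linear "frechet_derivative \<rho> (at x)"
    using local_definingD(4)[OF assms] by (rule has_derivative_bounded_linear)
  show ?thesis by (simp add: scaleR)
qed

text \<open>Homogeneity of degree two; with it nondegeneracy survives the passage from the tangent
  \<open>pt \<theta> m 1\<close> to a unit vector.\<close>

lemma slope_slope_scale:
  assumes ld: "local_defining \<Omega> U \<rho>" and x: "x \<in> U"
  shows "slope (slope \<rho> (c *\<^sub>R v)) (c *\<^sub>R v) x = c * c * slope (slope \<rho> v) v x"
proof -
  note U = local_definingD[OF ld]
  have d: "(slope \<rho> v has_derivative frechet_derivative (slope \<rho> v) (at x)) (at x)"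
    by (rule smooth_on_has_derivative[OF smooth_on_frechet[OF U(2)] x])
  interpret bounded_linear "frechet_derivative (slope \<rho> v) (at x)"
    using d by (rule has_derivative_bounded_linear)
  have "((\<lambda>y. c * slope \<rho> v y) has_derivative (\<lambda>h. c * frechet_derivative (slope \<rho> v) (at x) h)) (at x)"
    using d by (rule has_derivative_mult_right)
  then have "(slope \<rho> (c *\<^sub>R v) has_derivative (\<lambda>h. c * frechet_derivative (slope \<rho> v) (at x) h)) (at x)"
    by (rule has_derivative_transform_within_open[OF _ U(1) x]) (simp add: slope_scale[OF ld])
  from frechet_derivative_at[OF this, symmetric] show ?thesis by (simp add: scaleR)
qed

text \<open>Everything the rest of the proof knows about the data. It does not say where on the line
  the second tangency lies, nor how curved the boundary is there.\<close>

definition tangents_transfer :: "(real^2) set \<Rightarrow> (real^2) set \<Rightarrow> bool" where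
  "tangents_transfer \<Omega>1 \<Omega>2 \<longleftrightarrow> (\<forall>\<theta>\<in>{-pi..pi}. \<forall>U \<rho> s0 t0. local_defining \<Omega>1 U \<rho> \<longrightarrow> pt \<theta> s0 t0 \<in> U \<longrightarrow>
     \<rho> (pt \<theta> s0 t0) = 0 \<longrightarrow> slope \<rho> (dir (\<theta> + pi / 2)) (pt \<theta> s0 t0) = 0 \<longrightarrow>
     slope (slope \<rho> (dir (\<theta> + pi / 2))) (dir (\<theta> + pi / 2)) (pt \<theta> s0 t0) \<noteq> 0 \<longrightarrow>
     (\<forall>t. tangent_dir \<Omega>1 (pt \<theta> s0 t) (dir (\<theta> + pi / 2)) \<longrightarrow> t = t0) \<longrightarrow>
     (\<exists>t. tangent_dir \<Omega>2 (pt \<theta> s0 t) (dir (\<theta> + pi / 2))))"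

text \<open>In \<open>tangents_transfer\<close> the frame turns with the line, whereas
  differentiation along the boundary needs one fixed frame. There a line is given by its slope
  \<open>m\<close> and its intercept \<open>s - m * t\<close>, and both tangencies share
  these.\<close>

lemma tangent_line_partner:
  assumes tr: "tangents_transfer \<Omega>1 \<Omega>2" and cl: "closed \<Omega>1" and sb: "smooth_boundary \<Omega>1"
    and ld: "local_defining \<Omega>1 U \<rho>" and P: "pt \<theta> s t \<in> U" "\<rho> (pt \<theta> s t) = 0"
    and tang: "slope \<rho> (pt \<theta> m 1) (pt \<theta> s t) = 0"
    and curv: "slope (slope \<rho> (pt \<theta> m 1)) (pt \<theta> m 1) (pt \<theta> s t) \<noteq> 0"
    and \<theta>': "\<theta>' \<in> {-pi..pi}" "pt \<theta> m 1 = norm (pt \<theta> m 1) *\<^sub>R dir (\<theta>' + pi / 2)" "\<theta>' \<notin> snd ` Upsilon \<Omega>1"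
  shows "\<exists>S T. tangent_dir \<Omega>2 (pt \<theta> S T) (pt \<theta> m 1) \<and> S - m * T = s - m * t"
proof -
  define e c where "e = dir (\<theta>' + pi / 2)" and "c = norm (pt \<theta> m 1)"
  have "pt \<theta> m 1 \<bullet> dir (\<theta> + pi / 2) = 1" by simp
  then have "pt \<theta> m 1 \<noteq> 0" by (metis inner_zero_left zero_neq_one)
  then have c: "c > 0" by (simp add: c_def)
  have v: "pt \<theta> m 1 = c *\<^sub>R e" using \<theta>'(2) by (simp add: e_def c_def)
  obtain s' t' where P': "pt \<theta> s t = pt \<theta>' s' t'" using pt_cases by blast
  have tang': "slope \<rho> e (pt \<theta>' s' t') = 0"
    using tang slope_scale[OF ld P(1), of c e] c unfolding v P' by simp
  have curv': "slope (slope \<rho> e) e (pt \<theta>' s' t') \<noteq> 0"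
    using curv slope_slope_scale[OF ld P(1), of c e] c unfolding v P' by simp
  have "(s', \<theta>') \<notin> Upsilon \<Omega>1" using \<theta>'(3) by force
  then have "\<forall>t. tangent_dir \<Omega>1 (pt \<theta>' s' t) e \<longrightarrow> t = t'"
    using curved_tangent_unique[OF cl sb ld, of \<theta>' s' t'] P tang' curv' \<theta>'(1) unfolding P' e_def by blast
  then obtain t'' where t'': "tangent_dir \<Omega>2 (pt \<theta>' s' t'') e"
    using tr ld P tang' curv' \<theta>'(1) unfolding tangents_transfer_def P' e_def by blast
  \<comment> \<open>The distance of the two tangencies along the common line, in units of
    \<open>pt \<theta> m 1\<close>: the second coordinate grows by \<open>k\<close>, the first by
    \<open>k * m\<close>.\<close>
  define k where "k = (t'' - t') / c"
  have "pt \<theta>' s' t'' = pt \<theta>' s' t' + (t'' - t') *\<^sub>R e" by (simp add: pt_def e_def algebra_simps)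
  also have "(t'' - t') *\<^sub>R e = k *\<^sub>R pt \<theta> m 1" using c by (simp add: v k_def)
  also have "pt \<theta>' s' t' + k *\<^sub>R pt \<theta> m 1 = pt \<theta> (s + k * m) (t + k)"
    unfolding P'[symmetric] by (simp add: pt_def algebra_simps)
  finally have Q: "pt \<theta>' s' t'' = pt \<theta> (s + k * m) (t + k)" .
  have "tangent_dir \<Omega>2 (pt \<theta> (s + k * m) (t + k)) (pt \<theta> m 1)"
    using t'' slope_scale[of \<Omega>2] unfolding tangent_dir_def Q v by fastforce
  then show ?thesis by (intro exI[of _ "s + k * m"] exI[of _ "t + k"]) (simp add: algebra_simps)
qed

lemma graph_box_open: "open {x. \<bar>x \<bullet> dir \<theta> - s0\<bar> < \<epsilon> \<and> \<bar>x \<bullet> dir (\<theta> + pi / 2) - t0\<bar> < \<delta>}"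
  by (intro open_Collect_conj open_Collect_less continuous_intros)

text \<open>By Sard's theorem almost every slope is attained only at points of nonzero curvature.\<close>
lemma countable_charts_critical_slopes:
  obtains N where "negligible N"
    "\<And>\<epsilon> \<delta> k k' k'' s0 t0. graph_chart S \<theta> s0 t0 \<epsilon> \<delta> k k' k'' \<Longrightarrow>
       \<exists>s1 t1 \<epsilon>1 \<delta>1 h h' h''. graph_chart S \<theta> s1 t1 \<epsilon>1 \<delta>1 h h' h'' \<and> \<bar>s0 - s1\<bar> < \<epsilon>1 \<and> \<bar>t0 - t1\<bar> < \<delta>1 \<and>
         h' ` {t. \<bar>t - t1\<bar> < \<delta>1 \<and> h'' t = 0} \<subseteq> N"
proof -
  define box where "box s0 t0 \<epsilon> \<delta> = {x. \<bar>x \<bullet> dir \<theta> - s0\<bar> < \<epsilon> \<and> \<bar>x \<bullet> dir (\<theta> + pi / 2) - t0\<bar> < \<delta>}" for s0 t0 \<epsilon> \<delta>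
  define good where "good B Z \<longleftrightarrow> (\<exists>s0 t0 \<epsilon> \<delta> k k' k''. graph_chart S \<theta> s0 t0 \<epsilon> \<delta> k k' k'' \<and> B = box s0 t0 \<epsilon> \<delta> \<and>
    Z = k' ` {t. \<bar>t - t0\<bar> < \<delta> \<and> k'' t = 0})" for B Z
  define \<F> where "\<F> = {B. \<exists>Z. good B Z}"
  have "open B" if "B \<in> \<F>" for B
    using that graph_box_open by (auto simp: \<F>_def good_def box_def)
  \<comment> \<open>All charts together would give uncountably many null sets. Countably many boxes
    cover the same points, so around each point a chart of the countable family is
    available.\<close>
  then obtain \<F>' where \<F>': "\<F>' \<subseteq> \<F>" "countable \<F>'" "\<Union>\<F>' = \<Union>\<F>"
    by (rule Lindelof)
  define Z where "Z B = (SOME Z. good B Z)" for B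
  have Z: "good B (Z B)" if "B \<in> \<F>" for B
    using that someI_ex[of "good B"] unfolding \<F>_def Z_def by blast
  define N where "N = \<Union>(Z ` \<F>')"
  show thesis
  proof (rule that[of N])
    show "negligible N"
      unfolding N_def
    proof (rule negligible_countable_Union)
      fix A assume "A \<in> Z ` \<F>'"
      then obtain B where "good B A" using Z \<F>'(1) by blast
      then obtain s0 t0 \<epsilon> \<delta> k k' k'' where ch: "graph_chart S \<theta> s0 t0 \<epsilon> \<delta> k k' k''"
        and A: "A = k' ` {t. \<bar>t - t0\<bar> < \<delta> \<and> k'' t = 0}"
        unfolding good_def by blast
      show "negligible A"
        unfolding A by (rule negligible_critical_values) (use graph_chartD(5)[OF ch] in force)
    qed (use \<F>'(2) in simp)
    fix \<epsilon> \<delta> k k' k'' s0 t0 assume ch: "graph_chart S \<theta> s0 t0 \<epsilon> \<delta> k k' k''"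
    have "box s0 t0 \<epsilon> \<delta> \<in> \<F>" unfolding \<F>_def good_def using ch by blast
    moreover have "pt \<theta> s0 t0 \<in> box s0 t0 \<epsilon> \<delta>" using graph_chartD(1,2)[OF ch] by (simp add: box_def)
    ultimately obtain B where B: "B \<in> \<F>'" "pt \<theta> s0 t0 \<in> B" using \<F>'(3) by blast
    then have "good B (Z B)" using Z \<F>'(1) by blast
    then obtain s1 t1 \<epsilon>1 \<delta>1 h h' h'' where c: "graph_chart S \<theta> s1 t1 \<epsilon>1 \<delta>1 h h' h''" "B = box s1 t1 \<epsilon>1 \<delta>1"
      "Z B = h' ` {t. \<bar>t - t1\<bar> < \<delta>1 \<and> h'' t = 0}"
      unfolding good_def by blast
    have "\<bar>s0 - s1\<bar> < \<epsilon>1" "\<bar>t0 - t1\<bar> < \<delta>1" using B(2) c(2) by (simp_all add: box_def)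
    moreover have "h' ` {t. \<bar>t - t1\<bar> < \<delta>1 \<and> h'' t = 0} \<subseteq> N" using B(1) c(3) by (auto simp: N_def)
    ultimately show "\<exists>s1 t1 \<epsilon>1 \<delta>1 h h' h''. graph_chart S \<theta> s1 t1 \<epsilon>1 \<delta>1 h h' h'' \<and> \<bar>s0 - s1\<bar> < \<epsilon>1 \<and> \<bar>t0 - t1\<bar> < \<delta>1 \<and>
         h' ` {t. \<bar>t - t1\<bar> < \<delta>1 \<and> h'' t = 0} \<subseteq> N" using c(1) by blast
  qed
qed

text \<open>Distinct parameters have distinct slopes, and distinct slopes have distinct angles, so
  each exceptional angle costs at most one parameter.\<close>

lemma finite_bad_parameters:
  assumes inj: "inj_on g' J" and fin: "finite A"
    and ang: "\<And>m. ang m \<in> {-pi..pi} \<and> pt \<theta> m 1 = norm (pt \<theta> m 1) *\<^sub>R dir (ang m + pi / 2)"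
  shows "finite {t\<in>J. ang (g' t) \<in> A}"
proof -
  have inj_ang: "m = n" if "ang m = ang n" for m n
  proof -
    define d where "d = dir (ang m + pi / 2)"
    have v: "pt \<theta> m 1 = norm (pt \<theta> m 1) *\<^sub>R d" "pt \<theta> n 1 = norm (pt \<theta> n 1) *\<^sub>R d"
      using ang[of m] ang[of n] unfolding d_def that by blast+
    have "1 = norm (pt \<theta> m 1) * (d \<bullet> dir (\<theta> + pi / 2))" "1 = norm (pt \<theta> n 1) * (d \<bullet> dir (\<theta> + pi / 2))"
      by (metis v(1) inner_scaleR_left pt_inner(2)) (metis v(2) inner_scaleR_left pt_inner(2))
    then have "norm (pt \<theta> m 1) = norm (pt \<theta> n 1)" by (metis mult_right_cancel mult_zero_right zero_neq_one)
    then have "pt \<theta> m 1 = pt \<theta> n 1" using v by metis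
    then show ?thesis by simp
  qed
  show ?thesis
  proof (rule finite_imageD)
    show "finite ((\<lambda>t. ang (g' t)) ` {t\<in>J. ang (g' t) \<in> A})" by (rule finite_subset[OF _ fin]) auto
    show "inj_on (\<lambda>t. ang (g' t)) {t\<in>J. ang (g' t) \<in> A}"
      using inj inj_ang by (auto simp: inj_on_def)
  qed
qed

text \<open>The tangencies with \<open>\<Omega>2\<close> are chosen line by line, without
  continuity, and a convergent subsequence takes its place. The limit \<open>q\<close> lies on the
  tangent line at \<open>t0\<close> and has its slope. Since this slope is regular for
  \<open>\<Omega>2\<close>, the chart at \<open>q\<close> has nonzero second derivative, and the
  intercept quotients of both curves can be compared along one sequence of lines.\<close>

lemma curved_points_transfer:
  assumes tr: "tangents_transfer \<Omega>1 \<Omega>2" and cl1: "closed \<Omega>1" and sb1: "smooth_boundary \<Omega>1" and fin: "finite (Upsilon \<Omega>1)"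
    and comp2: "compact \<Omega>2" and sb2: "smooth_boundary \<Omega>2"
    and ld: "local_defining \<Omega>1 U \<rho>" and ch: "graph_chart (frontier \<Omega>1) \<theta> sc tc \<epsilon> \<delta> g g' g''"
    and gU: "\<And>t. \<bar>t - tc\<bar> < \<delta> \<Longrightarrow> pt \<theta> (g t) t \<in> U"
    and gR: "\<And>t. \<bar>t - tc\<bar> < \<delta> \<Longrightarrow> slope \<rho> (dir \<theta>) (pt \<theta> (g t) t) \<noteq> 0"
    and gt: "\<And>t. \<bar>t - tc\<bar> < \<delta> \<Longrightarrow> slope \<rho> (pt \<theta> (g' t) 1) (pt \<theta> (g t) t) = 0"
    and gc: "\<And>t. \<bar>t - tc\<bar> < \<delta> \<Longrightarrow> slope (slope \<rho> (pt \<theta> (g' t) 1)) (pt \<theta> (g' t) 1) (pt \<theta> (g t) t) =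
       - slope \<rho> (dir \<theta>) (pt \<theta> (g t) t) * g'' t"
    and tb: "\<bar>tb - tc\<bar> < \<delta>" "g'' tb \<noteq> 0"
  shows "pt \<theta> (g tb) tb \<in> frontier \<Omega>2"
proof (rule ccontr)
  assume bad: "pt \<theta> (g tb) tb \<notin> frontier \<Omega>2"
  note C = graph_chartD[OF ch]
  have cl2: "closed \<Omega>2" using comp2 by (rule compact_imp_closed)
  have gcont: "isCont g t" "isCont g' t" if "\<bar>t - tc\<bar> < \<delta>" for t
    using C(4,5)[OF that] DERIV_isCont by blast+
  \<comment> \<open>A whole neighbourhood of \<open>tb\<close> consists of curved points off
    \<open>frontier \<Omega>2\<close>, which leaves room to choose \<open>t0\<close> away from the
    exceptional values.\<close>
  obtain r where r: "r > 0" "\<And>t. \<bar>t - tb\<bar> < r \<Longrightarrow> \<bar>t - tc\<bar> < \<delta> \<and> g'' t \<noteq> 0 \<and> pt \<theta> (g t) t \<notin> frontier \<Omega>2"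
  proof -
    have 1: "\<forall>\<^sub>F t in nhds tb. \<bar>t - tc\<bar> < \<delta>"
    proof -
      have "\<forall>\<^sub>F x in nhds tb. x \<in> {tc - \<delta><..<tc + \<delta>}"
        using tb(1) by (intro eventually_nhds_in_open) (auto simp: abs_less_iff)
      then show ?thesis by eventually_elim auto
    qed
    have "(g'' \<longlongrightarrow> g'' tb) (nhds tb)"
      using C(6)[OF tb(1)] by (simp add: continuous_at tendsto_at_iff_tendsto_nhds)
    then have 2: "\<forall>\<^sub>F t in nhds tb. g'' t \<noteq> 0" using tb(2) by (rule tendsto_imp_eventually_ne)
    have "(g \<longlongrightarrow> g tb) (nhds tb)"
      using gcont(1)[OF tb(1)] by (simp add: continuous_at tendsto_at_iff_tendsto_nhds)
    then have "((\<lambda>t. pt \<theta> (g t) t) \<longlongrightarrow> pt \<theta> (g tb) tb) (nhds tb)" by (intro tendsto_pt filterlim_ident)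
    moreover have "open (- frontier \<Omega>2)" by auto
    ultimately have 3: "\<forall>\<^sub>F t in nhds tb. pt \<theta> (g t) t \<in> - frontier \<Omega>2"
      using bad by (intro topological_tendstoD) auto
    have "\<forall>\<^sub>F t in nhds tb. \<bar>t - tc\<bar> < \<delta> \<and> g'' t \<noteq> 0 \<and> pt \<theta> (g t) t \<notin> frontier \<Omega>2"
      using 1 2 3 by eventually_elim auto
    then show thesis using that by (auto simp: eventually_nhds_metric dist_real_def)
  qed
  define J where "J = {tb - r<..<tb + r}"
  have J: "t \<in> J \<longleftrightarrow> \<bar>t - tb\<bar> < r" for t by (auto simp: J_def)
  have inj: "inj_on g' J"
  proof -
    have "g' x \<noteq> g' y" if "x \<in> J" "y \<in> J" "x < y" for x y
    proof
      assume eq: "g' x = g' y"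
      have "(g' has_real_derivative g'' z) (at z)" if "x \<le> z" "z \<le> y" for z
        using that \<open>x \<in> J\<close> \<open>y \<in> J\<close> r(2)[of z] by (intro C(5)) (auto simp: J_def)
      then obtain z where z: "x < z" "z < y" "g' y - g' x = (y - x) * g'' z"
        using MVT2[OF \<open>x < y\<close>, of g' g''] by blast
      then have "g'' z = 0" using eq by simp
      moreover have "\<bar>z - tb\<bar> < r" using z that by (auto simp: J_def)
      ultimately show False using r(2) by blast
    qed
    then show ?thesis by (metis inj_onI linorder_neqE)
  qed
  have "\<exists>\<theta>'. \<theta>' \<in> {-pi..pi} \<and> pt \<theta> m 1 = norm (pt \<theta> m 1) *\<^sub>R dir (\<theta>' + pi / 2)" for m
  proof -
    have "pt \<theta> m 1 \<bullet> dir (\<theta> + pi / 2) = 1" by simp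
    then have "pt \<theta> m 1 \<noteq> 0" by (metis inner_zero_left zero_neq_one)
    from unit_tangent_angle[OF this] show ?thesis by blast
  qed
  then obtain ang where ang: "\<And>m. ang m \<in> {-pi..pi} \<and> pt \<theta> m 1 = norm (pt \<theta> m 1) *\<^sub>R dir (ang m + pi / 2)"
    by metis
  define F where "F = {t\<in>J. ang (g' t) \<in> snd ` Upsilon \<Omega>1}"
  have finF: "finite F" unfolding F_def using inj fin ang by (intro finite_bad_parameters) auto
  obtain N where N: "negligible N"
    "\<And>\<epsilon> \<delta> k k' k'' s0 t0. graph_chart (frontier \<Omega>2) \<theta> s0 t0 \<epsilon> \<delta> k k' k'' \<Longrightarrow>
       \<exists>s1 t1 \<epsilon>1 \<delta>1 h h' h''. graph_chart (frontier \<Omega>2) \<theta> s1 t1 \<epsilon>1 \<delta>1 h h' h'' \<and> \<bar>s0 - s1\<bar> < \<epsilon>1 \<and> \<bar>t0 - t1\<bar> < \<delta>1 \<and>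
         h' ` {t. \<bar>t - t1\<bar> < \<delta>1 \<and> h'' t = 0} \<subseteq> N"
    by (rule countable_charts_critical_slopes) blast
  obtain t0 where t0: "t0 \<in> J" "t0 \<notin> F" "g' t0 \<notin> N"
  proof (rule ccontr)
    assume "\<not> thesis"
    then have "g' ` J \<subseteq> N \<union> g' ` F" using that by blast
    moreover have "negligible (N \<union> g' ` F)"
      by (rule negligible_Un[OF N(1) negligible_finite[OF finite_imageI[OF finF]]])
    ultimately have neg: "negligible (g' ` J)" by (rule negligible_subset[rotated])
    \<comment> \<open>A continuous injective function on an interval has an image that contains a
      nondegenerate interval, hence is not negligible.\<close>
    have "continuous_on J g'" using r(2) J gcont(2) by (intro continuous_at_imp_continuous_on) auto
    then have con: "connected (g' ` J)" by (rule connected_continuous_image) (simp add: J_def)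
    have ab: "tb \<in> J" "tb + r / 2 \<in> J" "tb \<noteq> tb + r / 2" using r(1) by (auto simp: J_def)
    then have ne: "g' tb \<noteq> g' (tb + r / 2)" using inj by (metis inj_onD)
    define a b where "a = min (g' tb) (g' (tb + r / 2))" and "b = max (g' tb) (g' (tb + r / 2))"
    have "a < b" "a \<in> g' ` J" "b \<in> g' ` J" using ab ne by (auto simp: a_def b_def min_def max_def)
    then have "{a..b} \<subseteq> g' ` J" using con by (intro connected_contains_Icc)
    then have "negligible {a..b}" by (rule negligible_subset[OF neg])
    then show False using \<open>a < b\<close> negligible_interval(1)[of a b] by simp
  qed
  obtain d1 where d1: "d1 > 0" "\<And>x. x \<in> F \<Longrightarrow> d1 \<le> dist t0 x"
    using finite_set_avoid[OF finF, of t0] t0(2) by metis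
  define d where "d = min d1 (r - \<bar>t0 - tb\<bar>)"
  have d: "d > 0" using d1(1) t0(1) J by (simp add: d_def)
  \<comment> \<open>All terms differ from \<open>t0\<close> by less than \<open>d\<close>, so they
    lie in \<open>J\<close> and outside \<open>F\<close>; the 2 in the denominator makes the bound
    strict already for n = 0.\<close>
  define X where "X n = t0 + d / (real n + 2)" for n
  have Xd: "0 < X n - t0" "X n - t0 < d" for n
  proof -
    show "0 < X n - t0" using d by (simp add: X_def)
    have "d * 1 < d * (real n + 2)" using d by (intro mult_strict_left_mono) auto
    then show "X n - t0 < d" by (simp add: X_def divide_less_eq)
  qed
  have XJ: "X n \<in> J" for n
  proof -
    have "\<bar>X n - tb\<bar> \<le> \<bar>X n - t0\<bar> + \<bar>t0 - tb\<bar>" by linarith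
    also have "\<dots> < r" using Xd[of n] by (simp add: d_def)
    finally show ?thesis by (simp add: J)
  qed
  have XF: "X n \<notin> F" for n
    using d1(2)[of "X n"] Xd[of n] by (auto simp: dist_real_def d_def)
  have Xlim: "X \<longlonglongrightarrow> t0"
  proof -
    have "(\<lambda>n. t0 + d / real (n + 2)) \<longlonglongrightarrow> t0 + 0"
      by (intro tendsto_intros LIMSEQ_ignore_initial_segment[OF lim_const_over_n])
    then show ?thesis by (simp add: X_def[abs_def] add.commute)
  qed
  have "\<exists>S T. tangent_dir \<Omega>2 (pt \<theta> S T) (pt \<theta> (g' t) 1) \<and> S - g' t * T = g t - g' t * t" if t: "t \<in> J" "t \<notin> F" for t
  proof -
    have t': "\<bar>t - tc\<bar> < \<delta>" "g'' t \<noteq> 0" using t(1) r(2) J by auto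
    have "pt \<theta> (g t) t \<in> frontier \<Omega>1" using C(3,7) t'(1) by blast
    then have "\<rho> (pt \<theta> (g t) t) = 0" using frontier_local_defining[OF ld cl1 gU[OF t'(1)]] by simp
    moreover have "slope (slope \<rho> (pt \<theta> (g' t) 1)) (pt \<theta> (g' t) 1) (pt \<theta> (g t) t) \<noteq> 0"
      using gc[OF t'(1)] gR[OF t'(1)] t'(2) by simp
    moreover have "ang (g' t) \<notin> snd ` Upsilon \<Omega>1" using t by (auto simp: F_def)
    ultimately show ?thesis
      using tangent_line_partner[OF tr cl1 sb1 ld gU[OF t'(1)] _ gt[OF t'(1)], of "ang (g' t)"] ang by blast
  qed
  then have "\<forall>n. \<exists>S T. tangent_dir \<Omega>2 (pt \<theta> S T) (pt \<theta> (g' (X n)) 1) \<and> S - g' (X n) * T = g (X n) - g' (X n) * X n"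
    using XJ XF by blast
  then obtain S T where ST: "\<And>n. tangent_dir \<Omega>2 (pt \<theta> (S n) (T n)) (pt \<theta> (g' (X n)) 1)"
    "\<And>n. S n - g' (X n) * T n = g (X n) - g' (X n) * X n" by metis
  have "seq_compact (frontier \<Omega>2)"
    using compact_frontier[OF comp2] compact_eq_seq_compact_metric by blast
  moreover have "\<forall>n. pt \<theta> (S n) (T n) \<in> frontier \<Omega>2" using ST(1) by (simp add: tangent_dir_def)
  ultimately obtain q \<phi> where q: "q \<in> frontier \<Omega>2" "strict_mono (\<phi> :: nat \<Rightarrow> nat)"
    "((\<lambda>n. pt \<theta> (S n) (T n)) \<circ> \<phi>) \<longlonglongrightarrow> q"
    by (rule seq_compactE)
  define Sq Tq where "Sq = q \<bullet> dir \<theta>" and "Tq = q \<bullet> dir (\<theta> + pi / 2)"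
  have qeq: "q = pt \<theta> Sq Tq" by (simp add: Sq_def Tq_def pt_inner_eq)
  define Y S' T' where "Y n = X (\<phi> n)" and "S' n = S (\<phi> n)" and "T' n = T (\<phi> n)" for n
  have Q': "(\<lambda>n. pt \<theta> (S' n) (T' n)) \<longlonglongrightarrow> q" using q(3) by (simp add: S'_def T'_def o_def)
  have SL: "S' \<longlonglongrightarrow> Sq"
    using tendsto_inner[OF Q' tendsto_const[of "dir \<theta>"]] by (simp add: Sq_def)
  have TL: "T' \<longlonglongrightarrow> Tq"
    using tendsto_inner[OF Q' tendsto_const[of "dir (\<theta> + pi / 2)"]] by (simp add: Tq_def)
  have YL: "Y \<longlonglongrightarrow> t0" using LIMSEQ_subseq_LIMSEQ[OF Xlim q(2)] by (simp add: Y_def[abs_def] o_def)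
  have YJ: "Y n \<in> J" "Y n \<noteq> t0" for n using XJ Xd(1)[of "\<phi> n"] by (auto simp: Y_def)
  have t0c: "\<bar>t0 - tc\<bar> < \<delta>" using t0(1) r(2) J by auto
  have gYL: "(\<lambda>n. g (Y n)) \<longlonglongrightarrow> g t0" "(\<lambda>n. g' (Y n)) \<longlonglongrightarrow> g' t0"
    using isCont_tendsto_compose[OF gcont(1)[OF t0c] YL] isCont_tendsto_compose[OF gcont(2)[OF t0c] YL] .
  have td: "tangent_dir \<Omega>2 (pt \<theta> (S' n) (T' n)) (pt \<theta> (g' (Y n)) 1)" for n
    using ST(1) by (simp add: S'_def T'_def Y_def)
  have line: "S' n - g' (Y n) * T' n = g (Y n) - g' (Y n) * Y n" for n
    using ST(2) by (simp add: S'_def T'_def Y_def)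
  have lineq: "Sq - g' t0 * Tq = g t0 - g' t0 * t0"
  proof (rule LIMSEQ_unique)
    show "(\<lambda>n. S' n - g' (Y n) * T' n) \<longlonglongrightarrow> Sq - g' t0 * Tq" by (intro tendsto_intros SL TL gYL)
    show "(\<lambda>n. S' n - g' (Y n) * T' n) \<longlonglongrightarrow> g t0 - g' t0 * t0" unfolding line by (intro tendsto_intros YL gYL)
  qed
  obtain U2 \<rho>2 where ld2: "local_defining \<Omega>2 U2 \<rho>2" and qU: "q \<in> U2" using smooth_boundaryE[OF sb2 q(1)] .
  note U2 = local_definingD[OF ld2]
  have evU: "\<forall>\<^sub>F n in sequentially. pt \<theta> (S' n) (T' n) \<in> U2" using Q' U2(1) qU by (rule topological_tendstoD)
  \<comment> \<open>Tangency is a closed condition: the slopes, the points and the derivatives of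
    \<open>\<rho>2\<close> all converge.\<close>
  have "g' t0 * slope \<rho>2 (dir \<theta>) q + slope \<rho>2 (dir (\<theta> + pi / 2)) q = 0"
  proof (rule LIMSEQ_unique)
    have "isCont (slope \<rho>2 v) q" for v
      using smooth_on_continuous_on[OF smooth_on_frechet[OF U2(2)]] U2(1) qU by (simp add: continuous_on_eq_continuous_at)
    then show "(\<lambda>n. g' (Y n) * slope \<rho>2 (dir \<theta>) (pt \<theta> (S' n) (T' n)) + slope \<rho>2 (dir (\<theta> + pi / 2)) (pt \<theta> (S' n) (T' n)))
        \<longlonglongrightarrow> g' t0 * slope \<rho>2 (dir \<theta>) q + slope \<rho>2 (dir (\<theta> + pi / 2)) q"
      by (intro tendsto_intros gYL isCont_tendsto_compose[OF _ Q'])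
    have "\<forall>\<^sub>F n in sequentially. 0 = g' (Y n) * slope \<rho>2 (dir \<theta>) (pt \<theta> (S' n) (T' n)) + slope \<rho>2 (dir (\<theta> + pi / 2)) (pt \<theta> (S' n) (T' n))"
      using evU
    proof eventually_elim
      case (elim n)
      have "slope \<rho>2 (pt \<theta> (g' (Y n)) 1) (pt \<theta> (S' n) (T' n)) = 0" using td[of n] ld2 elim by (auto simp: tangent_dir_def)
      then show ?case using slope_pt[OF ld2 elim] by simp
    qed
    then show "(\<lambda>n. g' (Y n) * slope \<rho>2 (dir \<theta>) (pt \<theta> (S' n) (T' n)) + slope \<rho>2 (dir (\<theta> + pi / 2)) (pt \<theta> (S' n) (T' n))) \<longlonglongrightarrow> 0"
      by (rule Lim_transform_eventually[OF tendsto_const])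
  qed
  \<comment> \<open>The tangent at \<open>q\<close> has finite slope in the frame \<theta>, so the
    second boundary is a graph over the same axis.\<close>
  then have nzq: "slope \<rho>2 (dir \<theta>) (pt \<theta> Sq Tq) \<noteq> 0"
    using slope_dir_nonzero[OF ld2 qU, of \<theta>] qeq by auto
  obtain \<epsilon>' \<delta>' k0 k0' k0'' where "graph_chart (frontier \<Omega>2) \<theta> Sq Tq \<epsilon>' \<delta>' k0 k0' k0''"
    using exists_graph_chart[OF ld2 cl2 _ _ nzq] qU q(1) qeq by metis
  \<comment> \<open>The chart centred at \<open>q\<close> is exchanged for one of the countable
    family, whose critical slopes lie in \<open>N\<close>; its centre may differ from
    \<open>q\<close>.\<close>
  from N(2)[OF this] obtain s1 t1 \<epsilon>1 \<delta>1 k k' k'' where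
    ch2: "graph_chart (frontier \<Omega>2) \<theta> s1 t1 \<epsilon>1 \<delta>1 k k' k''" and inb: "\<bar>Sq - s1\<bar> < \<epsilon>1" "\<bar>Tq - t1\<bar> < \<delta>1"
    and crit: "k' ` {t. \<bar>t - t1\<bar> < \<delta>1 \<and> k'' t = 0} \<subseteq> N" by blast
  note C2 = graph_chartD[OF ch2]
  have Sk: "Sq = k Tq" using C2(7)[OF inb] q(1) qeq by simp
  have kc: "isCont k' Tq" using C2(5)[OF inb(2)] by (rule DERIV_isCont)
  have "\<forall>\<^sub>F n in sequentially. \<bar>S' n - s1\<bar> < \<epsilon>1 \<and> \<bar>T' n - t1\<bar> < \<delta>1"
    using order_tendstoD(2)[OF tendsto_rabs[OF tendsto_diff[OF SL tendsto_const]] inb(1)]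
      order_tendstoD(2)[OF tendsto_rabs[OF tendsto_diff[OF TL tendsto_const]] inb(2)]
    by (rule eventually_conj)
  then obtain n0 where n0: "\<And>n. n \<ge> n0 \<Longrightarrow> \<bar>S' n - s1\<bar> < \<epsilon>1 \<and> \<bar>T' n - t1\<bar> < \<delta>1"
    by (auto simp: eventually_sequentially)
  have Sk': "S' n = k (T' n)" "k' (T' n) = g' (Y n)" if "n \<ge> n0" for n
  proof -
    show 1: "S' n = k (T' n)" using C2(7)[of "S' n" "T' n"] n0[OF that] td[of n] by (simp add: tangent_dir_def)
    show "k' (T' n) = g' (Y n)"
      using chart_tangent_slope[OF cl2 sb2 ch2, of "T' n"] n0[OF that] td[of n] unfolding 1 by blast
  qed
  have k't: "k' Tq = g' t0"
  proof (rule LIMSEQ_unique)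
    show "(\<lambda>n. k' (T' n)) \<longlonglongrightarrow> k' Tq" by (rule isCont_tendsto_compose[OF kc TL])
    have "\<forall>\<^sub>F n in sequentially. g' (Y n) = k' (T' n)" using Sk'(2) by (intro eventually_sequentiallyI[of n0]) simp
    then show "(\<lambda>n. k' (T' n)) \<longlonglongrightarrow> g' t0" by (rule Lim_transform_eventually[OF gYL(2)])
  qed
  have k''nz: "k'' Tq \<noteq> 0"
  proof
    assume "k'' Tq = 0"
    then have "k' Tq \<in> k' ` {t. \<bar>t - t1\<bar> < \<delta>1 \<and> k'' t = 0}" using inb(2) by (intro imageI) simp
    then show False using crit k't t0(3) by (metis subsetD)
  qed
  define Y1 T1 where "Y1 n = Y (n + n0)" and "T1 n = T' (n + n0)" for n
  have Y1: "Y1 \<longlonglongrightarrow> t0" "\<And>n. Y1 n \<noteq> t0"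
    using LIMSEQ_ignore_initial_segment[OF YL, of n0] YJ(2) by (auto simp: Y1_def[abs_def])
  have T1: "T1 \<longlonglongrightarrow> Tq"
    using LIMSEQ_ignore_initial_segment[OF TL, of n0] by (simp add: T1_def[abs_def])
  \<comment> \<open>Equal parameters on the second boundary would give equal slopes, against the
    injectivity of \<open>g'\<close> on \<open>J\<close>. So the quotients for the second curve have
    nonzero increments of the parameter as well.\<close>
  have T1ne: "T1 n \<noteq> Tq" for n
  proof
    assume "T1 n = Tq"
    then have "g' (Y1 n) = g' t0" using Sk'(2)[of "n + n0"] k't by (simp add: T1_def Y1_def)
    then show False using inj YJ(1) t0(1) Y1(2)[of n] by (auto simp: inj_on_def Y1_def)
  qed
  have "g'' t0 \<noteq> 0" using t0(1) r(2) J by auto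
  note L1 = intercept_quotient_tendsto[OF C(4)[OF t0c] C(5)[OF t0c] this Y1]
  note L2 = intercept_quotient_tendsto[OF C2(4)[OF inb(2)] C2(5)[OF inb(2)] k''nz T1 T1ne]
  have "k (T1 n) - T1 n * k' (T1 n) = g (Y1 n) - Y1 n * g' (Y1 n)" for n
    using line[of "n + n0"] Sk'[of "n + n0"] by (simp add: T1_def Y1_def algebra_simps)
  moreover have "k Tq - Tq * k' Tq = g t0 - t0 * g' t0" using lineq k't Sk by (simp add: algebra_simps)
  moreover have "k' (T1 n) = g' (Y1 n)" for n using Sk'(2)[of "n + n0"] by (simp add: T1_def Y1_def)
  ultimately have "(\<lambda>n. ((g (Y1 n) - Y1 n * g' (Y1 n)) - (g t0 - t0 * g' t0)) / (g' (Y1 n) - g' t0)) \<longlonglongrightarrow> - Tq"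
    using L2 k't by simp
  \<comment> \<open>Equal slopes and intercepts give equal quotients, so the limits - t0 and - Tq
    agree; the common tangent line then makes the first coordinates agree too.\<close>
  from LIMSEQ_unique[OF L1 this] have "Tq = t0" by simp
  then have "q = pt \<theta> (g t0) t0" using lineq qeq by simp
  then show False using q(1) t0(1) r(2) J by auto
qed


section \<open>Coincidence of the boundaries, locally and globally\<close>

lemma transfer_chart:
  assumes tr: "tangents_transfer \<Omega>1 \<Omega>2" and adm: "admissible \<Omega>1 u1" "admissible \<Omega>2 u2"
    and ld: "local_defining \<Omega>1 U \<rho>" and p: "pt \<theta> s0 t0 \<in> U" "pt \<theta> s0 t0 \<in> frontier \<Omega>1"
    and nz: "slope \<rho> (dir \<theta>) (pt \<theta> s0 t0) \<noteq> 0"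
  obtains \<epsilon> \<delta> g g' g'' where "graph_chart (frontier \<Omega>1) \<theta> s0 t0 \<epsilon> \<delta> g g' g''"
    "\<And>t. \<bar>t - t0\<bar> < \<delta> \<Longrightarrow> g'' t \<noteq> 0 \<Longrightarrow> pt \<theta> (g t) t \<in> frontier \<Omega>2"
proof -
  note a1 = admissibleD[OF adm(1)] and a2 = admissibleD[OF adm(2)]
  obtain \<epsilon> \<delta> g g' g'' where ch: "graph_chart (frontier \<Omega>1) \<theta> s0 t0 \<epsilon> \<delta> g g' g''"
    "\<And>t. \<bar>t - t0\<bar> < \<delta> \<Longrightarrow> pt \<theta> (g t) t \<in> U"
    "\<And>t. \<bar>t - t0\<bar> < \<delta> \<Longrightarrow> slope \<rho> (dir \<theta>) (pt \<theta> (g t) t) \<noteq> 0"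
    "\<And>t. \<bar>t - t0\<bar> < \<delta> \<Longrightarrow> slope \<rho> (pt \<theta> (g' t) 1) (pt \<theta> (g t) t) = 0"
    "\<And>t. \<bar>t - t0\<bar> < \<delta> \<Longrightarrow> slope (slope \<rho> (pt \<theta> (g' t) 1)) (pt \<theta> (g' t) 1) (pt \<theta> (g t) t) =
       - slope \<rho> (dir \<theta>) (pt \<theta> (g t) t) * g'' t"
    by (rule exists_graph_chart[OF ld a1(2) p nz]) blast
  show thesis
    by (rule that[OF ch(1)])
       (rule curved_points_transfer[OF tr a1(2,4,7) a2(1,4) ld ch])
qed

text \<open>Three directions suffice: if neither axis is transversal to both boundaries, the two
  differentials vanish on different axes, and then both are nonzero on the diagonal.\<close>

lemma common_frame:
  assumes ld: "local_defining \<Omega>1 U1 \<rho>1" "local_defining \<Omega>2 U2 \<rho>2" and p: "p \<in> U1" "p \<in> U2"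
  shows "\<exists>\<theta>. slope \<rho>1 (dir \<theta>) p \<noteq> 0 \<and> slope \<rho>2 (dir \<theta>) p \<noteq> 0"
proof -
  let ?a = "\<lambda>\<rho>. slope \<rho> (dir 0) p" and ?b = "\<lambda>\<rho>. slope \<rho> (dir (0 + pi / 2)) p"
  have ab: "?a \<rho>1 \<noteq> 0 \<or> ?b \<rho>1 \<noteq> 0" "?a \<rho>2 \<noteq> 0 \<or> ?b \<rho>2 \<noteq> 0"
    using slope_dir_nonzero[OF ld(1) p(1), of 0] slope_dir_nonzero[OF ld(2) p(2), of 0] by blast+
  define c where "c = cos (pi / 4)"
  have c: "c \<noteq> 0" by (simp add: c_def cos_45)
  have "dir (pi / 4) = pt 0 c c" by (simp add: vec_eq_iff forall_2 pt_def c_def cos_45 sin_45)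
  then have d: "slope \<rho>1 (dir (pi / 4)) p = c * (?a \<rho>1 + ?b \<rho>1)" "slope \<rho>2 (dir (pi / 4)) p = c * (?a \<rho>2 + ?b \<rho>2)"
    using slope_pt[OF ld(1) p(1), of 0 c c] slope_pt[OF ld(2) p(2), of 0 c c] by (simp_all add: algebra_simps)
  consider "?a \<rho>1 \<noteq> 0" "?a \<rho>2 \<noteq> 0" | "?b \<rho>1 \<noteq> 0" "?b \<rho>2 \<noteq> 0"
    | "?a \<rho>1 + ?b \<rho>1 \<noteq> 0" "?a \<rho>2 + ?b \<rho>2 \<noteq> 0"
    using ab by force
  then show ?thesis
  proof cases
    case 3
    then show ?thesis using c d by (intro exI[of _ "pi / 4"]) simp
  qed blast+
qed

lemma graph_chart_islimpt:
  assumes ch: "graph_chart S \<theta> s0 t0 \<epsilon> \<delta> g g' g''" and p: "pt \<theta> s0 t0 \<in> S"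
    and sub: "r > 0" "\<And>t. \<bar>t - t0\<bar> < r \<Longrightarrow> pt \<theta> (g t) t \<in> A"
  shows "pt \<theta> s0 t0 islimpt A"
  unfolding islimpt_def
proof (intro allI impI)
  fix W assume W: "pt \<theta> s0 t0 \<in> W" "open W"
  note C = graph_chartD[OF ch]
  have g0: "g t0 = s0" using C(7)[of s0 t0] C(1,2) p by simp
  have "isCont g t0" using C(4)[of t0] C(2) DERIV_isCont by simp
  then have "((\<lambda>t. pt \<theta> (g t) t) \<longlongrightarrow> pt \<theta> (g t0) t0) (at t0)" unfolding continuous_at by (intro tendsto_intros)
  then have "\<forall>\<^sub>F t in at t0. pt \<theta> (g t) t \<in> W" using W g0 by (intro topological_tendstoD) auto
  moreover have "\<forall>\<^sub>F t in at t0. \<bar>t - t0\<bar> < r" using sub(1) by (auto simp: eventually_at dist_real_def)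
  moreover have "\<forall>\<^sub>F t in at t0. t \<noteq> t0" by (simp add: eventually_at_filter)
  ultimately have "\<forall>\<^sub>F t in at t0. pt \<theta> (g t) t \<in> W \<and> \<bar>t - t0\<bar> < r \<and> t \<noteq> t0" by eventually_elim blast
  from eventually_happens'[OF at_neq_bot this]
  obtain t where "pt \<theta> (g t) t \<in> W" "\<bar>t - t0\<bar> < r" "t \<noteq> t0" by blast
  then show "\<exists>y\<in>A. y \<in> W \<and> y \<noteq> pt \<theta> s0 t0" using sub(2) by (intro bexI[of _ "pt \<theta> (g t) t"]) auto
qed

text \<open>Where the second derivatives differ, one of them is nonzero, so the point of that graph
  lies on the other boundary and the functions agree. This set is open, so the second derivatives
  would agree on it as well; it is therefore empty, flat parts included, and the difference is
  affine. It vanishes at \<open>t0\<close> and at a second common point nearby, which is what the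
  accumulation point provides.\<close>

lemma graphs_coincide:
  assumes ch1: "graph_chart S1 \<theta> s0 t0 \<epsilon>1 \<delta>1 g1 g1' g1''" and tr1: "\<And>t. \<bar>t - t0\<bar> < \<delta>1 \<Longrightarrow> g1'' t \<noteq> 0 \<Longrightarrow> pt \<theta> (g1 t) t \<in> S2"
    and ch2: "graph_chart S2 \<theta> s0 t0 \<epsilon>2 \<delta>2 g2 g2' g2''" and tr2: "\<And>t. \<bar>t - t0\<bar> < \<delta>2 \<Longrightarrow> g2'' t \<noteq> 0 \<Longrightarrow> pt \<theta> (g2 t) t \<in> S1"
    and p: "pt \<theta> s0 t0 \<in> S1" "pt \<theta> s0 t0 \<in> S2" and lim: "pt \<theta> s0 t0 islimpt (S1 \<inter> S2)"
  shows "\<exists>W. open W \<and> pt \<theta> s0 t0 \<in> W \<and> S1 \<inter> W = S2 \<inter> W"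
proof -
  note C1 = graph_chartD[OF ch1] and C2 = graph_chartD[OF ch2]
  define \<epsilon> where "\<epsilon> = min \<epsilon>1 \<epsilon>2"
  have \<epsilon>: "\<epsilon> > 0" using C1(1) C2(1) by (simp add: \<epsilon>_def)
  have g0: "g1 t0 = s0" "g2 t0 = s0"
    using C1(7)[of s0 t0] C1(1,2) C2(7)[of s0 t0] C2(1,2) p by simp_all
  have small: "\<exists>\<delta>>0. \<forall>t. \<bar>t - t0\<bar> < \<delta> \<longrightarrow> \<bar>g t - s0\<bar> < \<epsilon>" if "(g has_real_derivative c) (at t0)" "g t0 = s0" for g :: "real \<Rightarrow> real" and c
  proof -
    have "continuous (at t0) g" using DERIV_isCont[OF that(1)] .
    then obtain \<delta> where "\<delta> > 0" "\<forall>t. dist t t0 < \<delta> \<longrightarrow> dist (g t) (g t0) < \<epsilon>"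
      using \<epsilon> unfolding continuous_at_eps_delta by (metis dist_real_def)
    then show ?thesis using that(2) by (auto simp: dist_real_def)
  qed
  obtain \<eta>1 where \<eta>1: "\<eta>1 > 0" "\<And>t. \<bar>t - t0\<bar> < \<eta>1 \<Longrightarrow> \<bar>g1 t - s0\<bar> < \<epsilon>"
    using small[of g1] C1(4)[of t0] C1(2) g0 by fastforce
  obtain \<eta>2 where \<eta>2: "\<eta>2 > 0" "\<And>t. \<bar>t - t0\<bar> < \<eta>2 \<Longrightarrow> \<bar>g2 t - s0\<bar> < \<epsilon>"
    using small[of g2] C2(4)[of t0] C2(2) g0 by fastforce
  define \<delta> where "\<delta> = Min {\<delta>1, \<delta>2, \<eta>1, \<eta>2}"
  have \<delta>: "\<delta> > 0" using C1(2) C2(2) \<eta>1(1) \<eta>2(1) by (simp add: \<delta>_def)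
  have \<delta>le: "\<delta> \<le> \<delta>1" "\<delta> \<le> \<delta>2" "\<delta> \<le> \<eta>1" "\<delta> \<le> \<eta>2" by (simp_all add: \<delta>_def)
  have in1: "\<bar>t - t0\<bar> < \<delta>1" "\<bar>t - t0\<bar> < \<delta>2" "\<bar>g1 t - s0\<bar> < \<epsilon>" "\<bar>g2 t - s0\<bar> < \<epsilon>" if "\<bar>t - t0\<bar> < \<delta>" for t
    using that \<delta>le \<eta>1(2)[of t] \<eta>2(2)[of t] by auto
  define h h' h'' where "h t = g1 t - g2 t" and "h' t = g1' t - g2' t" and "h'' t = g1'' t - g2'' t" for t
  have dh: "(h has_real_derivative h' t) (at t)" "(h' has_real_derivative h'' t) (at t)" "isCont h'' t" if "\<bar>t - t0\<bar> < \<delta>" for t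
    unfolding h_def[abs_def] h'_def[abs_def] h''_def[abs_def]
    using C1(4-6)[of t] C2(4-6)[of t] in1[OF that] by (auto intro!: DERIV_diff)
  have nbhd: "\<forall>\<^sub>F x in nhds t. \<bar>x - t0\<bar> < \<delta>" if "\<bar>t - t0\<bar> < \<delta>" for t
  proof -
    have "\<forall>\<^sub>F x in nhds t. x \<in> {t0 - \<delta><..<t0 + \<delta>}"
      using that by (intro eventually_nhds_in_open) (auto simp: abs_less_iff)
    then show ?thesis by eventually_elim auto
  qed
  have curved: "h t = 0" if t: "\<bar>t - t0\<bar> < \<delta>" "h'' t \<noteq> 0" for t
  proof (cases "g1'' t = 0")
    case False
    then have "pt \<theta> (g1 t) t \<in> S2" using tr1 in1[OF t(1)] by blast
    then show ?thesis using C2(7)[of "g1 t" t] in1[OF t(1)] by (simp add: h_def \<epsilon>_def)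
  next
    case True
    then have "g2'' t \<noteq> 0" using t(2) by (simp add: h''_def)
    then have "pt \<theta> (g2 t) t \<in> S1" using tr2 in1[OF t(1)] by blast
    then show ?thesis using C1(7)[of "g2 t" t] in1[OF t(1)] by (simp add: h_def \<epsilon>_def)
  qed
  have h''0: "h'' t = 0" if t: "\<bar>t - t0\<bar> < \<delta>" for t
  proof (rule ccontr)
    assume "h'' t \<noteq> 0"
    have zero_der: "f' x = 0" if "\<forall>\<^sub>F y in nhds x. f y = 0" "(f has_real_derivative f' x) (at x)" for f f' :: "real \<Rightarrow> real" and x
    proof -
      have "(f has_real_derivative 0) (at x)" using DERIV_cong_ev[OF refl that(1) refl, THEN iffD2] by simp
      then show ?thesis using that(2) DERIV_unique by blast
    qed
    have "(h'' \<longlongrightarrow> h'' t) (nhds t)"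
      using dh(3)[OF t] by (simp add: continuous_at tendsto_at_iff_tendsto_nhds)
    then have "\<forall>\<^sub>F x in nhds t. h'' x \<noteq> 0" using \<open>h'' t \<noteq> 0\<close> by (rule tendsto_imp_eventually_ne)
    with nbhd[OF t] have ev: "\<forall>\<^sub>F x in nhds t. h x = 0 \<and> \<bar>x - t0\<bar> < \<delta>" by eventually_elim (use curved in auto)
    then have "\<forall>\<^sub>F x in nhds t. \<forall>\<^sub>F y in nhds x. h y = 0 \<and> \<bar>y - t0\<bar> < \<delta>" by (simp add: eventually_eventually)
    then have "\<forall>\<^sub>F x in nhds t. h' x = 0"
    proof eventually_elim
      case (elim x)
      then have "\<forall>\<^sub>F y in nhds x. h y = 0" by eventually_elim auto
      moreover have "\<bar>x - t0\<bar> < \<delta>" using eventually_nhds_x_imp_x[OF elim] by simp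
      ultimately show ?case using zero_der dh(1) by blast
    qed
    then have "h'' t = 0" using zero_der dh(2)[OF t] by blast
    then show False using \<open>h'' t \<noteq> 0\<close> by simp
  qed
  have h'const: "h' t = h' t0" if t: "\<bar>t - t0\<bar> < \<delta>" for t
  proof -
    have "\<exists>z. \<bar>z - t0\<bar> \<le> \<bar>t - t0\<bar> \<and> h' t - h' t0 = (t - t0) * h'' z"
      by (rule mean_value_abs, rule dh(2)) (use t in linarith)
    then show ?thesis using h''0 t by (metis diff_eq_eq add_0 mult_zero_right order.strict_trans1)
  qed
  have haff: "h t = (t - t0) * h' t0" if t: "\<bar>t - t0\<bar> < \<delta>" for t
  proof -
    have "\<exists>z. \<bar>z - t0\<bar> \<le> \<bar>t - t0\<bar> \<and> h t - h t0 = (t - t0) * h' z"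
      by (rule mean_value_abs, rule dh(1)) (use t in linarith)
    then obtain z where "\<bar>z - t0\<bar> \<le> \<bar>t - t0\<bar>" "h t - h t0 = (t - t0) * h' z" by blast
    then show ?thesis using h'const[of z] t g0 by (simp add: h_def)
  qed
  define W where "W = {x. \<bar>x \<bullet> dir \<theta> - s0\<bar> < \<epsilon> \<and> \<bar>x \<bullet> dir (\<theta> + pi / 2) - t0\<bar> < \<delta>}"
  have W: "open W" "pt \<theta> s0 t0 \<in> W" using graph_box_open \<epsilon> \<delta> by (auto simp: W_def)
  have mem: "pt \<theta> s t \<in> S1 \<longleftrightarrow> s = g1 t" "pt \<theta> s t \<in> S2 \<longleftrightarrow> s = g2 t" if "pt \<theta> s t \<in> W" for s t
    using that C1(7)[of s t] C2(7)[of s t] \<delta>le by (auto simp: W_def \<epsilon>_def)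
  obtain x where x: "x \<in> S1 \<inter> S2" "x \<in> W" "x \<noteq> pt \<theta> s0 t0" using lim W unfolding islimpt_def by blast
  obtain s t where st: "x = pt \<theta> s t" using pt_cases by blast
  have "s = g1 t" "s = g2 t" using mem[of s t] x st by auto
  then have "h t = 0" by (simp add: h_def)
  moreover have "t \<noteq> t0" using x(3) st \<open>s = g1 t\<close> g0 by auto
  moreover have "\<bar>t - t0\<bar> < \<delta>" using x(2) st by (simp add: W_def)
  ultimately have "h' t0 = 0" using haff by (metis eq_iff_diff_eq_0 mult_eq_0_iff)
  then have eq: "g1 y = g2 y" if "\<bar>y - t0\<bar> < \<delta>" for y using haff[OF that] by (simp add: h_def)
  have "x \<in> S1 \<longleftrightarrow> x \<in> S2" if "x \<in> W" for x
  proof -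
    obtain s t where st: "x = pt \<theta> s t" using pt_cases by blast
    then have "\<bar>t - t0\<bar> < \<delta>" using that by (simp add: W_def)
    then show ?thesis using mem[of s t] that st eq by simp
  qed
  then have "S1 \<inter> W = S2 \<inter> W" by blast
  then show ?thesis using W by blast
qed

text \<open>At a point farthest from the origin the curve is at least as curved as the circle around the origin.\<close>
lemma farthest_point_curved:
  fixes g g' :: "real \<Rightarrow> real"
  assumes g: "\<And>t. \<bar>t - t0\<bar> < d \<Longrightarrow> (g has_real_derivative g' t) (at t)" and g': "(g' has_real_derivative c) (at t0)"
    and d: "d > 0" and max: "\<And>t. \<bar>t - t0\<bar> < d \<Longrightarrow> (g t)\<^sup>2 + t\<^sup>2 \<le> (g t0)\<^sup>2 + t0\<^sup>2"
  shows "c \<noteq> 0"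
proof
  assume c0: "c = 0"
  define N N' where "N t = (g t)\<^sup>2 + t\<^sup>2" and "N' t = 2 * g t * g' t + 2 * t" for t
  have dN: "(N has_real_derivative N' t) (at t)" if "\<bar>t - t0\<bar> < d" for t
    unfolding N_def[abs_def] N'_def using g[OF that] by (auto intro!: derivative_eq_intros)
  have N'0: "N' t0 = 0"
    using DERIV_local_max[OF dN[of t0] d] max d by (simp add: N_def abs_minus_commute)
  \<comment> \<open>With c = 0 the second derivative of the squared distance is 2 g'^2 + 2 > 0, so
    N' is positive just to the right of its zero \<open>t0\<close> and N exceeds its
    maximum.\<close>
  have "(N' has_real_derivative 2 * (g' t0 * g' t0 + c * g t0) + 2) (at t0)"
    unfolding N'_def[abs_def] using g[of t0] g' d by (auto intro!: derivative_eq_intros simp: algebra_simps)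
  moreover have "2 * (g' t0 * g' t0 + c * g t0) + 2 > 0" using c0 by (simp add: add_nonneg_pos)
  ultimately obtain d' where d': "d' > 0" "\<And>h. 0 < h \<Longrightarrow> h < d' \<Longrightarrow> N' t0 < N' (t0 + h)"
    using DERIV_pos_inc_right by blast
  define h where "h = min d d' / 2"
  have h: "0 < h" "h < d" "h < d'" using d d'(1) by (auto simp: h_def min_def)
  have "(N has_real_derivative N' x) (at x)" if "t0 \<le> x" "x \<le> t0 + h" for x
    using that h by (intro dN) auto
  then obtain z where z: "t0 < z" "z < t0 + h" "N (t0 + h) - N t0 = (t0 + h - t0) * N' z"
    using MVT2[of t0 "t0 + h" N N'] h(1) by auto
  have "N' z > 0" using d'(2)[of "z - t0"] z h N'0 by simp
  then have "N (t0 + h) > N t0" using z(3) h(1) by (simp add: mult_pos_pos algebra_simps)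
  then show False using max[of "t0 + h"] h by (simp add: N_def)
qed

lemma islimpt_Int_open:
  "x islimpt S \<Longrightarrow> open W \<Longrightarrow> x \<in> W \<Longrightarrow> x islimpt (S \<inter> W)"
  unfolding islimpt_def by (metis Int_iff open_Int)

text \<open>Both transfers enter: near a common point either graph may be the one with nonzero
  second derivative.\<close>

lemma frontier_subset:
  assumes tr: "tangents_transfer \<Omega>1 \<Omega>2" "tangents_transfer \<Omega>2 \<Omega>1" and adm: "admissible \<Omega>1 u1" "admissible \<Omega>2 u2"
  shows "frontier \<Omega>1 \<subseteq> frontier \<Omega>2"
proof -
  let ?S1 = "frontier \<Omega>1" and ?S2 = "frontier \<Omega>2"
  note a1 = admissibleD[OF adm(1)] and a2 = admissibleD[OF adm(2)]
  have chart1: "\<exists>\<theta> s0 t0 \<epsilon> \<delta> g g' g''. p = pt \<theta> s0 t0 \<and> graph_chart ?S1 \<theta> s0 t0 \<epsilon> \<delta> g g' g'' \<and>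
      (\<forall>t. \<bar>t - t0\<bar> < \<delta> \<longrightarrow> g'' t \<noteq> 0 \<longrightarrow> pt \<theta> (g t) t \<in> ?S2)" if p: "p \<in> ?S1" for p
  proof -
    obtain U \<rho> where ld: "local_defining \<Omega>1 U \<rho>" and pU: "p \<in> U" using smooth_boundaryE[OF a1(4) p] .
    obtain \<theta> where nz: "slope \<rho> (dir \<theta>) p \<noteq> 0" using common_frame[OF ld ld pU pU] by blast
    obtain s0 t0 where st: "p = pt \<theta> s0 t0" using pt_cases by blast
    obtain \<epsilon> \<delta> g g' g'' where "graph_chart ?S1 \<theta> s0 t0 \<epsilon> \<delta> g g' g''"
      "\<And>t. \<bar>t - t0\<bar> < \<delta> \<Longrightarrow> g'' t \<noteq> 0 \<Longrightarrow> pt \<theta> (g t) t \<in> ?S2"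
      by (rule transfer_chart[OF tr(1) adm ld pU[unfolded st] p[unfolded st] nz[unfolded st]]) blast
    then show ?thesis using st by blast
  qed
  \<comment> \<open>Accumulation points rather than the whole intersection: at an isolated crossing
    the boundaries need not agree.\<close>
  define A where "A = {p. p islimpt (?S1 \<inter> ?S2)}"
  have Acl: "closed A" unfolding A_def by (rule closed_limpts)
  have Asub: "A \<subseteq> ?S1 \<inter> ?S2"
    unfolding A_def using closed_limpt[of "?S1 \<inter> ?S2"] closed_Int[OF frontier_closed frontier_closed] by blast
  have lim1: "p islimpt ?S1" if p: "p \<in> ?S1" for p
  proof -
    obtain \<theta> s0 t0 \<epsilon> \<delta> g g' g'' where c: "p = pt \<theta> s0 t0" "graph_chart ?S1 \<theta> s0 t0 \<epsilon> \<delta> g g' g''"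
      using chart1[OF p] by blast
    note C = graph_chartD[OF c(2)]
    show ?thesis unfolding c(1)
    proof (rule graph_chart_islimpt[OF c(2)])
      show "pt \<theta> (g t) t \<in> ?S1" if "\<bar>t - t0\<bar> < \<delta>" for t using C(3,7) that by blast
    qed (use C(2) p c(1) in auto)
  qed
  have Aopen: "\<exists>W. open W \<and> p \<in> W \<and> ?S1 \<inter> W \<subseteq> A" if p: "p \<in> A" for p
  proof -
    have p12: "p \<in> ?S1" "p \<in> ?S2" using p Asub by auto
    obtain U1 \<rho>1 where ld1: "local_defining \<Omega>1 U1 \<rho>1" and pU1: "p \<in> U1" using smooth_boundaryE[OF a1(4) p12(1)] .
    obtain U2 \<rho>2 where ld2: "local_defining \<Omega>2 U2 \<rho>2" and pU2: "p \<in> U2" using smooth_boundaryE[OF a2(4) p12(2)] .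
    obtain \<theta> where nz: "slope \<rho>1 (dir \<theta>) p \<noteq> 0" "slope \<rho>2 (dir \<theta>) p \<noteq> 0" using common_frame[OF ld1 ld2 pU1 pU2] by blast
    obtain s0 t0 where st: "p = pt \<theta> s0 t0" using pt_cases by blast
    obtain \<epsilon>1 \<delta>1 g1 g1' g1'' where c1: "graph_chart ?S1 \<theta> s0 t0 \<epsilon>1 \<delta>1 g1 g1' g1''"
      "\<And>t. \<bar>t - t0\<bar> < \<delta>1 \<Longrightarrow> g1'' t \<noteq> 0 \<Longrightarrow> pt \<theta> (g1 t) t \<in> ?S2"
      by (rule transfer_chart[OF tr(1) adm ld1 pU1[unfolded st] p12(1)[unfolded st] nz(1)[unfolded st]]) blast
    obtain \<epsilon>2 \<delta>2 g2 g2' g2'' where c2: "graph_chart ?S2 \<theta> s0 t0 \<epsilon>2 \<delta>2 g2 g2' g2''"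
      "\<And>t. \<bar>t - t0\<bar> < \<delta>2 \<Longrightarrow> g2'' t \<noteq> 0 \<Longrightarrow> pt \<theta> (g2 t) t \<in> ?S1"
      by (rule transfer_chart[OF tr(2) adm(2,1) ld2 pU2[unfolded st] p12(2)[unfolded st] nz(2)[unfolded st]]) blast
    have "pt \<theta> s0 t0 islimpt (?S1 \<inter> ?S2)" using p st by (simp add: A_def)
    from graphs_coincide[OF c1 c2 _ _ this] p12 st
    obtain W where W: "open W" "p \<in> W" "?S1 \<inter> W = ?S2 \<inter> W" by auto
    have "?S1 \<inter> W \<subseteq> A"
    proof
      fix x assume x: "x \<in> ?S1 \<inter> W"
      then have "x islimpt (?S1 \<inter> W)" using lim1 W(1) by (intro islimpt_Int_open) auto
      moreover have "?S1 \<inter> W \<subseteq> ?S1 \<inter> ?S2" using W(3) by blast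
      ultimately show "x \<in> A" unfolding A_def using islimpt_subset by blast
    qed
    then show ?thesis using W by blast
  qed
  \<comment> \<open>Relative openness of \<open>A\<close>, expressed by one open set that meets
    \<open>frontier \<Omega>1\<close> only in \<open>A\<close>; removing it leaves a compact set,
    which has a farthest point.\<close>
  define O' where "O' = \<Union>{W. open W \<and> ?S1 \<inter> W \<subseteq> A}"
  have "open O'" unfolding O'_def by (intro open_Union) auto
  moreover have C_eq: "?S1 - A = ?S1 - O'" unfolding O'_def using Aopen by blast
  moreover have "compact ?S1" using a1(1) by (rule compact_frontier)
  ultimately have comp: "compact (?S1 - A)" by (simp add: compact_diff)
  have "?S1 - A = {}"
  proof (rule ccontr)
    assume "?S1 - A \<noteq> {}"
    then obtain x where x: "x \<in> ?S1 - A" "\<And>y. y \<in> ?S1 - A \<Longrightarrow> dist 0 y \<le> dist 0 x"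
      using distance_attains_sup[OF comp, of 0] by blast
    \<comment> \<open>\<open>A\<close> is closed, so near \<open>x\<close> all of
      \<open>frontier \<Omega>1\<close> lies in the complement, and \<open>x\<close> is a local
      maximum of the distance along the whole boundary curve.\<close>
    have "open (- A)" using Acl by auto
    then have "\<exists>r>0. ball x r \<subseteq> - A" using x(1) by (auto elim: openE)
    then obtain r where r: "r > 0" "ball x r \<subseteq> - A" by blast
    obtain \<theta> s0 t0 \<epsilon> \<delta> g g' g'' where c: "x = pt \<theta> s0 t0" "graph_chart ?S1 \<theta> s0 t0 \<epsilon> \<delta> g g' g''"
      "\<And>t. \<bar>t - t0\<bar> < \<delta> \<Longrightarrow> g'' t \<noteq> 0 \<Longrightarrow> pt \<theta> (g t) t \<in> ?S2"
      using chart1[of x] x(1) by blast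
    note C = graph_chartD[OF c(2)]
    have g0: "g t0 = s0" using C(7)[of s0 t0] C(1,2) x(1) c(1) by simp
    have gS: "pt \<theta> (g t) t \<in> ?S1" if "\<bar>t - t0\<bar> < \<delta>" for t using C(3,7) that by blast
    have "isCont g t0" using C(4)[of t0] C(2) DERIV_isCont by simp
    then have "(g \<longlongrightarrow> g t0) (nhds t0)" by (simp add: continuous_at tendsto_at_iff_tendsto_nhds)
    then have "((\<lambda>t. pt \<theta> (g t) t) \<longlongrightarrow> x) (nhds t0)" unfolding c(1) g0[symmetric] by (intro tendsto_pt filterlim_ident)
    then have "\<forall>\<^sub>F t in nhds t0. pt \<theta> (g t) t \<in> ball x r" using r(1) by (intro topological_tendstoD) auto
    then obtain d1 where d1: "d1 > 0" "\<And>t. \<bar>t - t0\<bar> < d1 \<Longrightarrow> pt \<theta> (g t) t \<in> ball x r"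
      by (auto simp: eventually_nhds_metric dist_real_def)
    define d where "d = min d1 \<delta>"
    have d: "d > 0" using d1(1) C(2) by (simp add: d_def)
    have "g'' t0 \<noteq> 0"
    proof (rule farthest_point_curved[OF _ _ d])
      show "(g has_real_derivative g' t) (at t)" if "\<bar>t - t0\<bar> < d" for t using C(4) that by (simp add: d_def)
      show "(g' has_real_derivative g'' t0) (at t0)" using C(5)[of t0] C(2) by simp
      fix t assume t: "\<bar>t - t0\<bar> < d"
      then have "pt \<theta> (g t) t \<in> ?S1 - A" using gS[of t] d1(2)[of t] r(2) by (auto simp: d_def)
      then have "norm (pt \<theta> (g t) t) \<le> norm (pt \<theta> (g t0) t0)" using x(2) c(1) g0 by fastforce
      then have "(norm (pt \<theta> (g t) t))\<^sup>2 \<le> (norm (pt \<theta> (g t0) t0))\<^sup>2" by (intro power_mono) auto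
      then show "(g t)\<^sup>2 + t\<^sup>2 \<le> (g t0)\<^sup>2 + t0\<^sup>2" by (simp add: norm_pt)
    qed
    moreover have "(g'' \<longlongrightarrow> g'' t0) (nhds t0)"
      using C(6)[of t0] C(2) by (simp add: continuous_at tendsto_at_iff_tendsto_nhds)
    ultimately have "\<forall>\<^sub>F t in nhds t0. g'' t \<noteq> 0" by (intro tendsto_imp_eventually_ne)
    then obtain d2 where d2: "d2 > 0" "\<And>t. \<bar>t - t0\<bar> < d2 \<Longrightarrow> g'' t \<noteq> 0"
      by (auto simp: eventually_nhds_metric dist_real_def)
    \<comment> \<open>Nonzero curvature persists near \<open>x\<close>, and points of nonzero
      curvature lie on \<open>frontier \<Omega>2\<close>; so common points accumulate at
      \<open>x\<close>, against \<open>x \<notin> A\<close>.\<close>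
    have "pt \<theta> s0 t0 islimpt (?S1 \<inter> ?S2)"
    proof (rule graph_chart_islimpt[OF c(2)])
      show "min d2 \<delta> > 0" using d2(1) C(2) by simp
      show "pt \<theta> (g t) t \<in> ?S1 \<inter> ?S2" if "\<bar>t - t0\<bar> < min d2 \<delta>" for t
        using gS[of t] c(3)[of t] d2(2)[of t] that by simp
    qed (use x(1) c(1) in simp)
    then show False using x(1) c(1) by (simp add: A_def)
  qed
  then show ?thesis using Asub by blast
qed

theorem corollary4p16:
  fixes a b \<psi> c0 l :: real
    and \<phi> w u1 u2 :: "real^2 \<Rightarrow> real"
    and \<Omega>1 \<Omega>2 :: "(real^2) set"
  assumes "a > 0" and "b > 0" and "2 * \<psi> \<in> {0<..<pi}" and "c0 > 0"
    and "smooth_on UNIV w" and "\<And>x. x \<in> ball 0 1 \<Longrightarrow> w x > 0"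
    and "smoothing_kernel \<phi>"
    and "l > 1" and "(\<lambda>x. complex_of_real (\<phi> x)) \<in> sobolev_inf l"
    and "admissible \<Omega>1 u1" and "admissible \<Omega>2 u2"
    and "\<And>s \<theta>. \<theta> \<in> {-pi..pi} \<Longrightarrow>
           R_transform a b \<psi> \<phi> c0 w (cutoff u1 \<Omega>1) s \<theta> =
           R_transform a b \<psi> \<phi> c0 w (cutoff u2 \<Omega>2) s \<theta>"
  shows "frontier \<Omega>1 = frontier \<Omega>2"
proof -
  have L2: "integrable lborel (\<lambda>x. (\<phi> x)\<^sup>2)"
    using smoothing_kernel_square_integrable[OF assms(7-9)] .
  \<comment> \<open>Stated for an arbitrary ordered pair: the hypotheses are symmetric, and the
    result is used in both directions.\<close>
  have transfer: "tangents_transfer \<Omega> \<Omega>'"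
    if adm: "admissible \<Omega> u" "admissible \<Omega>' u'"
      and eq: "\<And>s \<theta>. \<theta> \<in> {-pi..pi} \<Longrightarrow> R_transform a b \<psi> \<phi> c0 w (cutoff u \<Omega>) s \<theta> = R_transform a b \<psi> \<phi> c0 w (cutoff u' \<Omega>') s \<theta>"
    for \<Omega> \<Omega>' u u'
    unfolding tangents_transfer_def
  proof (intro ballI allI impI)
    fix \<theta> U \<rho> s0 t0
    assume \<theta>: "\<theta> \<in> {-pi..pi}" and h: "local_defining \<Omega> U \<rho>" "pt \<theta> s0 t0 \<in> U" "\<rho> (pt \<theta> s0 t0) = 0"
      "slope \<rho> (dir (\<theta> + pi / 2)) (pt \<theta> s0 t0) = 0"
      "slope (slope \<rho> (dir (\<theta> + pi / 2))) (dir (\<theta> + pi / 2)) (pt \<theta> s0 t0) \<noteq> 0"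
      and uniq: "\<forall>t. tangent_dir \<Omega> (pt \<theta> s0 t) (dir (\<theta> + pi / 2)) \<longrightarrow> t = t0"
    show "\<exists>t. tangent_dir \<Omega>' (pt \<theta> s0 t) (dir (\<theta> + pi / 2))"
      by (rule curved_tangent_transfer[OF assms(1,2,4-7) L2 adm eq[OF \<theta>] h]) (use uniq in auto)
  qed
  have "tangents_transfer \<Omega>1 \<Omega>2" "tangents_transfer \<Omega>2 \<Omega>1"
    using transfer[OF assms(10,11)] transfer[OF assms(11,10)] assms(12) by auto
  then show ?thesis using frontier_subset assms(10,11) by (intro subset_antisym) auto
qed

end
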